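(* Let $(W,U,V)$ be an admissible Nudelman data set ($W$ of size $\delta\times\delta$, $U,V$ of size $p\times\delta$) with $U^*U+W^*W=I_\delta$, and let $(\mathcal{U},\mathcal{V})=\tau(W,U,V)$. Let $G(z)$ be a $p\times p$ lossless function with a unitary realization matrix $R=\begin{pmatrix}D&C\\ B&A\end{pmatrix}$, $A$ of size $k\times k$. Then $$\widetilde R=\begin{pmatrix}\widetilde D&\widetilde C\\\widetilde B&\widetilde A\end{pmatrix}=\begin{pmatrix}\mathcal{U}&0\\0&I_k\end{pmatrix}\begin{pmatrix}D&0&C\\0&I_\delta&0\\ B&0&A\end{pmatrix}\begin{pmatrix}\mathcal{V}^*&0\\0&I_k\end{pmatrix}$$ ($\widetilde D$ of size $p\times p$, $\widetilde A$ of size $(\delta+k)\times(\delta+k)$) is a unitary realization matrix of $\widetilde G=T_{\hat\Theta_{W,U,V}}(G)$.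
   Context: $^*$ denotes conjugate transpose, $M^{-*}=(M^{-1})^*$, $J=\begin{pmatrix}I_p&0\\0&-I_p\end{pmatrix}$; square roots of positive definite matrices are the Hermitian positive ones. A $p\times p$ rational matrix function $G$ is lossless if $G(z)G(z)^*\le I_p$ for $|z|>1$, with equality for $|z|=1$. The realization matrix of a realization $G(z)=D+C(zI_k-A)^{-1}B$ is $\begin{pmatrix}D&C\\ B&A\end{pmatrix}$. For $\Theta=(\Theta_{ij})_{i,j=1,2}$ with $p\times p$ blocks, $T_\Theta(F)=(\Theta_{11}F+\Theta_{12})(\Theta_{21}F+\Theta_{22})^{-1}$. A matrix is stable if its eigenvalues lie in the open unit disk. An admissible Nudelman data set is a triple $(W,U,V)$ with $W\in\mathbb{C}^{\delta\times\delta}$ stable, $U,V\in\mathbb{C}^{p\times\delta}$, $(U,W)$ observable, such that the solution $P$ of $P-W^*PW=U^*U-V^*V$ is positive definite. Definition of $\tau$ (when $U^*U+W^*W=I_\delta$): let $T=P^{1/2}$, $\tilde U=UT^{-1}$, $\tilde W=TWT^{-1}$, $\tilde V=VT^{-1}$, $X=I_p-U(I_\delta-W^* )^{-1}U^*$, $Y=(I_\delta-W)(I_\delta-W^* )^{-1}U^*$, $K=\tilde U^*\tilde U+\tilde W^*\tilde W=I_\delta+\tilde V^*\tilde V$, $L=\tilde U^*X+\tilde W^*TY$, $Z=X^*X+Y^*P^{-1}Y$. Then $\tau(W,U,V)=(\mathcal{U},\mathcal{V})$ with the unitary matrices $$\mathcal{U}=\begin{pmatrix}X&\tilde U\\ TY&\tilde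 W\end{pmatrix}\begin{pmatrix}Z^{1/2}&0\\-K^{-1}LZ^{1/2}&K^{-1/2}\end{pmatrix},\qquad\mathcal{V}=\begin{pmatrix}(I_p+\tilde V\tilde V^* )^{-1/2}&\tilde V(I_\delta+\tilde V^*\tilde V)^{-1/2}\\-\tilde V^*(I_p+\tilde V\tilde V^* )^{-1/2}&(I_\delta+\tilde V^*\tilde V)^{-1/2}\end{pmatrix}.$$ Definition of $\hat\Theta_{W,U,V}$: write $\mathcal{U}=\begin{pmatrix}M_u&\alpha_u\\\beta_u^*&K_u\end{pmatrix}$, $\mathcal{V}=\begin{pmatrix}M_v&\alpha_v\\\beta_v^*&K_v\end{pmatrix}$ ($M_u,M_v$ of size $p\times p$), $M=\begin{pmatrix}M_u&0\\0&M_v\end{pmatrix}$, $\alpha=\begin{pmatrix}\alpha_u\\\alpha_v\end{pmatrix}$, $\beta=\begin{pmatrix}\beta_u\\\beta_v\end{pmatrix}$, $H_{\mathcal{U},\mathcal{V}}=M+\alpha(K_v-K_u)^{-1}\beta^*J$. With $\mathcal{C}=\begin{pmatrix}U\\ V\end{pmatrix}$, $\Theta_{W,U,V}(z)=I_{2p}-(z-1)\mathcal{C}(zI_\delta-W)^{-1}P^{-1}(I_\delta-W)^{-*}\mathcal{C}^*J$, and $\hat\Theta_{W,U,V}=\Theta_{W,U,V}H_{\mathcal{U},\mathcal{V}}$. *)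

theory Defs
  imports
    "HOL-Computational_Algebra.Computational_Algebra"
    "HOL-Computational_Algebra.Field_as_Ring"
    "Jordan_Normal_Form.Schur_Decomposition"
    "Jordan_Normal_Form.Matrix_Kernel"
    "Jordan_Normal_Form.Gauss_Jordan_Elimination"
begin

notation mat_adjoint ("_\<^sup>\<dagger>" [1000] 999)

definition minv :: "'a :: field mat \<Rightarrow> 'a mat" where
  "minv A = the (mat_inverse A)"

definition hermitian_mat :: "complex mat \<Rightarrow> bool" where
  "hermitian_mat A \<longleftrightarrow> square_mat A \<and> A\<^sup>\<dagger> = A"

definition unitary_mat :: "complex mat \<Rightarrow> bool" where
  "unitary_mat A \<longleftrightarrow> square_mat A \<and> inverts_mat A (A\<^sup>\<dagger>) \<and> inverts_mat (A\<^sup>\<dagger>) A"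

definition pos_def :: "complex mat \<Rightarrow> bool" where
  "pos_def A \<longleftrightarrow> hermitian_mat A \<and>
    (\<forall>v \<in> carrier_vec (dim_row A). v \<noteq> 0\<^sub>v (dim_row A) \<longrightarrow> Re ((A *\<^sub>v v) \<bullet>c v) > 0)"

definition pos_semidef :: "complex mat \<Rightarrow> bool" where
  "pos_semidef A \<longleftrightarrow> hermitian_mat A \<and>
    (\<forall>v \<in> carrier_vec (dim_row A). Re ((A *\<^sub>v v) \<bullet>c v) \<ge> 0)"

definition msqrt :: "complex mat \<Rightarrow> complex mat" where
  "msqrt A = (THE S. pos_def S \<and> S * S = A)"

definition stable :: "complex mat \<Rightarrow> bool" where
  "stable A \<longleftrightarrow> (\<forall>e. eigenvalue A e \<longrightarrow> cmod e < 1)"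

definition observable :: "complex mat \<Rightarrow> complex mat \<Rightarrow> bool" where
  "observable C A \<longleftrightarrow> (\<Inter>j. mat_kernel (C * (A ^\<^sub>m j))) = {0\<^sub>v (dim_col C)}"

definition append_cols :: "'a :: zero mat \<Rightarrow> 'a mat \<Rightarrow> 'a mat" (infixr "@\<^sub>c" 65) where
  "A @\<^sub>c B = four_block_mat A B (0\<^sub>m 0 (dim_col A)) (0\<^sub>m 0 (dim_col B))"

definition signature_mat :: "nat \<Rightarrow> complex mat" where
  "signature_mat p = four_block_mat (1\<^sub>m p) (0\<^sub>m p p) (0\<^sub>m p p) (- 1\<^sub>m p)"


subsection \<open>Rational matrix functions\<close>

text \<open>
  A rational function is an element of the field of fractions of the complex polynomials,
  and a rational matrix function is a matrix over that field.  Identities and inverses of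
  rational matrix functions are thus identities and inverses over \<open>\<complex>(z)\<close>.
\<close>

type_synonym rat_mat = "complex poly fract mat"

definition rat_const :: "complex mat \<Rightarrow> rat_mat" where
  "rat_const A = map_mat (\<lambda>c. Fract [:c:] 1) A"

definition rat_var :: "complex poly fract" where
  "rat_var = Fract [:0, 1:] 1"

definition resolvent :: "complex mat \<Rightarrow> rat_mat" where
  "resolvent A = minv (rat_var \<cdot>\<^sub>m 1\<^sub>m (dim_row A) - rat_const A)"

text \<open>
  \<^const>\<open>quot_of_fract\<close> yields a coprime numerator and denominator, so the zeros of the
  denominator are exactly the poles.
\<close>

definition rat_pole :: "complex poly fract \<Rightarrow> complex \<Rightarrow> bool" where
  "rat_pole f w \<longleftrightarrow> poly (snd (quot_of_fract f)) w = 0"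

definition rat_eval :: "complex poly fract \<Rightarrow> complex \<Rightarrow> complex" where
  "rat_eval f w = poly (fst (quot_of_fract f)) w / poly (snd (quot_of_fract f)) w"

definition mat_regular_at :: "rat_mat \<Rightarrow> complex \<Rightarrow> bool" where
  "mat_regular_at G w \<longleftrightarrow> (\<forall>f \<in> elements_mat G. \<not> rat_pole f w)"

definition mat_eval :: "rat_mat \<Rightarrow> complex \<Rightarrow> complex mat" where
  "mat_eval G w = map_mat (\<lambda>f. rat_eval f w) G"

definition lossless :: "nat \<Rightarrow> rat_mat \<Rightarrow> bool" where
  "lossless p G \<longleftrightarrow> G \<in> carrier_mat p p \<and>
    (\<forall>w. cmod w > 1 \<longrightarrow> mat_regular_at G w \<and>
       pos_semidef (1\<^sub>m p - mat_eval G w * (mat_eval G w)\<^sup>\<dagger>)) \<and>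
    (\<forall>w. cmod w = 1 \<longrightarrow> mat_regular_at G w \<and>
       mat_eval G w * (mat_eval G w)\<^sup>\<dagger> = 1\<^sub>m p)"

definition realization_mat :: "nat \<Rightarrow> nat \<Rightarrow> complex mat \<Rightarrow> rat_mat \<Rightarrow> bool" where
  "realization_mat p n R G \<longleftrightarrow> R \<in> carrier_mat (p + n) (p + n) \<and>
    (case split_block R p p of (D, C, B, A) \<Rightarrow>
      G = rat_const D + rat_const C * resolvent A * rat_const B)"

definition lft :: "nat \<Rightarrow> rat_mat \<Rightarrow> rat_mat \<Rightarrow> rat_mat" where
  "lft p \<Theta> F = (case split_block \<Theta> p p of (\<Theta>11, \<Theta>12, \<Theta>21, \<Theta>22) \<Rightarrow>
    (\<Theta>11 * F + \<Theta>12) * minv (\<Theta>21 * F + \<Theta>22))"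

definition lft_defined :: "nat \<Rightarrow> rat_mat \<Rightarrow> rat_mat \<Rightarrow> bool" where
  "lft_defined p \<Theta> F \<longleftrightarrow> (case split_block \<Theta> p p of (\<Theta>11, \<Theta>12, \<Theta>21, \<Theta>22) \<Rightarrow>
    invertible_mat (\<Theta>21 * F + \<Theta>22))"


subsection \<open>Nudelman data\<close>

text \<open>The solution of the Stein equation, which is unique for stable \<open>W\<close>.\<close>

definition stein_sol :: "complex mat \<Rightarrow> complex mat \<Rightarrow> complex mat \<Rightarrow> complex mat" where
  "stein_sol W U V = (THE P. P \<in> carrier_mat (dim_row W) (dim_row W) \<and>
     P - W\<^sup>\<dagger> * P * W = U\<^sup>\<dagger> * U - V\<^sup>\<dagger> * V)"

definition admissible ::
  "nat \<Rightarrow> nat \<Rightarrow> complex mat \<Rightarrow> complex mat \<Rightarrow> complex mat \<Rightarrow> bool" where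
  "admissible p d W U V \<longleftrightarrow>
     W \<in> carrier_mat d d \<and> U \<in> carrier_mat p d \<and> V \<in> carrier_mat p d \<and>
     stable W \<and> observable U W \<and> pos_def (stein_sol W U V)"

definition tau ::
  "complex mat \<Rightarrow> complex mat \<Rightarrow> complex mat \<Rightarrow> complex mat \<times> complex mat" where
  "tau W U V = (let
     p = dim_row U; d = dim_row W;
     P = stein_sol W U V;
     T = msqrt P;
     Ut = U * minv T;
     Wt = T * W * minv T;
     Vt = V * minv T;
     X = 1\<^sub>m p - U * minv (1\<^sub>m d - W\<^sup>\<dagger>) * U\<^sup>\<dagger>;
     Y = (1\<^sub>m d - W) * minv (1\<^sub>m d - W\<^sup>\<dagger>) * U\<^sup>\<dagger>;
     K = Ut\<^sup>\<dagger> * Ut + Wt\<^sup>\<dagger> * Wt;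
     L = Ut\<^sup>\<dagger> * X + Wt\<^sup>\<dagger> * T * Y;
     Z = X\<^sup>\<dagger> * X + Y\<^sup>\<dagger> * minv P * Y;
     Rp = minv (msqrt (1\<^sub>m p + Vt * Vt\<^sup>\<dagger>));
     Rd = minv (msqrt (1\<^sub>m d + Vt\<^sup>\<dagger> * Vt))
   in
     (four_block_mat X Ut (T * Y) Wt *
        four_block_mat (msqrt Z) (0\<^sub>m p d) (- (minv K * L * msqrt Z)) (minv (msqrt K)),
      four_block_mat Rp (Vt * Rd) (- (Vt\<^sup>\<dagger> * Rp)) Rd))"

definition coupling_defined :: "nat \<Rightarrow> complex mat \<Rightarrow> complex mat \<Rightarrow> bool" where
  "coupling_defined p \<U> \<V> \<longleftrightarrow>
    (case split_block \<U> p p of (Mu, au, bu', Ku) \<Rightarrow>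
     case split_block \<V> p p of (Mv, av, bv', Kv) \<Rightarrow> invertible_mat (Kv - Ku))"

definition H_mat :: "nat \<Rightarrow> complex mat \<Rightarrow> complex mat \<Rightarrow> complex mat" where
  "H_mat p \<U> \<V> =
    (case split_block \<U> p p of (Mu, au, bu', Ku) \<Rightarrow>
     case split_block \<V> p p of (Mv, av, bv', Kv) \<Rightarrow>
      let M = four_block_mat Mu (0\<^sub>m p p) (0\<^sub>m p p) Mv;
          \<alpha> = au @\<^sub>r av;
          \<beta> = bu'\<^sup>\<dagger> @\<^sub>r bv'\<^sup>\<dagger>
      in M + \<alpha> * minv (Kv - Ku) * \<beta>\<^sup>\<dagger> * signature_mat p)"

definition Theta :: "complex mat \<Rightarrow> complex mat \<Rightarrow> complex mat \<Rightarrow> rat_mat" where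
  "Theta W U V = (let
     p = dim_row U; d = dim_row W;
     P = stein_sol W U V;
     C = U @\<^sub>r V
   in 1\<^sub>m (2 * p) - (rat_var - 1) \<cdot>\<^sub>m
      (rat_const C * resolvent W *
       rat_const (minv P * (minv (1\<^sub>m d - W))\<^sup>\<dagger> * C\<^sup>\<dagger> * signature_mat p)))"

definition Theta_hat :: "complex mat \<Rightarrow> complex mat \<Rightarrow> complex mat \<Rightarrow> rat_mat" where
  "Theta_hat W U V =
    (case tau W U V of (\<U>, \<V>) \<Rightarrow> Theta W U V * rat_const (H_mat (dim_row U) \<U> \<V>))"

end

theory Submission
  imports Defs "Jordan_Normal_Form.Spectral_Radius"
begin

text \<open>The transfer function of \<open>R'\<close> is the closed loop of one linear system, read in two ways.  Feed
  \<open>G\<close> with the identity; the state of \<open>G\<close> is then \<open>\<xi> = (z - A)\<^sup>-\<^sup>1 B\<close>.  Add a \<open>\<delta>\<close>-dimensional signal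
  \<open>f\<close> that bypasses \<open>G\<close>, and put \<open>(u, s) = \<V>(1, f)\<close> and \<open>(y, s') = \<U>(G, f)\<close>.  The three factors of
  \<open>R'\<close> undo \<open>\<V>\<close>, apply \<open>R\<close> to \<open>(1, \<xi>)\<close>, and apply \<open>\<U>\<close>, so that \<open>R' (u, s, \<xi>) = (y, s', z\<xi>)\<close>.  If the
  loop is closed by \<open>s' = z s\<close>, then \<open>(s, \<xi>)\<close> is the state of \<open>R'\<close> for the input \<open>u\<close>, and \<open>R'\<close>
  realizes \<open>y u\<^sup>-\<^sup>1\<close>.  The inverse exists because \<open>1\<close> is the first component of \<open>\<V>\<^sup>\<dagger> (u, s)\<close>, while
  \<open>s\<close> is a matrix times \<open>u\<close>.  This is \<open>closed_loop_realization\<close>.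

  It remains to see that \<open>\<Theta> H (G, 1) = (y, u)\<close> for this closed loop.  Let \<open>T\<close> be the square root of the Stein solution \<open>P\<close>, and write
  \<open>\<beta>\<^sub>u\<^sup>*\<close>, \<open>\<beta>\<^sub>v\<^sup>*\<close> for the lower left blocks of \<open>\<U>\<close>, \<open>\<V>\<close>.  Since \<open>K\<^sub>v - K\<^sub>u = T (1 - W) T\<^sup>-\<^sup>1 K\<^sub>v\<close>, the constant
  matrix \<open>H\<close> sends \<open>(G, 1)\<close> to \<open>(M\<^sub>u G + U q, M\<^sub>v + V q)\<close> with
  \<open>q = (1 - W)\<^sup>-\<^sup>1 T\<^sup>-\<^sup>1 (\<beta>\<^sub>u\<^sup>* G - \<beta>\<^sub>v\<^sup>*)\<close>; this is the loop with \<open>z\<close> frozen at \<open>1\<close> (\<open>H_mat_apply\<close>).  Multiplication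
  by \<open>\<Theta>\<close> moves the frequency from \<open>1\<close> to \<open>z\<close>: it replaces \<open>q\<close> by
  \<open>r = (z - W)\<^sup>-\<^sup>1 T\<^sup>-\<^sup>1 (\<beta>\<^sub>u\<^sup>* G - z \<beta>\<^sub>v\<^sup>*)\<close> (\<open>Theta_apply\<close>).  The Stein equation and the orthogonality of the two block
  columns of \<open>\<U>\<close> and of \<open>\<V>\<close>, in the form \<open>U\<^sup>\<dagger> M\<^sub>u + W\<^sup>\<dagger> T \<beta>\<^sub>u\<^sup>* = 0\<close> and \<open>V\<^sup>\<dagger> M\<^sub>v + T \<beta>\<^sub>v\<^sup>* = 0\<close>, are what makes
  this work.  The signal \<open>f = K\<^sub>v\<^sup>-\<^sup>1 T r\<close> then closes the loop.

  Unitarity of \<open>R'\<close> reduces to that of \<open>\<U>\<close> and \<open>\<V>\<close>.  The matrix \<open>\<V>\<close> is a Halmos dilation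
  (\<open>halmos_unitary\<close>).  For \<open>\<U>\<close>, the blocks \<open>X\<close>, \<open>Y\<close> complete the isometric block column of \<open>U\<close> and \<open>W\<close> to a unitary matrix
  (\<open>isometry_completion\<close>).  Conjugation with \<open>T\<close> destroys unitarity, but \<open>Z\<close> is the corner of the inverse
  Gram matrix, that is, the inverse of the Schur complement of \<open>K\<close>, and therefore the triangular
  factor in the definition of \<open>\<U>\<close> restores it (\<open>schur_complement_inverse\<close>,
  \<open>schur_complement_normalization\<close>).

  Two facts of matrix analysis give meaning to the definitions: positive definite matrices have
  exactly one positive definite square root, and the Stein equation of a stable matrix has exactly
  one solution.\<close>


section \<open>Matrix algebra modulo dimensions\<close>

text \<open>The ring laws of rectangular matrices are stated here with side conditions on \<^const>\<open>dim_row\<close> and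
  \<^const>\<open>dim_col\<close>, which the simplifier discharges by evaluation.  The carrier versions would make it guess
  intermediate dimensions.  The collections \<open>mat_ring\<close> and \<open>mat_ac\<close> normalize expressions to sums of
  signed products.\<close>

lemma mat_assoc: fixes A :: "'a::semiring_0 mat" shows
  "dim_col A = dim_row B \<Longrightarrow> dim_col B = dim_row C \<Longrightarrow> (A * B) * C = A * (B * C)"
  by (rule assoc_mult_mat[of A "dim_row A" "dim_col A" B "dim_col B" C "dim_col C"]) auto

lemma mat_add_mult: fixes A :: "'a::semiring_0 mat" shows
  "dim_row A = dim_row B \<Longrightarrow> dim_col A = dim_col B \<Longrightarrow> dim_col B = dim_row C \<Longrightarrow> (A + B) * C = A * C + B * C"
  by (rule add_mult_distrib_mat[of A "dim_row A" "dim_col A" B C "dim_col C"]) auto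

lemma mat_mult_add: fixes A :: "'a::semiring_0 mat" shows
  "dim_row C = dim_row B \<Longrightarrow> dim_col C = dim_col B \<Longrightarrow> dim_col A = dim_row C \<Longrightarrow> A * (B + C) = A * B + A * C"
  by (rule mult_add_distrib_mat[of A "dim_row A" "dim_col A" B "dim_col B" C]) auto

lemma mat_uminus_mult: fixes A :: "'a::ring mat" shows
  "dim_col A = dim_row B \<Longrightarrow> (- A) * B = - (A * B)"
  by (rule eq_matI) (auto simp: scalar_prod_def sum_negf)

lemma mat_mult_uminus: fixes A :: "'a::ring mat" shows
  "dim_col A = dim_row B \<Longrightarrow> A * (- B) = - (A * B)"
  by (rule eq_matI) (auto simp: scalar_prod_def sum_negf)

lemma mat_diff: fixes A :: "'a::ring mat" shows
  "dim_row A = dim_row B \<Longrightarrow> dim_col A = dim_col B \<Longrightarrow> A - B = A + (- B)"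
  by (rule eq_matI) auto

lemma mat_uminus_add: fixes A :: "'a::ring mat" shows
  "dim_row A = dim_row B \<Longrightarrow> dim_col A = dim_col B \<Longrightarrow> - (A + B) = - A + (- B)"
  by (rule eq_matI) auto

lemma mat_uminus_uminus: fixes A :: "'a::ring mat" shows "- (- A) = A"
  by (rule eq_matI) auto

lemma mat_add_comm: fixes A :: "'a::ab_semigroup_add mat" shows
  "dim_row A = dim_row B \<Longrightarrow> dim_col A = dim_col B \<Longrightarrow> A + B = B + A"
  by (rule eq_matI) (auto simp: ac_simps)

lemma mat_add_assoc: fixes A :: "'a::ab_semigroup_add mat" shows
  "dim_row A = dim_row B \<Longrightarrow> dim_col A = dim_col B \<Longrightarrow> dim_row C = dim_row B \<Longrightarrow> dim_col C = dim_col B \<Longrightarrow>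
   (A + B) + C = A + (B + C)"
  by (rule eq_matI) (auto simp: ac_simps)

lemma mat_add_lcomm: fixes A :: "'a::ab_semigroup_add mat" shows
  "dim_row A = dim_row B \<Longrightarrow> dim_col A = dim_col B \<Longrightarrow> dim_row C = dim_row B \<Longrightarrow> dim_col C = dim_col B \<Longrightarrow>
   A + (B + C) = B + (A + C)"
  by (rule eq_matI) (auto simp: ac_simps)

lemma mat_cancel: fixes A :: "'a::ring mat" shows
  "A + (- A) = 0\<^sub>m (dim_row A) (dim_col A)" "- A + A = 0\<^sub>m (dim_row A) (dim_col A)"
  "dim_row A = dim_row B \<Longrightarrow> dim_col A = dim_col B \<Longrightarrow> A + (- A + B) = B"
  "dim_row A = dim_row B \<Longrightarrow> dim_col A = dim_col B \<Longrightarrow> - A + (A + B) = B"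
  by (rule eq_matI; auto)+

lemma mat_cancel_over: fixes A :: "'a::ring mat" shows
  "dim_row A = dim_row B \<Longrightarrow> dim_col A = dim_col B \<Longrightarrow> dim_row C = dim_row B \<Longrightarrow> dim_col C = dim_col B \<Longrightarrow>
   A + (B + (- A + C)) = B + C"
  by (rule eq_matI) auto

lemma mat_zero: fixes A :: "'a::ring mat" shows
  "dim_row A = n \<Longrightarrow> dim_col A = m \<Longrightarrow> A + 0\<^sub>m n m = A"
  "dim_row A = n \<Longrightarrow> dim_col A = m \<Longrightarrow> 0\<^sub>m n m + A = A"
  "dim_col A = n \<Longrightarrow> A * 0\<^sub>m n m = 0\<^sub>m (dim_row A) m"
  "dim_row A = m \<Longrightarrow> 0\<^sub>m n m * A = 0\<^sub>m n (dim_col A)"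
  "- 0\<^sub>m n m = (0\<^sub>m n m :: 'a mat)"
  by (rule eq_matI; auto)+

lemma mat_one: fixes A :: "'a::semiring_1 mat" shows
  "dim_row A = n \<Longrightarrow> 1\<^sub>m n * A = A" "dim_col A = n \<Longrightarrow> A * 1\<^sub>m n = A"
  by (auto intro: left_mult_one_mat right_mult_one_mat)

lemma mat_smult: fixes A :: "'a::comm_ring_1 mat" shows
  "dim_col A = dim_row B \<Longrightarrow> (c \<cdot>\<^sub>m A) * B = c \<cdot>\<^sub>m (A * B)"
  "dim_col A = dim_row B \<Longrightarrow> A * (c \<cdot>\<^sub>m B) = c \<cdot>\<^sub>m (A * B)"
  "dim_row A = dim_row B \<Longrightarrow> dim_col A = dim_col B \<Longrightarrow> c \<cdot>\<^sub>m (A + B) = c \<cdot>\<^sub>m A + c \<cdot>\<^sub>m B"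
  "c \<cdot>\<^sub>m (- A) = - (c \<cdot>\<^sub>m A)"
  "(c + d) \<cdot>\<^sub>m A = c \<cdot>\<^sub>m A + d \<cdot>\<^sub>m A"
  "(c - d) \<cdot>\<^sub>m A = c \<cdot>\<^sub>m A + - (d \<cdot>\<^sub>m A)"
  "1 \<cdot>\<^sub>m A = A"
  by (rule eq_matI; auto simp: algebra_simps)+

lemmas mat_ring = mat_assoc mat_add_mult mat_mult_add mat_uminus_mult mat_mult_uminus mat_diff mat_uminus_add
  mat_uminus_uminus mat_add_assoc mat_cancel mat_zero mat_one mat_smult

lemmas mat_ac = mat_add_comm mat_add_lcomm

lemma mat_minus_mult: fixes A :: "'a::ring mat" shows
  "dim_row A = dim_row B \<Longrightarrow> dim_col A = dim_col B \<Longrightarrow> dim_col B = dim_row C \<Longrightarrow> (A - B) * C = A * C - B * C"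
  by (simp add: mat_diff mat_add_mult mat_uminus_mult)

lemma mat_inv_cancel: fixes A :: "'a::semiring_1 mat" 
  shows "A * B = 1\<^sub>m n \<Longrightarrow> dim_col A = dim_row B \<Longrightarrow> dim_col B = dim_row X \<Longrightarrow> dim_row X = n \<Longrightarrow> A * (B * X) = X"
  by (simp add: mat_assoc[symmetric] mat_one)

text \<open>The normal form of \<open>mat_ring\<close> has no cancellation across an equation; this rule clears the
  negative terms of an equation instead.\<close>

lemma mat_eq_of_diff: fixes A :: "'a::ring mat"
  assumes "A - B = C - D" "dim_row A = dim_row B" "dim_col A = dim_col B" "dim_row C = dim_row A" "dim_col C = dim_col A"
    "dim_row D = dim_row A" "dim_col D = dim_col A"
  shows "A + D = C + B"
proof (rule eq_matI)
  fix i j assume ij: "i < dim_row (C + B)" "j < dim_col (C + B)"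
  have "(A - B) $$ (i,j) = (C - D) $$ (i,j)" using assms(1) by simp
  then have "A $$ (i,j) - B $$ (i,j) = C $$ (i,j) - D $$ (i,j)" using assms(2-) ij by simp
  then show "(A + D) $$ (i,j) = (C + B) $$ (i,j)" using assms(2-) ij by (simp add: algebra_simps)
qed (use assms(2-) in auto)

lemma mat_vec_assoc: fixes A :: "'a::semiring_0 mat" shows
  "dim_col A = dim_row B \<Longrightarrow> dim_vec v = dim_col B \<Longrightarrow> (A * B) *\<^sub>v v = A *\<^sub>v (B *\<^sub>v v)"
  by (rule assoc_mult_mat_vec[of A "dim_row A" "dim_col A" B "dim_col B"]) (auto intro: carrier_vecI)

lemma mat_vec_add: fixes A :: "'a::semiring_0 mat" shows
  "dim_row A = dim_row B \<Longrightarrow> dim_col A = dim_col B \<Longrightarrow> dim_vec v = dim_col B \<Longrightarrow> (A + B) *\<^sub>v v = A *\<^sub>v v + B *\<^sub>v v"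
  by (rule add_mult_distrib_mat_vec[of A "dim_row A" "dim_col A" B]) (auto intro: carrier_vecI)

lemma mat_vec_zero: fixes A :: "'a::semiring_0 mat"
  shows "dim_col A = n \<Longrightarrow> A *\<^sub>v 0\<^sub>v n = 0\<^sub>v (dim_row A)"
  by (rule eq_vecI) (simp_all add: scalar_prod_def)


section \<open>Adjoints and block matrices\<close>

lemma adj_dim[simp]: "dim_row (A\<^sup>\<dagger>) = dim_col A" "dim_col (A\<^sup>\<dagger>) = dim_row A"
  by (auto simp: mat_adjoint_def mat_of_rows_def)

lemma adj_index[simp]: "i < dim_col A \<Longrightarrow> j < dim_row A \<Longrightarrow> A\<^sup>\<dagger> $$ (i,j) = conjugate (A $$ (j,i))"
  by (auto simp: mat_adjoint_def mat_of_rows_def)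

lemma adj_carrier[simp]: "A \<in> carrier_mat n m \<Longrightarrow> A\<^sup>\<dagger> \<in> carrier_mat m n" by auto

lemma adj_adj[simp]: "(A\<^sup>\<dagger>)\<^sup>\<dagger> = A" by (rule eq_matI) auto

lemma adj_mult: fixes A :: "complex mat" shows "dim_col A = dim_row B \<Longrightarrow> (A * B)\<^sup>\<dagger> = B\<^sup>\<dagger> * A\<^sup>\<dagger>"
  by (rule eq_matI) (auto simp: scalar_prod_def mult.commute)

lemma adj_add: fixes A :: "complex mat" shows 
  "dim_row A = dim_row B \<Longrightarrow> dim_col A = dim_col B \<Longrightarrow> (A + B)\<^sup>\<dagger> = A\<^sup>\<dagger> + B\<^sup>\<dagger>"
  by (rule eq_matI) auto

lemma adj_diff: fixes A :: "complex mat" shows 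
  "dim_row A = dim_row B \<Longrightarrow> dim_col A = dim_col B \<Longrightarrow> (A - B)\<^sup>\<dagger> = A\<^sup>\<dagger> - B\<^sup>\<dagger>"
  by (rule eq_matI) auto

lemma adj_uminus: fixes A :: "complex mat" shows "(- A)\<^sup>\<dagger> = - A\<^sup>\<dagger>"
  by (rule eq_matI) auto

lemma adj_one: "(1\<^sub>m n :: complex mat)\<^sup>\<dagger> = 1\<^sub>m n"
  by (rule eq_matI) auto

lemma adj_zero: "(0\<^sub>m n m :: complex mat)\<^sup>\<dagger> = 0\<^sub>m m n"
  by (rule eq_matI) auto

lemma adj_four_block: fixes A :: "complex mat" shows
  "dim_row B = dim_row A \<Longrightarrow> dim_col C = dim_col A \<Longrightarrow> dim_row C = dim_row D \<Longrightarrow> dim_col B = dim_col D \<Longrightarrow> 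
   (four_block_mat A B C D)\<^sup>\<dagger> = four_block_mat (A\<^sup>\<dagger>) (C\<^sup>\<dagger>) (B\<^sup>\<dagger>) (D\<^sup>\<dagger>)"
  by (rule eq_matI) auto

lemmas adj_simps = adj_adj adj_mult adj_add adj_diff adj_uminus adj_one adj_zero adj_four_block

lemma append_rows_dim[simp]: "dim_row (A @\<^sub>r B) = dim_row A + dim_row B" "dim_col (A @\<^sub>r B) = dim_col A"
  by (auto simp: append_rows_def)

lemma append_rows_index: "i < dim_row A + dim_row B \<Longrightarrow> j < dim_col A \<Longrightarrow> 
   (A @\<^sub>r B) $$ (i,j) = (if i < dim_row A then A $$ (i,j) else B $$ (i - dim_row A,j))"
  by (auto simp: append_rows_def)

lemma append_cols_dim[simp]: "dim_row (A @\<^sub>c B) = dim_row A" "dim_col (A @\<^sub>c B) = dim_col A + dim_col B"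
  by (auto simp: append_cols_def)

lemma append_cols_index: "i < dim_row A \<Longrightarrow> j < dim_col A + dim_col B \<Longrightarrow> 
   (A @\<^sub>c B) $$ (i,j) = (if j < dim_col A then A $$ (i,j) else B $$ (i,j - dim_col A))"
  by (auto simp: append_cols_def)

lemma adj_append_rows: fixes A :: "complex mat" shows
  "dim_col A = dim_col B \<Longrightarrow> (A @\<^sub>r B)\<^sup>\<dagger> = A\<^sup>\<dagger> @\<^sub>c B\<^sup>\<dagger>"
  by (rule eq_matI) (auto simp: append_rows_index append_cols_index)

lemma four_block_mult: fixes A :: "'a::semiring_0 mat" shows
 "dim_row B = dim_row A \<Longrightarrow> dim_col C = dim_col A \<Longrightarrow> dim_row C = dim_row D \<Longrightarrow> dim_col B = dim_col D \<Longrightarrow> 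
  dim_row B' = dim_row A' \<Longrightarrow> dim_col C' = dim_col A' \<Longrightarrow> dim_row C' = dim_row D' \<Longrightarrow> dim_col B' = dim_col D' \<Longrightarrow> 
  dim_col A = dim_row A' \<Longrightarrow> dim_col D = dim_row D' \<Longrightarrow>
  four_block_mat A B C D * four_block_mat A' B' C' D' =
  four_block_mat (A * A' + B * C') (A * B' + B * D') (C * A' + D * C') (C * B' + D * D')"
  by (rule mult_four_block_mat[of A "dim_row A" "dim_col A" B "dim_col B" C "dim_row D" D]) auto

lemma four_block_mult_append_rows: fixes A :: "'a::ring mat" shows
 "dim_row B = dim_row A \<Longrightarrow> dim_col C = dim_col A \<Longrightarrow> dim_row C = dim_row D \<Longrightarrow> dim_col B = dim_col D \<Longrightarrow> 
  dim_col A = dim_row E \<Longrightarrow> dim_col D = dim_row F \<Longrightarrow> dim_col E = dim_col F \<Longrightarrow>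
  four_block_mat A B C D * (E @\<^sub>r F) = (A * E + B * F) @\<^sub>r (C * E + D * F)"
  unfolding append_rows_def by (subst four_block_mult) (auto simp: mat_zero intro!: cong_four_block_mat)

lemma append_rows_mult: fixes A :: "'a::ring mat" shows
 "dim_col A = dim_col B \<Longrightarrow> dim_col A = dim_row C \<Longrightarrow> (A @\<^sub>r B) * C = (A * C) @\<^sub>r (B * C)"
  by (rule eq_matI) (auto simp: append_rows_index append_rows_def scalar_prod_def)

lemma append_cols_mult: fixes A :: "'a::ring mat" shows
 "dim_row A = dim_row B \<Longrightarrow> dim_col A = dim_row C \<Longrightarrow> dim_col B = dim_row D \<Longrightarrow> dim_col C = dim_col D \<Longrightarrow>
  (A @\<^sub>c B) * (C @\<^sub>r D) = A * C + B * D"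
proof -
  assume a: "dim_row A = dim_row B" "dim_col A = dim_row C" "dim_col B = dim_row D" "dim_col C = dim_col D"
  have "(A @\<^sub>c B) * (C @\<^sub>r D) = four_block_mat (A * C + B * D) (0\<^sub>m (dim_row A) 0) (0\<^sub>m 0 (dim_col C)) (0\<^sub>m 0 0)"
    unfolding append_cols_def append_rows_def using a
    by (subst four_block_mult) (auto simp: mat_zero intro!: cong_four_block_mat)
  also have "\<dots> = A * C + B * D" using a by (intro eq_matI) auto
  finally show ?thesis .
qed

lemma append_rows_add: fixes A :: "'a::ring mat" shows
 "dim_row A = dim_row C \<Longrightarrow> dim_col A = dim_col C \<Longrightarrow> dim_row B = dim_row D \<Longrightarrow> dim_col B = dim_col D \<Longrightarrow>
  dim_col A = dim_col B \<Longrightarrow>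
  (A @\<^sub>r B) + (C @\<^sub>r D) = (A + C) @\<^sub>r (B + D)"
  by (rule eq_matI) (auto simp: append_rows_index)

lemma append_rows_uminus: fixes A :: "'a::ring mat" shows
 "dim_col A = dim_col B \<Longrightarrow> - (A @\<^sub>r B)  = (- A) @\<^sub>r (- B)"
  by (rule eq_matI) (auto simp: append_rows_index)

lemma append_rows_smult: fixes A :: "'a::ring mat" shows
 "dim_col A = dim_col B \<Longrightarrow> c \<cdot>\<^sub>m (A @\<^sub>r B)  = (c \<cdot>\<^sub>m A) @\<^sub>r (c \<cdot>\<^sub>m B)"
  by (rule eq_matI) (auto simp: append_rows_index)

lemma append_rows_assoc: 
 "dim_col A = dim_col B \<Longrightarrow> dim_col A = dim_col C \<Longrightarrow> (A @\<^sub>r B) @\<^sub>r C = A @\<^sub>r (B @\<^sub>r C)"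
  by (rule eq_matI) (auto simp: append_rows_index)

lemma append_rows_inject:
  assumes "A @\<^sub>r B = C @\<^sub>r D" "dim_row A = dim_row C" "dim_col A = dim_col B" "dim_col C = dim_col D"
  shows "A = C" "B = D"
proof -
  have "dim_row (A @\<^sub>r B) = dim_row (C @\<^sub>r D)" "dim_col (A @\<^sub>r B) = dim_col (C @\<^sub>r D)"
    using assms(1) by simp_all
  then have d: "dim_row B = dim_row D" "dim_col A = dim_col C" using assms(2) by simp_all
  have e: "(A @\<^sub>r B) $$ (i,j) = (C @\<^sub>r D) $$ (i,j)" for i j using assms by simp
  show "A = C"
  proof (rule eq_matI)
    fix i j assume "i < dim_row C" "j < dim_col C"
    then have "A $$ (i,j) = (A @\<^sub>r B) $$ (i,j)" "C $$ (i,j) = (C @\<^sub>r D) $$ (i,j)"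
      using assms(2-) d by (simp_all add: append_rows_index)
    then show "A $$ (i,j) = C $$ (i,j)" using e by simp
  qed (use assms(2-) d in auto)
  show "B = D"
  proof (rule eq_matI)
    fix i j assume "i < dim_row D" "j < dim_col D"
    then have "B $$ (i,j) = (A @\<^sub>r B) $$ (dim_row C + i,j)" "D $$ (i,j) = (C @\<^sub>r D) $$ (dim_row C + i,j)"
      using assms(2-) d by (simp_all add: append_rows_index)
    then show "B $$ (i,j) = D $$ (i,j)" using e by simp
  qed (use assms(2-) d in auto)
qed

lemma append_rows_split:
  assumes X: "X \<in> carrier_mat (a + b) m"
  shows "\<exists>A B. X = A @\<^sub>r B \<and> A \<in> carrier_mat a m \<and> B \<in> carrier_mat b m"
proof -
  define A where "A = mat a m (\<lambda>(i,j). X $$ (i,j))"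
  define B where "B = mat b m (\<lambda>(i,j). X $$ (a+i,j))"
  have d: "dim_row A = a" "dim_col A = m" "dim_row B = b" "dim_col B = m" "dim_row X = a + b" "dim_col X = m"
    using X by (simp_all add: A_def B_def)
  have "X = A @\<^sub>r B"
  proof (rule eq_matI)
    fix i j assume ij: "i < dim_row (A @\<^sub>r B)" "j < dim_col (A @\<^sub>r B)"
    then have "(A @\<^sub>r B) $$ (i,j) = (if i < a then A $$ (i,j) else B $$ (i - a,j))"
      using append_rows_index[of i A B j] d by simp
    also have "\<dots> = X $$ (i,j)" using ij d by (simp add: A_def B_def)
    finally show "X $$ (i,j) = (A @\<^sub>r B) $$ (i,j)" by simp
  qed (simp_all add: d)
  moreover have "A \<in> carrier_mat a m" "B \<in> carrier_mat b m" unfolding A_def B_def by (rule mat_carrier)+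
  ultimately show ?thesis by (intro exI conjI)
qed

lemma split_block_four_block:
  assumes "A \<in> carrier_mat r c" "B \<in> carrier_mat r m" "C \<in> carrier_mat n c" "D \<in> carrier_mat n m"
  shows "split_block (four_block_mat A B C D) r c = (A,B,C,D)"
  using assms by (auto simp: split_block_def Let_def intro!: eq_matI)

lemma four_block_decomp:
  assumes "M \<in> carrier_mat (r + n) (c + m)"
  obtains A B C D where "M = four_block_mat A B C D"
    "A \<in> carrier_mat r c" "B \<in> carrier_mat r m" "C \<in> carrier_mat n c" "D \<in> carrier_mat n m"
proof -
  obtain A B C D where s: "split_block M r c = (A,B,C,D)" by (cases "split_block M r c") auto
  show ?thesis by (rule that) (use split_block[OF s, of n m] assms in auto)
qed


section \<open>Inverses\<close>

lemma minv_inverse: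
  assumes A: "A \<in> carrier_mat n n" and d: "det A \<noteq> 0"
  shows "minv A \<in> carrier_mat n n" "A * minv A = 1\<^sub>m n" "minv A * A = 1\<^sub>m n"
proof -
  have "mat_inverse A \<noteq> None"
    using mat_inverse(1)[OF A] det_non_zero_imp_unit[OF A d] by metis
  then obtain B where "mat_inverse A = Some B" by (elim not_None_eq[THEN iffD1, THEN exE])
  from mat_inverse(2)[OF A this] this show "minv A \<in> carrier_mat n n" "A * minv A = 1\<^sub>m n" "minv A * A = 1\<^sub>m n"
    by (auto simp: minv_def)
qed

lemma det_nonzero_of_left_inverse:
  fixes A :: "'a::field mat"
  assumes "A \<in> carrier_mat n n" "B \<in> carrier_mat n n" "B * A = 1\<^sub>m n" shows "det A \<noteq> 0"
  using det_mult[OF assms(2,1)] assms(3) by auto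

lemma minv_unique:
  fixes A :: "'a::field mat"
  assumes A: "A \<in> carrier_mat n n" and B: "B \<in> carrier_mat n n" and "B * A = 1\<^sub>m n"
  shows "minv A = B"
proof -
  note m = minv_inverse[OF A det_nonzero_of_left_inverse[OF assms]]
  have "B = B * (A * minv A)" using m B by simp
  also have "\<dots> = (B * A) * minv A" using m A B by (simp add: mat_assoc)
  also have "\<dots> = minv A" using m assms by simp
  finally show ?thesis by simp
qed

lemma invertible_mat_det: 
  fixes A :: "'a::field mat"
  assumes A: "A \<in> carrier_mat n n" and d: "det A \<noteq> 0" shows "invertible_mat A"
proof -
  have "dim_row A = n" "dim_col A = n" "dim_row (minv A) = n" using minv_inverse[OF assms] A by blast+
  then show ?thesis
    unfolding invertible_mat_def inverts_mat_def square_mat.simps using minv_inverse(2,3)[OF assms] by metis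
qed

lemma det_nonzero_of_kernel:
  fixes A :: "'a::field mat"
  assumes A: "A \<in> carrier_mat n n" and k: "\<And>v. v \<in> carrier_vec n \<Longrightarrow> A *\<^sub>v v = 0\<^sub>v n \<Longrightarrow> v = 0\<^sub>v n"
  shows "det A \<noteq> 0"
proof
  assume "det A = 0"
  with det_0_iff_vec_prod_zero_field[OF A] have "\<exists>v. v \<in> carrier_vec n \<and> v \<noteq> 0\<^sub>v n \<and> A *\<^sub>v v = 0\<^sub>v n" by (rule iffD1)
  then obtain v where v: "v \<in> carrier_vec n" "v \<noteq> 0\<^sub>v n" "A *\<^sub>v v = 0\<^sub>v n" by (elim exE conjE)
  from v(2) k[OF v(1,3)] show False by (rule notE)
qed

lemma minv_adj:
  fixes A :: "complex mat"
  assumes A: "A \<in> carrier_mat n n" and d: "det A \<noteq> 0"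
  shows "minv (A\<^sup>\<dagger>) = (minv A)\<^sup>\<dagger>"
proof (rule minv_unique[of _ n])
  note m = minv_inverse[OF assms]
  note [simp] = carrier_matD[OF A] carrier_matD[OF m(1)]
  have "(minv A)\<^sup>\<dagger> * A\<^sup>\<dagger> = (A * minv A)\<^sup>\<dagger>" by (simp add: adj_mult)
  then show "(minv A)\<^sup>\<dagger> * A\<^sup>\<dagger> = 1\<^sub>m n" unfolding m(2) by (simp add: adj_one)
qed (use A minv_inverse[OF assms] in simp_all)


section \<open>Constants and resolvents over the rational functions\<close>

lemma comm_ring_hom_const: "comm_ring_hom (\<lambda>c::complex. Fract [:c:] 1)"
  apply unfold_locales
     apply (simp only: pCons_0_0 fract_collapse)
    apply (simp only: add_fract mult_1_left mult_1_right one_neq_zero not_False_eq_True add_pCons add_0_left)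
   apply (simp only: one_pCons[symmetric] fract_collapse)
  apply (simp only: mult_fract mult_1_left mult_1_right mult_pCons_left mult_pCons_right smult_pCons
    mult_zero_left smult_0_right add_pCons add_0_left pCons_0_0 add_0_right)
  apply (simp only: mult.commute)
  done

lemma comm_ring_hom_fract: "comm_ring_hom (\<lambda>c::complex poly. Fract c 1)"
  by unfold_locales
    (simp_all only: mult_fract mult_1_left add_fract mult_1_right one_neq_zero not_False_eq_True fract_collapse)

interpretation const_hom: comm_ring_hom "\<lambda>c::complex. Fract [:c:] 1" by (rule comm_ring_hom_const)

interpretation fract_hom: comm_ring_hom "\<lambda>c::complex poly. Fract c 1" by (rule comm_ring_hom_fract)

lemma rat_const_dim[simp]: "dim_row (rat_const A) = dim_row A" "dim_col (rat_const A) = dim_col A"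
  by (auto simp: rat_const_def)

lemma rat_const_carrier[simp]: "A \<in> carrier_mat n m \<Longrightarrow> rat_const A \<in> carrier_mat n m"
  by (auto simp: rat_const_def)

lemma rat_const_mult: "dim_col A = dim_row B \<Longrightarrow> rat_const (A * B) = rat_const A * rat_const B"
  unfolding rat_const_def
  by (rule const_hom.mat_hom_mult[of A "dim_row A" "dim_col A" B "dim_col B"]) auto

lemma rat_const_one: "rat_const (1\<^sub>m n) = 1\<^sub>m n"
  unfolding rat_const_def by (rule const_hom.mat_hom_one)

lemma rat_const_zero: "rat_const (0\<^sub>m n m) = 0\<^sub>m n m"
  unfolding rat_const_def by (rule eq_matI) (simp_all only: index_map_mat index_zero_mat const_hom.hom_zero)

lemma rat_const_add: "dim_row A = dim_row B \<Longrightarrow> dim_col A = dim_col B \<Longrightarrow> rat_const (A + B) = rat_const A + rat_const B"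
  unfolding rat_const_def by (rule eq_matI) (simp_all only: index_map_mat index_add_mat index_uminus_mat index_minus_mat const_hom.hom_add)

lemma rat_const_uminus: "rat_const (- A) = - rat_const A"
  unfolding rat_const_def by (rule eq_matI) (simp_all only: index_map_mat index_add_mat index_uminus_mat index_minus_mat const_hom.hom_uminus)

lemma rat_const_diff: "dim_row A = dim_row B \<Longrightarrow> dim_col A = dim_col B \<Longrightarrow> rat_const (A - B) = rat_const A - rat_const B"
  unfolding rat_const_def by (rule eq_matI) (simp_all only: index_map_mat index_add_mat index_uminus_mat index_minus_mat const_hom.hom_minus)

lemma rat_const_four_block: 
  "dim_row B = dim_row A \<Longrightarrow> dim_col C = dim_col A \<Longrightarrow> dim_row C = dim_row D \<Longrightarrow> dim_col B = dim_col D \<Longrightarrow>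
   rat_const (four_block_mat A B C D) = four_block_mat (rat_const A) (rat_const B) (rat_const C) (rat_const D)"
  unfolding rat_const_def by (rule eq_matI) auto

lemma rat_const_append_rows: 
  "dim_col A = dim_col B \<Longrightarrow> rat_const (A @\<^sub>r B) = rat_const A @\<^sub>r rat_const B"
  unfolding rat_const_def by (rule eq_matI) (auto simp: append_rows_index)

lemma rat_const_append_cols: 
  "dim_row A = dim_row B \<Longrightarrow> rat_const (A @\<^sub>c B) = rat_const A @\<^sub>c rat_const B"
  unfolding rat_const_def by (rule eq_matI) (auto simp: append_cols_index)

lemmas rat_const_simps = rat_const_mult rat_const_one rat_const_zero rat_const_add rat_const_uminus rat_const_diff rat_const_four_block
   rat_const_append_rows rat_const_append_cols

text \<open>The determinant of \<open>z - A\<close> over the field of rational functions is the characteristic polynomial,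
  which is monic and hence not zero.  So resolvents exist without any condition on the spectrum.\<close>

lemma resolvent_inverse:
  assumes A: "A \<in> carrier_mat n n"
  shows "resolvent A \<in> carrier_mat n n"
   "(rat_var \<cdot>\<^sub>m 1\<^sub>m n - rat_const A) * resolvent A = 1\<^sub>m n"
   "resolvent A * (rat_var \<cdot>\<^sub>m 1\<^sub>m n - rat_const A) = 1\<^sub>m n"
proof -
  let ?X = "rat_var \<cdot>\<^sub>m 1\<^sub>m n - rat_const A"
  have X: "?X \<in> carrier_mat n n" using A by (auto simp: minus_carrier_mat)
  have "?X = map_mat (\<lambda>c. Fract c 1) (char_poly_matrix A)"
  proof (rule eq_matI)
    fix i j assume "i < dim_row (map_mat (\<lambda>c. Fract c 1) (char_poly_matrix A))"
      "j < dim_col (map_mat (\<lambda>c. Fract c 1) (char_poly_matrix A))"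
    then have ij: "i < n" "j < n" using A by (simp_all add: char_poly_matrix_def)
    have n: "[:- a:] = - [:a:]" for a :: complex by simp
    have l: "?X $$ (i,j) = rat_var * (if i = j then 1 else 0) - Fract [:A $$ (i,j):] 1"
      using A ij unfolding rat_const_def by simp
    have r: "char_poly_matrix A $$ (i,j) = [:0,1:] * (if i = j then 1 else 0) - [:A $$ (i,j):]"
      using A ij unfolding char_poly_matrix_def by simp
    have "map_mat (\<lambda>c. Fract c 1) (char_poly_matrix A) $$ (i,j) = Fract (char_poly_matrix A $$ (i,j)) 1"
      by (rule index_map_mat(1)) (use A ij in \<open>simp_all add: char_poly_matrix_def\<close>)
    also have "\<dots> = ?X $$ (i,j)"
      unfolding l r unfolding rat_var_def
      by (simp only: fract_hom.hom_minus fract_hom.hom_mult fract_hom.hom_one fract_hom.hom_zero if_distrib[of "\<lambda>c. Fract c 1"])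
    finally show "?X $$ (i,j) = map_mat (\<lambda>c. Fract c 1) (char_poly_matrix A) $$ (i,j)" by (rule sym)
  qed (use A in \<open>simp_all add: char_poly_matrix_def rat_const_def\<close>)
  then have "det ?X = Fract (char_poly A) 1"
    unfolding char_poly_def by (simp only: fract_hom.hom_det)
  moreover have "char_poly A \<noteq> 0" using degree_monic_char_poly[OF A] by auto
  ultimately have "det ?X \<noteq> 0"
    by (simp only: Zero_fract_def eq_fract(1)[OF one_neq_zero one_neq_zero] mult_1_right not_False_eq_True mult_zero_left)
  from minv_inverse[OF X this] A
  show "resolvent A \<in> carrier_mat n n" "?X * resolvent A = 1\<^sub>m n" "resolvent A * ?X = 1\<^sub>m n"
    by (auto simp: resolvent_def)
qed

lemma resolvent_dim[simp]: "A \<in> carrier_mat n n \<Longrightarrow> dim_row (resolvent A) = n" "A \<in> carrier_mat n n \<Longrightarrow> dim_col (resolvent A) = n"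
  using resolvent_inverse(1)[of A n] by auto


section \<open>Unitary matrices\<close>

lemma unitary_matI:
  assumes "A \<in> carrier_mat n n" "A\<^sup>\<dagger> * A = 1\<^sub>m n"
  shows "unitary_mat A" "A * A\<^sup>\<dagger> = 1\<^sub>m n"
proof -
  show a: "A * A\<^sup>\<dagger> = 1\<^sub>m n"
    by (rule mat_mult_left_right_inverse[OF _ assms]) (use assms in simp)
  show "unitary_mat A" using a assms by (auto simp: unitary_mat_def inverts_mat_def)
qed

lemma unitary_matD:
  assumes "unitary_mat A" "A \<in> carrier_mat n n"
  shows "A\<^sup>\<dagger> * A = 1\<^sub>m n" "A * A\<^sup>\<dagger> = 1\<^sub>m n"
  using assms by (auto simp: unitary_mat_def inverts_mat_def)

lemma four_block_unitaryI:
  fixes A :: "complex mat"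
  assumes c: "A \<in> carrier_mat p p" "B \<in> carrier_mat p d" "C \<in> carrier_mat d p" "D \<in> carrier_mat d d"
  assumes e: "A\<^sup>\<dagger> * A + C\<^sup>\<dagger> * C = 1\<^sub>m p" "B\<^sup>\<dagger> * A + D\<^sup>\<dagger> * C = 0\<^sub>m d p" "B\<^sup>\<dagger> * B + D\<^sup>\<dagger> * D = 1\<^sub>m d"
  shows "(four_block_mat A B C D)\<^sup>\<dagger> * four_block_mat A B C D = 1\<^sub>m (p + d)"
proof -
  note [simp] = c[THEN carrier_matD(1)] c[THEN carrier_matD(2)]
  have "A\<^sup>\<dagger> * B + C\<^sup>\<dagger> * D = (B\<^sup>\<dagger> * A + D\<^sup>\<dagger> * C)\<^sup>\<dagger>" by (simp add: adj_simps)
  then have "A\<^sup>\<dagger> * B + C\<^sup>\<dagger> * D = 0\<^sub>m p d" unfolding e(2) by (simp add: adj_simps)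
  then show ?thesis using e by (simp add: adj_simps four_block_mult)
qed

lemma four_block_unitaryD:
  fixes A :: "complex mat"
  assumes c: "A \<in> carrier_mat p p" "B \<in> carrier_mat p d" "C \<in> carrier_mat d p" "D \<in> carrier_mat d d"
  assumes e: "(four_block_mat A B C D)\<^sup>\<dagger> * four_block_mat A B C D = 1\<^sub>m (p + d)"
  shows "A\<^sup>\<dagger> * A + C\<^sup>\<dagger> * C = 1\<^sub>m p" "B\<^sup>\<dagger> * A + D\<^sup>\<dagger> * C = 0\<^sub>m d p" 
    "A\<^sup>\<dagger> * B + C\<^sup>\<dagger> * D = 0\<^sub>m p d" "B\<^sup>\<dagger> * B + D\<^sup>\<dagger> * D = 1\<^sub>m d"
proof -
  note [simp] = c[THEN carrier_matD(1)] c[THEN carrier_matD(2)]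
  have "four_block_mat (A\<^sup>\<dagger> * A + C\<^sup>\<dagger> * C) (A\<^sup>\<dagger> * B + C\<^sup>\<dagger> * D) (B\<^sup>\<dagger> * A + D\<^sup>\<dagger> * C) (B\<^sup>\<dagger> * B + D\<^sup>\<dagger> * D)
    = four_block_mat (1\<^sub>m p) (0\<^sub>m p d) (0\<^sub>m d p) (1\<^sub>m d)"
    using e by (simp add: adj_simps four_block_mult)
  from arg_cong[OF this, of "\<lambda>M. split_block M p p"]
  show "A\<^sup>\<dagger> * A + C\<^sup>\<dagger> * C = 1\<^sub>m p" "B\<^sup>\<dagger> * A + D\<^sup>\<dagger> * C = 0\<^sub>m d p" 
    "A\<^sup>\<dagger> * B + C\<^sup>\<dagger> * D = 0\<^sub>m p d" "B\<^sup>\<dagger> * B + D\<^sup>\<dagger> * D = 1\<^sub>m d"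
    by (auto simp: split_block_four_block[of _ p p _ d _ d] carrier_matI simp del: four_block_one_mat)
qed

lemma unitary_mult:
  assumes "unitary_mat A" "unitary_mat B" "A \<in> carrier_mat n n" "B \<in> carrier_mat n n"
  shows "unitary_mat (A * B)"
proof (rule unitary_matI(1)[of _ n])
  note [simp] = carrier_matD[OF assms(3)] carrier_matD[OF assms(4)]
  show "A * B \<in> carrier_mat n n" using assms by simp
  have "(A * B)\<^sup>\<dagger> * (A * B) = B\<^sup>\<dagger> * (A\<^sup>\<dagger> * (A * B))" by (simp add: adj_mult mat_assoc)
  also have "\<dots> = B\<^sup>\<dagger> * B" using mat_inv_cancel[OF unitary_matD(1)[OF assms(1,3)], of B] by simp
  finally show "(A * B)\<^sup>\<dagger> * (A * B) = 1\<^sub>m n" using unitary_matD(1)[OF assms(2,4)] by simp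
qed

lemma unitary_adj: 
  assumes "unitary_mat A" shows "unitary_mat (A\<^sup>\<dagger>)"
  using assms by (auto simp: unitary_mat_def inverts_mat_def)

lemma unitary_diag_one:
  assumes "unitary_mat A" "A \<in> carrier_mat n n"
  shows "unitary_mat (four_block_mat A (0\<^sub>m n k) (0\<^sub>m k n) (1\<^sub>m k))"
proof (rule unitary_matI(1)[of _ "n + k"])
  show "(four_block_mat A (0\<^sub>m n k) (0\<^sub>m k n) (1\<^sub>m k))\<^sup>\<dagger> * four_block_mat A (0\<^sub>m n k) (0\<^sub>m k n) (1\<^sub>m k) = 1\<^sub>m (n + k)"
    by (rule four_block_unitaryI) (use assms unitary_matD[OF assms] in \<open>simp_all add: adj_simps mat_zero mat_one\<close>)
qed (use assms in \<open>auto intro: carrier_matI\<close>)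

text \<open>Up to a permutation of the coordinates this is the direct sum of the given unitary matrix and an
  identity: the inserted coordinates bypass it.\<close>

lemma unitary_insert_identity: 
  fixes A :: "complex mat"
  assumes c: "D \<in> carrier_mat p p" "C \<in> carrier_mat p k" "B \<in> carrier_mat k p" "A \<in> carrier_mat k k"
   and u: "unitary_mat (four_block_mat D C B A)"
  shows "unitary_mat (four_block_mat (four_block_mat D (0\<^sub>m p d) (0\<^sub>m d p) (1\<^sub>m d)) (C @\<^sub>r 0\<^sub>m d k) (B @\<^sub>c 0\<^sub>m k d) A)"
    (is "unitary_mat ?M")
proof (rule unitary_matI(1)[of _ "p + d + k"])
  note [simp] = c[THEN carrier_matD(1)] c[THEN carrier_matD(2)]
  have R: "four_block_mat D C B A \<in> carrier_mat (p + k) (p + k)" by (auto intro: carrier_matI)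
  note e = four_block_unitaryD[OF c unitary_matD(1)[OF u R]]
  have Ca: "C @\<^sub>r 0\<^sub>m d k = four_block_mat C (0\<^sub>m p 0) (0\<^sub>m d k) (0\<^sub>m d 0)" by (simp add: append_rows_def)
  have Ba: "B @\<^sub>c 0\<^sub>m k d = four_block_mat B (0\<^sub>m k d) (0\<^sub>m 0 p) (0\<^sub>m 0 d)" by (simp add: append_cols_def)
  have z: "four_block_mat X (0\<^sub>m k 0) (0\<^sub>m 0 k) (0\<^sub>m 0 0) = X" if "X \<in> carrier_mat k k" for X :: "complex mat"
    by (rule eq_matI) (use that in auto)
  show "?M\<^sup>\<dagger> * ?M = 1\<^sub>m (p + d + k)"
  proof (rule four_block_unitaryI)
    let ?D = "four_block_mat D (0\<^sub>m p d) (0\<^sub>m d p) (1\<^sub>m d)"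
    show "?D\<^sup>\<dagger> * ?D + (B @\<^sub>c 0\<^sub>m k d)\<^sup>\<dagger> * (B @\<^sub>c 0\<^sub>m k d) = 1\<^sub>m (p + d)"
      unfolding Ba by (simp add: adj_simps four_block_mult mat_zero mat_one add_four_block_mat[of _ p p _ d _ d] carrier_matI e)
    have "(C @\<^sub>r 0\<^sub>m d k)\<^sup>\<dagger> * ?D = four_block_mat (C\<^sup>\<dagger> * D) (0\<^sub>m k d) (0\<^sub>m 0 p) (0\<^sub>m 0 d)"
      unfolding Ca by (simp add: adj_simps four_block_mult mat_zero mat_one)
    moreover have "A\<^sup>\<dagger> * (B @\<^sub>c 0\<^sub>m k d) = four_block_mat (A\<^sup>\<dagger> * B) (0\<^sub>m k d) (0\<^sub>m 0 p) (0\<^sub>m 0 d)"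
      unfolding append_cols_def by (rule eq_matI) (auto simp: scalar_prod_def)
    ultimately have "(C @\<^sub>r 0\<^sub>m d k)\<^sup>\<dagger> * ?D + A\<^sup>\<dagger> * (B @\<^sub>c 0\<^sub>m k d) = four_block_mat (C\<^sup>\<dagger> * D + A\<^sup>\<dagger> * B) (0\<^sub>m k d) (0\<^sub>m 0 p) (0\<^sub>m 0 d)"
      by (simp add: add_four_block_mat[of _ k p _ d _ 0] carrier_matI mat_zero)
    also have "\<dots> = 0\<^sub>m k (p + d)" unfolding e by (rule eq_matI) auto
    finally show "(C @\<^sub>r 0\<^sub>m d k)\<^sup>\<dagger> * ?D + A\<^sup>\<dagger> * (B @\<^sub>c 0\<^sub>m k d) = 0\<^sub>m k (p + d)" .
    have "(C @\<^sub>r 0\<^sub>m d k)\<^sup>\<dagger> * (C @\<^sub>r 0\<^sub>m d k) = C\<^sup>\<dagger> * C"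
      by (simp add: adj_append_rows adj_zero append_cols_mult mat_zero)
    then show "(C @\<^sub>r 0\<^sub>m d k)\<^sup>\<dagger> * (C @\<^sub>r 0\<^sub>m d k) + A\<^sup>\<dagger> * A = 1\<^sub>m k" using e by simp
  qed (auto intro: carrier_matI)
qed (use c in \<open>auto intro: carrier_matI\<close>)


section \<open>Positive definite matrices and their square roots\<close>

lemma cscalar_adj:
  fixes A :: "complex mat"
  assumes "A \<in> carrier_mat n m" "v \<in> carrier_vec m" "w \<in> carrier_vec n"
  shows "(A *\<^sub>v v) \<bullet>c w = v \<bullet>c (A\<^sup>\<dagger> *\<^sub>v w)"
proof -
  have "(A *\<^sub>v v) \<bullet>c w = (\<Sum>i<n. \<Sum>j<m. A $$ (i,j) * v $ j * cnj (w $ i))"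
    using assms by (simp add: scalar_prod_def sum_distrib_right lessThan_atLeast0)
  also have "\<dots> = (\<Sum>j<m. \<Sum>i<n. A $$ (i,j) * v $ j * cnj (w $ i))" by (rule sum.swap)
  also have "\<dots> = v \<bullet>c (A\<^sup>\<dagger> *\<^sub>v w)"
    using assms by (simp add: scalar_prod_def sum_distrib_left lessThan_atLeast0 mult_ac)
  finally show ?thesis .
qed

lemma cscalar_self:
  fixes v :: "complex vec"
  assumes "v \<in> carrier_vec n"
  shows "Re (v \<bullet>c v) \<ge> 0" "v \<noteq> 0\<^sub>v n \<Longrightarrow> Re (v \<bullet>c v) > 0"
proof -
  have e: "Re (v \<bullet>c v) = (\<Sum>i<n. (cmod (v $ i))\<^sup>2)"
    using assms unfolding scalar_prod_def cmod_power2
    by (simp add: lessThan_atLeast0 power2_eq_square)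
  show "Re (v \<bullet>c v) \<ge> 0" unfolding e by (simp add: sum_nonneg)
  assume "v \<noteq> 0\<^sub>v n"
  then obtain i where i: "i < n" "v $ i \<noteq> 0" using assms by (metis eq_vecI carrier_vecD index_zero_vec)
  then show "Re (v \<bullet>c v) > 0" unfolding e by (intro sum_pos2[of _ i]) auto
qed

lemma pos_def_gram_sum:
  fixes A B :: "complex mat"
  assumes A: "A \<in> carrier_mat m n" and B: "B \<in> carrier_mat l n"
    and k: "\<And>v. v \<in> carrier_vec n \<Longrightarrow> A *\<^sub>v v = 0\<^sub>v m \<Longrightarrow> B *\<^sub>v v = 0\<^sub>v l \<Longrightarrow> v = 0\<^sub>v n"
  shows "pos_def (A\<^sup>\<dagger> * A + B\<^sup>\<dagger> * B)"
  unfolding pos_def_def hermitian_mat_def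
proof (intro conjI ballI impI)
  let ?M = "A\<^sup>\<dagger> * A + B\<^sup>\<dagger> * B"
  show "square_mat ?M" using A B by simp
  show "?M\<^sup>\<dagger> = ?M" using A B by (simp add: adj_simps)
  fix v :: "complex vec" assume "v \<in> carrier_vec (dim_row ?M)" and v0: "v \<noteq> 0\<^sub>v (dim_row ?M)"
  then have v: "v \<in> carrier_vec n" "v \<noteq> 0\<^sub>v n" using B by simp_all
  have Av: "A *\<^sub>v v \<in> carrier_vec m" and Bv: "B *\<^sub>v v \<in> carrier_vec l" using A B v by simp_all
  have "?M *\<^sub>v v = A\<^sup>\<dagger> *\<^sub>v (A *\<^sub>v v) + B\<^sup>\<dagger> *\<^sub>v (B *\<^sub>v v)"
    using A B v(1) by (subst mat_vec_add) (simp_all only: mat_vec_assoc index_mult_mat adj_dim carrier_matD carrier_vecD)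
  then have "(?M *\<^sub>v v) \<bullet>c v = (A\<^sup>\<dagger> *\<^sub>v (A *\<^sub>v v) + B\<^sup>\<dagger> *\<^sub>v (B *\<^sub>v v)) \<bullet>c v" by (rule arg_cong)
  also have "\<dots> = (A\<^sup>\<dagger> *\<^sub>v (A *\<^sub>v v)) \<bullet>c v + (B\<^sup>\<dagger> *\<^sub>v (B *\<^sub>v v)) \<bullet>c v"
    by (rule add_scalar_prod_distrib[of _ n]) (use A B v(1) in \<open>auto intro!: carrier_vecI\<close>)
  also have "\<dots> = (A *\<^sub>v v) \<bullet>c (A *\<^sub>v v) + (B *\<^sub>v v) \<bullet>c (B *\<^sub>v v)"
    using cscalar_adj[OF adj_carrier[OF A] Av v(1)] cscalar_adj[OF adj_carrier[OF B] Bv v(1)] by simp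
  finally have e: "Re ((?M *\<^sub>v v) \<bullet>c v) = Re ((A *\<^sub>v v) \<bullet>c (A *\<^sub>v v)) + Re ((B *\<^sub>v v) \<bullet>c (B *\<^sub>v v))" by simp
  have "A *\<^sub>v v \<noteq> 0\<^sub>v m \<or> B *\<^sub>v v \<noteq> 0\<^sub>v l" using k[OF v(1)] v(2) by metis
  then show "Re ((?M *\<^sub>v v) \<bullet>c v) > 0"
    unfolding e using cscalar_self[OF Av] cscalar_self[OF Bv] by (auto intro: add_pos_nonneg add_nonneg_pos)
qed

lemma pos_def_gram:
  fixes A :: "complex mat"
  assumes A: "A \<in> carrier_mat n n" and d: "det A \<noteq> 0"
  shows "pos_def (A\<^sup>\<dagger> * A)"
proof -
  have "pos_def (A\<^sup>\<dagger> * A + (0\<^sub>m n n)\<^sup>\<dagger> * 0\<^sub>m n n)"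
  proof (rule pos_def_gram_sum[OF A, where l = n])
    fix v :: "complex vec" assume "v \<in> carrier_vec n" "A *\<^sub>v v = 0\<^sub>v n"
    then show "v = 0\<^sub>v n" using det_0_iff_vec_prod_zero_field[OF A] d by metis
  qed simp
  then show ?thesis using A by (simp add: mat_ring)
qed

lemma pos_def_one_plus_gram:
  fixes A :: "complex mat"
  assumes A: "A \<in> carrier_mat m n"
  shows "pos_def (1\<^sub>m n + A\<^sup>\<dagger> * A)"
proof -
  have "pos_def ((1\<^sub>m n)\<^sup>\<dagger> * 1\<^sub>m n + A\<^sup>\<dagger> * A)" by (rule pos_def_gram_sum[OF _ A, of _ n]) auto
  then show ?thesis by (simp add: adj_simps)
qed

lemma pos_def_det:
  assumes p: "pos_def A" and A: "A \<in> carrier_mat n n" shows "det A \<noteq> 0"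
proof (rule det_nonzero_of_kernel[OF A])
  fix v assume v: "v \<in> carrier_vec n" "A *\<^sub>v v = 0\<^sub>v n"
  then have "Re ((A *\<^sub>v v) \<bullet>c v) = 0" by simp
  then show "v = 0\<^sub>v n" using p A v(1) unfolding pos_def_def by fastforce
qed

text \<open>For \<open>D = S - T\<close> one has \<open>S D + D T = S\<^sup>2 - T\<^sup>2 = 0\<close>.  A trace argument then shows that the positive
  quadratic forms of \<open>S\<close> and \<open>T\<close> vanish on the columns of \<open>D\<close>.\<close>

lemma pos_def_sqrt_unique:
  assumes S: "pos_def S" "S \<in> carrier_mat n n" and T: "pos_def T" "T \<in> carrier_mat n n" and e: "S * S = T * T"
  shows "S = T"
proof -
  define D where "D = S - T"
  have h: "S\<^sup>\<dagger> = S" "T\<^sup>\<dagger> = T" using S T by (auto simp: pos_def_def hermitian_mat_def)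
  have D: "D \<in> carrier_mat n n" "D\<^sup>\<dagger> = D" using S T h by (auto simp: D_def adj_simps minus_carrier_mat)
  note [simp] = carrier_matD[OF S(2)] carrier_matD[OF T(2)] carrier_matD[OF D(1)]
  \<comment> \<open>Multiply by \<open>D\<close> and take traces: \<open>tr (D S D) + tr (D T D) = 0\<close>, a sum of nonnegative terms.\<close>
  have SDT: "S * D + D * T = 0\<^sub>m n n"
    unfolding D_def by (simp add: mat_ring e)
  have tr: "(\<Sum>i<n. (D * M) $$ (i,i)) = (\<Sum>i<n. (M * D) $$ (i,i))" if "M \<in> carrier_mat n n" for M
  proof -
    have "(\<Sum>i<n. (D * M) $$ (i,i)) = (\<Sum>i<n. \<Sum>j<n. D $$ (i,j) * M $$ (j,i))"
      using that by (simp add: scalar_prod_def lessThan_atLeast0)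
    also have "\<dots> = (\<Sum>j<n. \<Sum>i<n. D $$ (i,j) * M $$ (j,i))" by (rule sum.swap)
    also have "\<dots> = (\<Sum>i<n. (M * D) $$ (i,i))"
      using that by (simp add: scalar_prod_def lessThan_atLeast0 mult.commute)
    finally show ?thesis .
  qed
  \<comment> \<open>The diagonal entries of \<open>D M D\<close> are values of the quadratic form of \<open>M\<close>, as \<open>D\<close> is Hermitian.\<close>
  have q: "(D * M * D) $$ (i,i) = (M *\<^sub>v col D i) \<bullet>c col D i" if "M \<in> carrier_mat n n" "i < n" for M i
  proof -
    have "(D * M * D) $$ (i,i) = (D * (M * D)) $$ (i,i)" using that by (simp add: mat_assoc)
    also have "\<dots> = (\<Sum>j<n. D $$ (i,j) * (M * D) $$ (j,i))"
      using that by (simp add: scalar_prod_def lessThan_atLeast0)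
    also have "\<dots> = (\<Sum>j<n. cnj (D $$ (j,i)) * (M * D) $$ (j,i))"
    proof (rule sum.cong[OF refl])
      fix j assume "j \<in> {..<n}"
      then have "D\<^sup>\<dagger> $$ (i,j) = cnj (D $$ (j,i))" using that by (subst adj_index) simp_all
      then show "D $$ (i,j) * (M * D) $$ (j,i) = cnj (D $$ (j,i)) * (M * D) $$ (j,i)" using D(2) by simp
    qed
    also have "\<dots> = (M *\<^sub>v col D i) \<bullet>c col D i"
      using that unfolding scalar_prod_def[of "M *\<^sub>v col D i"] by (simp add: lessThan_atLeast0 mult.commute)
    finally show ?thesis .
  qed
  have "D * (S * D + D * T) = 0\<^sub>m n n" unfolding SDT by (simp add: mat_zero)
  then have "(\<Sum>i<n. (D * S * D + D * (D * T)) $$ (i,i)) = 0"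
    by (simp add: mat_ring)
  then have "(\<Sum>i<n. (D * S * D) $$ (i,i)) + (\<Sum>i<n. (D * (D * T)) $$ (i,i)) = 0"
    by (simp add: sum.distrib)
  also have "(\<Sum>i<n. (D * (D * T)) $$ (i,i)) = (\<Sum>i<n. (D * T * D) $$ (i,i))"
    by (rule tr) (auto intro: carrier_matI)
  finally have "(\<Sum>i<n. (S *\<^sub>v col D i) \<bullet>c col D i + (T *\<^sub>v col D i) \<bullet>c col D i) = 0"
    unfolding sum.distrib[symmetric] using q[OF S(2)] q[OF T(2)] by simp
  then have z: "(\<Sum>i<n. Re ((S *\<^sub>v col D i) \<bullet>c col D i) + Re ((T *\<^sub>v col D i) \<bullet>c col D i)) = 0"
    by (metis (no_types, lifting) Re_sum plus_complex.sel(1) sum.cong zero_complex.sel(1))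
  have nn: "Re ((M *\<^sub>v v) \<bullet>c v) \<ge> 0" "v \<noteq> 0\<^sub>v n \<Longrightarrow> Re ((M *\<^sub>v v) \<bullet>c v) > 0"
    if "pos_def M" "M \<in> carrier_mat n n" "v \<in> carrier_vec n" for M v
    using that by (cases "v = 0\<^sub>v n"; auto simp: pos_def_def less_imp_le)+
  have cd: "col D i \<in> carrier_vec n" for i by (simp add: carrier_vecI)
  have "col D i = 0\<^sub>v n" if i: "i < n" for i
  proof (rule ccontr)
    assume "col D i \<noteq> 0\<^sub>v n"
    then have "(\<Sum>i<n. Re ((S *\<^sub>v col D i) \<bullet>c col D i) + Re ((T *\<^sub>v col D i) \<bullet>c col D i)) > 0"
      using i by (intro sum_pos2[of _ i]) (auto intro!: add_nonneg_nonneg add_pos_nonneg nn S T cd)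
    with z show False by simp
  qed
  then have "D $$ (i,j) = 0" if "i < n" "j < n" for i j
    using that by (metis carrier_matD(1,2) D(1) index_col index_zero_vec(1))
  then have "D = 0\<^sub>m n n" by (intro eq_matI) auto
  have "S = D + T" unfolding D_def by (rule eq_matI) auto
  then show ?thesis using \<open>D = 0\<^sub>m n n\<close> by (simp add: mat_zero)
qed

definition real_diag :: "nat \<Rightarrow> (nat \<Rightarrow> real) \<Rightarrow> complex mat" where
  "real_diag n f = mat n n (\<lambda>(i,j). if i = j then complex_of_real (f i) else 0)"

lemma real_diag_dim[simp]: "dim_row (real_diag n f) = n" "dim_col (real_diag n f) = n" "real_diag n f \<in> carrier_mat n n"
  by (auto simp: real_diag_def)

lemma real_diag_mult: "real_diag n f * real_diag n g = real_diag n (\<lambda>i. f i * g i)"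
proof (rule eq_matI)
  fix i j assume "i < dim_row (real_diag n (\<lambda>i. f i * g i))" "j < dim_col (real_diag n (\<lambda>i. f i * g i))"
  then have ij: "i < n" "j < n" by simp_all
  have "(real_diag n f * real_diag n g) $$ (i,j) = (\<Sum>k<n. real_diag n f $$ (i,k) * real_diag n g $$ (k,j))"
    using ij by (simp add: scalar_prod_def lessThan_atLeast0)
  also have "\<dots> = (\<Sum>k<n. if k = i then real_diag n f $$ (i,i) * real_diag n g $$ (i,j) else 0)"
    by (rule sum.cong) (use ij in \<open>auto simp: real_diag_def\<close>)
  also have "\<dots> = real_diag n (\<lambda>i. f i * g i) $$ (i,j)" using ij by (simp add: real_diag_def)
  finally show "(real_diag n f * real_diag n g) $$ (i,j) = real_diag n (\<lambda>i. f i * g i) $$ (i,j)" .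
qed simp_all

lemma real_diag_adj: "(real_diag n f)\<^sup>\<dagger> = real_diag n f"
  by (rule eq_matI) (auto simp: real_diag_def)

lemma real_diag_one: "(\<And>i. i < n \<Longrightarrow> f i = 1) \<Longrightarrow> real_diag n f = 1\<^sub>m n"
  by (rule eq_matI) (auto simp: real_diag_def)

lemma adj_mult_self_index:
  fixes W :: "complex mat"
  assumes "W \<in> carrier_mat n m" "i < m" "j < m"
  shows "(W\<^sup>\<dagger> * W) $$ (i,j) = col W j \<bullet>c col W i"
  using assms by (simp add: scalar_prod_def mult.commute)

text \<open>Extends a given direction to an orthonormal basis; it supplies the change of basis of the
  diagonalization below.\<close>

lemma unitary_first_column:
  fixes v :: "complex vec"
  assumes v: "v \<in> carrier_vec n" "v \<noteq> 0\<^sub>v n"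
  obtains W c where "W \<in> carrier_mat n n" "W\<^sup>\<dagger> * W = 1\<^sub>m n" "col W 0 = c \<cdot>\<^sub>v v"
proof -
  interpret cof_vec_space n "TYPE(complex)" .
  have n0: "n \<noteq> 0" using v by (metis carrier_vecD vec_of_dim_0)
  define b where "b = basis_completion v"
  define ws where "ws = gram_schmidt n b"
  note bc = basis_completion[OF v, folded b_def]
  have hb: "b = v # tl b" using bc(6,7) n0 by (cases b) auto
  note gs = gram_schmidt_result[OF bc(2) bc(4) bc(5) ws_def]
  have len: "length ws = n" using gs(4) bc(6) by simp
  have hd: "hd ws = v" unfolding ws_def by (subst hb, rule gram_schmidt_hd[OF v(1)])
  \<comment> \<open>The basis from Gram-Schmidt is orthogonal but not normalized.\<close>
  define N where "N w = complex_of_real (1 / sqrt (Re (w \<bullet>c w)))" for w :: "complex vec"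
  define W where "W = mat_of_cols n (map (\<lambda>w. N w \<cdot>\<^sub>v w) ws)"
  have W: "W \<in> carrier_mat n n" unfolding W_def using mat_of_cols_carrier(1)[of n "map (\<lambda>w. N w \<cdot>\<^sub>v w) ws"] len by simp
  have wc: "ws ! j \<in> carrier_vec n" if "j < n" for j using gs(3) len that by auto
  have cW: "col W j = N (ws ! j) \<cdot>\<^sub>v (ws ! j)" if "j < n" for j
    unfolding W_def using wc that len by (subst col_mat_of_cols) auto
  have orth: "ws ! i \<bullet>c ws ! j = 0 \<longleftrightarrow> i \<noteq> j" if "i < n" "j < n" for i j
    using corthogonalD[OF gs(2)] that len by auto
  have "W\<^sup>\<dagger> * W = 1\<^sub>m n"
  proof (rule eq_matI)
    fix i j assume "i < dim_row (1\<^sub>m n :: complex mat)" "j < dim_col (1\<^sub>m n :: complex mat)"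
    then have ij: "i < n" "j < n" by simp_all
    have "(W\<^sup>\<dagger> * W) $$ (i,j) = N (ws ! j) * (cnj (N (ws ! i)) * (ws ! j \<bullet>c ws ! i))"
      using wc[OF ij(1)] wc[OF ij(2)]
      unfolding adj_mult_self_index[OF W ij] cW[OF ij(1)] cW[OF ij(2)] by (simp add: conjugate_smult_vec)
    also have "\<dots> = 1\<^sub>m n $$ (i,j)"
    proof (cases "i = j")
      case True
      let ?w = "ws ! i"
      have z: "?w \<noteq> 0\<^sub>v n"
      proof
        assume "?w = 0\<^sub>v n"
        then have "?w \<bullet>c ?w = 0" by simp
        then show False using orth[OF ij(1) ij(1)] by simp
      qed
      have "?w \<bullet>c ?w = complex_of_real (Re (?w \<bullet>c ?w))"
        by (simp add: complex_eq_iff scalar_prod_def)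
      then obtain r where r: "?w \<bullet>c ?w = complex_of_real r" by blast
      have "Re (?w \<bullet>c ?w) > 0" by (rule cscalar_self(2)[OF wc[OF ij(1)] z])
      then have "r > 0" unfolding r by simp
      then have "1 / sqrt r * (1 / sqrt r * r) = 1" by (simp add: field_simps)
      then have "N ?w * (cnj (N ?w) * (?w \<bullet>c ?w)) = 1"
        unfolding N_def r by (simp only: complex_cnj_complex_of_real Re_complex_of_real of_real_mult[symmetric] of_real_1)
      then show ?thesis using True ij by simp
    next
      case False
      then show ?thesis using orth[OF ij(2,1)] ij by simp
    qed
    finally show "(W\<^sup>\<dagger> * W) $$ (i,j) = 1\<^sub>m n $$ (i,j)" .
  qed (use W in simp_all)
  moreover have "ws ! 0 = v" using hd len n0 by (metis hd_conv_nth length_0_conv)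
  then have "col W 0 = N v \<cdot>\<^sub>v v" using cW[of 0] n0 by simp
  ultimately show ?thesis using that W by blast
qed

text \<open>The spectral theorem, by deflation: in an orthonormal basis that starts with an eigenvector, a
  Hermitian matrix is block diagonal, and the complementary block is again Hermitian.\<close>

lemma hermitian_diagonalization:
  fixes A :: "complex mat"
  assumes "A \<in> carrier_mat n n" "A\<^sup>\<dagger> = A"
  shows "\<exists>Q \<in> carrier_mat n n. Q\<^sup>\<dagger> * Q = 1\<^sub>m n \<and> diagonal_mat (Q\<^sup>\<dagger> * A * Q)"
  using assms
proof (induction n arbitrary: A)
  case 0
  then show ?case by (intro bexI[of _ "1\<^sub>m 0"]) (auto simp: diagonal_mat_def)
next
  case (Suc m)
  let ?n = "Suc m"
  note A = Suc.prems(1)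
  from spectrum_non_empty[OF A] obtain e where "eigenvalue A e" by (auto simp: spectrum_def)
  then obtain v where v: "v \<in> carrier_vec ?n" "v \<noteq> 0\<^sub>v ?n" "A *\<^sub>v v = e \<cdot>\<^sub>v v"
    using A unfolding eigenvalue_def eigenvector_def by auto
  obtain W c where W: "W \<in> carrier_mat ?n ?n" "W\<^sup>\<dagger> * W = 1\<^sub>m ?n" "col W 0 = c \<cdot>\<^sub>v v"
    by (rule unitary_first_column[OF v(1,2)])
  note [simp] = carrier_matD[OF A] carrier_matD[OF W(1)]
  define A' where "A' = W\<^sup>\<dagger> * A * W"
  have A': "A' \<in> carrier_mat ?n ?n" "A'\<^sup>\<dagger> = A'" unfolding A'_def
    by (auto simp: adj_simps mat_assoc Suc.prems(2) intro: carrier_matI)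
  \<comment> \<open>The first column of \<open>A'\<close> is \<open>e\<close> times a unit vector, since \<open>v\<close> is an eigenvector; the first row follows by symmetry.\<close>
  have c0: "A' $$ (i,0) = (if i = 0 then e else 0)" if i: "i < ?n" for i
  proof -
    have "A *\<^sub>v col W 0 = e \<cdot>\<^sub>v col W 0"
      unfolding W(3) using v A by (simp add: mult_mat_vec[of A ?n ?n] smult_smult_assoc mult.commute)
    then have "col (A * W) 0 = e \<cdot>\<^sub>v col W 0" by (subst col_mult2[OF A W(1)]) simp_all
    moreover have "A' $$ (i,0) = row (W\<^sup>\<dagger>) i \<bullet> col (A * W) 0"
      unfolding A'_def using i by (simp add: mat_assoc)
    ultimately have "A' $$ (i,0) = e * (row (W\<^sup>\<dagger>) i \<bullet> col W 0)" by simp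
    also have "row (W\<^sup>\<dagger>) i \<bullet> col W 0 = (W\<^sup>\<dagger> * W) $$ (i,0)" using i by simp
    finally show ?thesis unfolding W(2) using i by simp
  qed
  have r0: "A' $$ (0,i) = (if i = 0 then cnj e else 0)" if i: "i < ?n" for i
  proof -
    have "A' $$ (0,i) = A'\<^sup>\<dagger> $$ (0,i)" using A'(2) by simp
    also have "\<dots> = cnj (A' $$ (i,0))" using i carrier_matD[OF A'(1)] by (subst adj_index) simp_all
    finally show ?thesis using c0[OF i] by simp
  qed
  define A3 where "A3 = mat m m (\<lambda>(i,j). A' $$ (Suc i, Suc j))"
  have A3: "A3 \<in> carrier_mat m m" by (simp add: A3_def)
  have A3h: "A3\<^sup>\<dagger> = A3"
  proof (rule eq_matI)
    fix i j assume "i < dim_row A3" "j < dim_col A3"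
    then have ij: "i < m" "j < m" by (simp_all add: A3_def)
    have "A' $$ (Suc i, Suc j) = A'\<^sup>\<dagger> $$ (Suc i, Suc j)" using A'(2) by simp
    also have "\<dots> = cnj (A' $$ (Suc j, Suc i))" using ij carrier_matD[OF A'(1)] by (subst adj_index) simp_all
    finally show "A3\<^sup>\<dagger> $$ (i,j) = A3 $$ (i,j)" using ij by (simp add: A3_def)
  qed (simp_all add: A3_def)
  define E where "E = mat 1 1 (\<lambda>_. e)"
  have blk: "A' = four_block_mat E (0\<^sub>m 1 m) (0\<^sub>m m 1) A3"
    by (rule eq_matI) (use carrier_matD[OF A'(1)] c0 r0 c0[of 0] r0[of 0] in \<open>auto simp: A3_def E_def\<close>)
  from Suc.IH[OF A3 A3h] obtain Q3 where Q3: "Q3 \<in> carrier_mat m m" "Q3\<^sup>\<dagger> * Q3 = 1\<^sub>m m" "diagonal_mat (Q3\<^sup>\<dagger> * A3 * Q3)"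
    by blast
  define F where "F = four_block_mat (1\<^sub>m 1) (0\<^sub>m 1 m) (0\<^sub>m m 1) Q3"
  note [simp] = carrier_matD[OF A3] carrier_matD[OF Q3(1)]
  have [simp]: "dim_row F = ?n" "dim_col F = ?n" "dim_row E = 1" "dim_col E = 1" by (simp_all add: F_def E_def)
  have FF: "F\<^sup>\<dagger> * F = 1\<^sub>m ?n"
    unfolding F_def by (simp add: adj_simps four_block_mult mat_zero mat_one Q3(2))
  have FAF: "F\<^sup>\<dagger> * (A' * F) = four_block_mat E (0\<^sub>m 1 m) (0\<^sub>m m 1) (Q3\<^sup>\<dagger> * A3 * Q3)"
    unfolding F_def blk by (simp add: adj_simps four_block_mult mat_zero mat_one mat_assoc)
  show ?case
  proof (intro bexI conjI)
    show "W * F \<in> carrier_mat ?n ?n" by (auto intro: carrier_matI)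
    have "(W * F)\<^sup>\<dagger> * (W * F) = F\<^sup>\<dagger> * ((W\<^sup>\<dagger> * W) * F)" by (simp add: adj_mult mat_assoc)
    then show "(W * F)\<^sup>\<dagger> * (W * F) = 1\<^sub>m ?n" by (simp add: W(2) FF mat_one)
    have "(W * F)\<^sup>\<dagger> * A * (W * F) = F\<^sup>\<dagger> * (A' * F)" unfolding A'_def by (simp add: adj_mult mat_assoc)
    then show "diagonal_mat ((W * F)\<^sup>\<dagger> * A * (W * F))"
      unfolding FAF using Q3(3) by (auto simp: diagonal_mat_def)
  qed
qed

lemma pos_def_sqrt_exists:
  assumes p: "pos_def A" and A: "A \<in> carrier_mat n n"
  shows "\<exists>S. pos_def S \<and> S * S = A"
proof -
  have h: "A\<^sup>\<dagger> = A" using p by (simp add: pos_def_def hermitian_mat_def)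
  obtain Q where Q: "Q \<in> carrier_mat n n" "Q\<^sup>\<dagger> * Q = 1\<^sub>m n" and dg: "diagonal_mat (Q\<^sup>\<dagger> * A * Q)"
    using hermitian_diagonalization[OF A h] by blast
  note [simp] = carrier_matD[OF A] carrier_matD[OF Q(1)]
  have QQ: "Q * Q\<^sup>\<dagger> = 1\<^sub>m n" by (rule mat_mult_left_right_inverse[OF _ Q(1) Q(2)]) (use Q in simp)
  define d where "d i = Re ((A *\<^sub>v col Q i) \<bullet>c col Q i)" for i
  have cQ: "col Q i \<in> carrier_vec n" for i by (simp add: carrier_vecI)
  have diag: "(Q\<^sup>\<dagger> * A * Q) $$ (i,i) = (A *\<^sub>v col Q i) \<bullet>c col Q i" if "i < n" for i
  proof -
    have "(Q\<^sup>\<dagger> * A * Q) $$ (i,i) = (Q\<^sup>\<dagger> * (A * Q)) $$ (i,i)" by (simp add: mat_assoc)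
    also have "\<dots> = row (Q\<^sup>\<dagger>) i \<bullet> col (A * Q) i" using that by (subst index_mult_mat) simp_all
    also have "col (A * Q) i = A *\<^sub>v col Q i" by (rule col_mult2[OF A Q(1) that])
    also have "row (Q\<^sup>\<dagger>) i = conjugate (col Q i)" using that by (intro eq_vecI) auto
    also have "conjugate (col Q i) \<bullet> (A *\<^sub>v col Q i) = (A *\<^sub>v col Q i) \<bullet>c col Q i"
      by (rule comm_scalar_prod[of _ n]) (auto intro: carrier_vecI)
    finally show ?thesis .
  qed
  have im: "Im ((Q\<^sup>\<dagger> * A * Q) $$ (i,i)) = 0" if "i < n" for i
  proof -
    let ?M = "Q\<^sup>\<dagger> * A * Q"
    have "?M\<^sup>\<dagger> = ?M" by (simp add: adj_simps h mat_assoc)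
    then have "?M $$ (i,i) = ?M\<^sup>\<dagger> $$ (i,i)" by simp
    also have "\<dots> = cnj (?M $$ (i,i))" using that by (subst adj_index) simp_all
    finally show ?thesis by (simp add: complex_eq_iff)
  qed
  have dpos: "d i > 0" if i: "i < n" for i
  proof -
    have "col Q i \<noteq> 0\<^sub>v n"
    proof
      assume z: "col Q i = 0\<^sub>v n"
      have "col Q i \<bullet>c col Q i = 1" using adj_mult_self_index[OF Q(1) i i] Q(2) i by simp
      then show False unfolding z by simp
    qed
    then show ?thesis unfolding d_def using p cQ by (simp add: pos_def_def)
  qed
  have D: "Q\<^sup>\<dagger> * A * Q = real_diag n d"
  proof (rule eq_matI)
    fix i j assume "i < dim_row (real_diag n d)" "j < dim_col (real_diag n d)"
    then have ij: "i < n" "j < n" by simp_all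
    show "(Q\<^sup>\<dagger> * A * Q) $$ (i,j) = real_diag n d $$ (i,j)"
    proof (cases "i = j")
      case True
      then show ?thesis using diag[OF ij(1)] im[OF ij(1)] ij by (simp add: real_diag_def d_def complex_eq_iff)
    next
      case False
      then show ?thesis using dg ij by (simp add: diagonal_mat_def real_diag_def)
    qed
  qed simp_all
  \<comment> \<open>Fourth roots, because the square root is produced as a Gram matrix \<open>M\<^sup>\<dagger> M\<close>, whose positivity is already known.\<close>
  define r where "r i = sqrt (sqrt (d i))" for i
  define M where "M = real_diag n r * Q\<^sup>\<dagger>"
  have M: "M \<in> carrier_mat n n" unfolding M_def by (auto intro: carrier_matI)
  have inv: "real_diag n (\<lambda>i. 1 / r i) * real_diag n r = 1\<^sub>m n"
    unfolding real_diag_mult by (rule real_diag_one) (use dpos in \<open>fastforce simp: r_def\<close>)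
  have "(Q * real_diag n (\<lambda>i. 1 / r i)) * M = Q * ((real_diag n (\<lambda>i. 1 / r i) * real_diag n r) * Q\<^sup>\<dagger>)"
    unfolding M_def by (simp add: mat_assoc)
  then have "(Q * real_diag n (\<lambda>i. 1 / r i)) * M = 1\<^sub>m n" unfolding inv by (simp add: mat_one QQ)
  then have "det M \<noteq> 0" by (rule det_nonzero_of_left_inverse[OF M, rotated]) (auto intro: carrier_matI)
  then have "pos_def (M\<^sup>\<dagger> * M)" by (rule pos_def_gram[OF M])
  moreover have "(M\<^sup>\<dagger> * M) * (M\<^sup>\<dagger> * M) = A"
  proof -
    have MM: "M\<^sup>\<dagger> * M = Q * (real_diag n r * real_diag n r * Q\<^sup>\<dagger>)" unfolding M_def by (simp add: adj_simps real_diag_adj mat_assoc)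
    have "(M\<^sup>\<dagger> * M) * (M\<^sup>\<dagger> * M) = Q * (real_diag n r * real_diag n r * ((Q\<^sup>\<dagger> * Q) * (real_diag n r * real_diag n r * Q\<^sup>\<dagger>)))"
      unfolding MM by (simp add: mat_assoc)
    also have "\<dots> = Q * ((real_diag n r * real_diag n r * (real_diag n r * real_diag n r)) * Q\<^sup>\<dagger>)"
      unfolding Q(2) by (simp add: mat_one mat_assoc)
    also have "real_diag n r * real_diag n r * (real_diag n r * real_diag n r) = real_diag n d"
      unfolding real_diag_mult by (rule eq_matI) (use dpos in \<open>auto simp: real_diag_def r_def less_imp_le\<close>)
    also have "Q * (real_diag n d * Q\<^sup>\<dagger>) = (Q * Q\<^sup>\<dagger>) * A * (Q * Q\<^sup>\<dagger>)" unfolding D[symmetric] by (simp add: mat_assoc)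
    finally show ?thesis unfolding QQ by (simp add: mat_one)
  qed
  ultimately show ?thesis by blast
qed

lemma msqrt_pos_def:
  assumes p: "pos_def A" and A: "A \<in> carrier_mat n n"
  shows "pos_def (msqrt A)" "msqrt A * msqrt A = A" "msqrt A \<in> carrier_mat n n" "(msqrt A)\<^sup>\<dagger> = msqrt A" "det (msqrt A) \<noteq> 0"
proof -
  have c: "S \<in> carrier_mat n n" if "pos_def S" "S * S = A" for S
  proof -
    have "dim_row (S * S) = n" using that(2) A by simp
    then show ?thesis using that(1) by (auto simp: pos_def_def hermitian_mat_def)
  qed
  have "\<exists>!S. pos_def S \<and> S * S = A"
  proof (rule ex_ex1I[OF pos_def_sqrt_exists[OF assms]])
    fix S T assume "pos_def S \<and> S * S = A" "pos_def T \<and> T * T = A"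
    then show "S = T" using pos_def_sqrt_unique[of S n T] c by metis
  qed
  then have m: "pos_def (msqrt A) \<and> msqrt A * msqrt A = A" unfolding msqrt_def by (rule theI')
  then show "pos_def (msqrt A)" "msqrt A * msqrt A = A" "msqrt A \<in> carrier_mat n n" "(msqrt A)\<^sup>\<dagger> = msqrt A"
    using c by (auto simp: pos_def_def hermitian_mat_def)
  then show "det (msqrt A) \<noteq> 0" using pos_def_det by blast
qed

lemma pos_def_inverse_sqrt:
  assumes p: "pos_def A" and A: "A \<in> carrier_mat n n" and R: "R = minv (msqrt A)"
  shows "R \<in> carrier_mat n n" "R\<^sup>\<dagger> = R" "R * msqrt A = 1\<^sub>m n" "msqrt A * R = 1\<^sub>m n" "R * (A * R) = 1\<^sub>m n"
proof -
  note m = msqrt_pos_def[OF p A]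
  note i = minv_inverse[OF m(3,5), folded R]
  show r: "R \<in> carrier_mat n n" "R * msqrt A = 1\<^sub>m n" "msqrt A * R = 1\<^sub>m n" using i by auto
  have "minv ((msqrt A)\<^sup>\<dagger>) = (minv (msqrt A))\<^sup>\<dagger>" by (rule minv_adj[OF m(3,5)])
  then show "R\<^sup>\<dagger> = R" by (simp only: m(4) R)
  note [simp] = carrier_matD[OF m(3)] carrier_matD[OF i(1)]
  have "R * ((msqrt A * msqrt A) * R) = (R * msqrt A) * (msqrt A * R)" by (simp add: mat_assoc)
  then show "R * (A * R) = 1\<^sub>m n" unfolding i m(2) by simp
qed


section \<open>Stable matrices and the Stein equation\<close>

lemma stable_one_minus_det:
  assumes W: "W \<in> carrier_mat d d" and s: "stable W"
  shows "det (1\<^sub>m d - W) \<noteq> 0"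
proof (rule det_nonzero_of_kernel[of _ d])
  show "1\<^sub>m d - W \<in> carrier_mat d d" using W by (simp add: minus_carrier_mat)
  fix v assume v: "v \<in> carrier_vec d" "(1\<^sub>m d - W) *\<^sub>v v = 0\<^sub>v d"
  show "v = 0\<^sub>v d"
  proof (rule ccontr)
    assume n: "v \<noteq> 0\<^sub>v d"
    have "(1\<^sub>m d - W) *\<^sub>v v = v - W *\<^sub>v v" using W v(1) by (simp add: minus_mult_distrib_mat_vec[of _ d d])
    then have e: "v - W *\<^sub>v v = 0\<^sub>v d" using v(2) by simp
    have "W *\<^sub>v v = 1 \<cdot>\<^sub>v v"
    proof (rule eq_vecI)
      fix i assume "i < dim_vec (1 \<cdot>\<^sub>v v)"
      then have i: "i < d" using v(1) by simp
      have "v $ i - (W *\<^sub>v v) $ i = (v - W *\<^sub>v v) $ i" using W i by (subst index_minus_vec) simp_all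
      also have "\<dots> = 0" unfolding e using i by simp
      finally show "(W *\<^sub>v v) $ i = (1 \<cdot>\<^sub>v v) $ i" using i v(1) by simp
    qed (use W v in simp)
    then have "eigenvalue W 1" using W v(1) n unfolding eigenvalue_def eigenvector_def by auto
    then show False using s by (auto simp: stable_def)
  qed
qed

text \<open>Scaling \<open>W\<close> by \<open>1 / \<rho>\<close>, with \<open>\<rho>\<close> larger than all moduli of eigenvalues, gives a matrix whose powers
  are bounded by the Jordan normal form.\<close>

lemma stable_power_bound:
  assumes W: "W \<in> carrier_mat n n" and st: "stable W"
  obtains \<rho> c where "0 < \<rho>" "\<rho> < 1" "\<And>k. norm_bound (W ^\<^sub>m k) (c * \<rho> ^ k)"
proof -
  have fin: "finite (spectrum W)" by (rule card_finite_spectrum[OF W])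
  define m where "m = Max (insert 0 (cmod ` spectrum W))"
  have m1: "m < 1" unfolding m_def using fin st by (auto simp: stable_def spectrum_def)
  have m0: "0 \<le> m" unfolding m_def using fin by simp
  have mb: "cmod e \<le> m" if "eigenvalue W e" for e
    unfolding m_def using that fin by (intro Max_ge) (auto simp: spectrum_def)
  \<comment> \<open>Any number strictly between the spectral radius and 1 serves as rate.\<close>
  define \<rho> where "\<rho> = (1 + m) / 2"
  have r: "0 < \<rho>" "\<rho> < 1" "m < \<rho>" using m0 m1 by (auto simp: \<rho>_def)
  define c where "c = complex_of_real (1 / \<rho>)"
  have c0: "c \<noteq> 0" using r by (simp add: c_def)
  let ?W = "c \<cdot>\<^sub>m W"
  have W': "?W \<in> carrier_mat n n" using W by simp
  have ev: "cmod e < 1" if "eigenvalue ?W e" for e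
  proof -
    from that obtain v where v: "v \<in> carrier_vec n" "v \<noteq> 0\<^sub>v n" "?W *\<^sub>v v = e \<cdot>\<^sub>v v"
      using W unfolding eigenvalue_def eigenvector_def by auto
    have "c \<cdot>\<^sub>v (W *\<^sub>v v) = e \<cdot>\<^sub>v v" unfolding v(3)[symmetric] using v(1) W
      by (intro eq_vecI) (auto simp: scalar_prod_def sum_distrib_left mult.assoc)
    then have "(1 / c) \<cdot>\<^sub>v (c \<cdot>\<^sub>v (W *\<^sub>v v)) = (1 / c) \<cdot>\<^sub>v (e \<cdot>\<^sub>v v)" by simp
    then have "W *\<^sub>v v = (e / c) \<cdot>\<^sub>v v" using c0 by (simp add: smult_smult_assoc)
    then have "eigenvalue W (e / c)" using v W unfolding eigenvalue_def eigenvector_def by auto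
    from mb[OF this] have "cmod e \<le> m / \<rho>" using r by (simp add: c_def norm_divide norm_mult mult.commute field_simps)
    also have "m / \<rho> < 1" using r by simp
    finally show ?thesis .
  qed
  from char_poly_factorized[OF W'] obtain as where as: "char_poly ?W = (\<Prod>a\<leftarrow>as. [:- a, 1:])" by auto
  have lt: "cmod a < 1" if "a \<in> set as" for a
    using ev linear_poly_root[OF that] unfolding eigenvalue_root_char_poly[OF W'] as by simp
  have "\<exists>c1 c2. \<forall>k. norm_bound (?W ^\<^sub>m k) (c1 + c2 * of_nat k ^ (0 - 1))"
    by (rule factored_char_poly_norm_bound[OF W' as jordan_nf_exists[OF W' as]]) (use lt in \<open>force+\<close>)
  then obtain b where b: "norm_bound (?W ^\<^sub>m k) b" for k by auto
  have p: "W ^\<^sub>m k = complex_of_real (\<rho> ^ k) \<cdot>\<^sub>m (?W ^\<^sub>m k)" for k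
  proof (induction k)
    case 0
    then show ?case by (simp add: mat_smult)
  next
    case (Suc k)
    have d: "?W ^\<^sub>m k \<in> carrier_mat n n" using W' by (rule pow_carrier_mat)
    have "W ^\<^sub>m Suc k = W ^\<^sub>m k * W" by simp
    also have "\<dots> = complex_of_real (\<rho> ^ k) \<cdot>\<^sub>m (?W ^\<^sub>m k) * W" by (subst Suc.IH) (rule refl)
    also have "\<dots> = complex_of_real (\<rho> ^ k) \<cdot>\<^sub>m ((?W ^\<^sub>m k) * W)" using d W by (simp add: mat_smult)
    also have "\<dots> = complex_of_real (\<rho> ^ Suc k) \<cdot>\<^sub>m (c \<cdot>\<^sub>m ((?W ^\<^sub>m k) * W))"
      unfolding c_def by (rule eq_matI) (use r in simp_all)
    also have "c \<cdot>\<^sub>m ((?W ^\<^sub>m k) * W) = (?W ^\<^sub>m k) * ?W" using d W by (simp add: mat_smult)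
    finally show ?case by simp
  qed
  have "norm_bound (W ^\<^sub>m k) (b * \<rho> ^ k)" for k
  proof
    fix i j assume "i < dim_row (W ^\<^sub>m k)" "j < dim_col (W ^\<^sub>m k)"
    then have ij: "i < n" "j < n" using W by (simp_all add: pow_mat_dim split: if_splits)
    have d: "?W ^\<^sub>m k \<in> carrier_mat n n" using W' by (rule pow_carrier_mat)
    have "cmod ((?W ^\<^sub>m k) $$ (i,j)) \<le> b" using b[of k] carrier_matD[OF d] ij unfolding norm_bound_def by simp
    then have "\<rho> ^ k * cmod ((?W ^\<^sub>m k) $$ (i,j)) \<le> \<rho> ^ k * b" using r by (simp add: mult_left_mono)
    then show "cmod ((W ^\<^sub>m k) $$ (i,j)) \<le> b * \<rho> ^ k"
      unfolding p[of k] index_smult_mat(1)[of i "?W ^\<^sub>m k" j, unfolded carrier_matD[OF d], OF ij]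
      using r by (simp add: norm_mult mult.commute norm_power)
  qed
  with r show ?thesis using that by blast
qed

text \<open>The terms of the series that solves the Stein equation with right-hand side \<open>Q\<close>.\<close>

definition stein_term :: "complex mat \<Rightarrow> complex mat \<Rightarrow> nat \<Rightarrow> complex mat" where
  "stein_term W Q k = (W ^\<^sub>m k)\<^sup>\<dagger> * Q * (W ^\<^sub>m k)"

context
  fixes W :: "complex mat" and n :: nat
  assumes W: "W \<in> carrier_mat n n" and st: "stable W"
begin

lemma pow_dim[simp]: "dim_row (W ^\<^sub>m k) = n" "dim_col (W ^\<^sub>m k) = n" "dim_row W = n" "dim_col W = n"
  using W pow_carrier_mat[OF W, of k] by auto

lemma stein_term_dim[simp]: "dim_row (stein_term W Q k) = n" "dim_col (stein_term W Q k) = n"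
  by (simp_all add: stein_term_def)

lemma stein_term_Suc: "Q \<in> carrier_mat n n \<Longrightarrow> stein_term W Q (Suc k) = W\<^sup>\<dagger> * stein_term W Q k * W"
  by (simp add: stein_term_def adj_mult mat_assoc)

lemma stein_term_0: "Q \<in> carrier_mat n n \<Longrightarrow> stein_term W Q 0 = Q"
  using W by (simp add: stein_term_def adj_one)

lemma stein_term_bound:
  assumes Q: "Q \<in> carrier_mat n n"
  obtains q C where "0 < q" "q < 1" "\<And>k i j. i < n \<Longrightarrow> j < n \<Longrightarrow> cmod (stein_term W Q k $$ (i,j)) \<le> C * q ^ k"
proof -
  obtain \<rho> c where r: "0 < \<rho>" "\<rho> < 1" and b: "\<And>k. norm_bound (W ^\<^sub>m k) (c * \<rho> ^ k)"
    using stable_power_bound[OF W st] by blast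
  obtain d where d: "norm_bound Q d" using norm_bound_max by blast
  have "cmod (stein_term W Q k $$ (i,j)) \<le> c * d * n * c * n * (\<rho>\<^sup>2) ^ k" if "i < n" "j < n" for k i j
  proof -
    have P: "W ^\<^sub>m k \<in> carrier_mat n n" by (rule pow_carrier_mat[OF W])
    have "norm_bound ((W ^\<^sub>m k)\<^sup>\<dagger>) (c * \<rho> ^ k)" using b[of k] by (auto simp: norm_bound_def)
    from norm_bound_mult[OF adj_carrier[OF P] Q this d]
    have "norm_bound ((W ^\<^sub>m k)\<^sup>\<dagger> * Q) (c * \<rho> ^ k * d * n)" .
    from norm_bound_mult[OF _ P this b] 
    have "norm_bound (stein_term W Q k) (c * \<rho> ^ k * d * n * (c * \<rho> ^ k) * n)"
      unfolding stein_term_def using Q P by (meson adj_carrier mult_carrier_mat)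
    then have "cmod (stein_term W Q k $$ (i,j)) \<le> c * \<rho> ^ k * d * n * (c * \<rho> ^ k) * n"
      using that unfolding norm_bound_def by simp
    also have "\<dots> = c * d * n * c * n * (\<rho>\<^sup>2) ^ k" by (simp add: power2_eq_square power_mult_distrib)
    finally show ?thesis .
  qed
  moreover have "0 < \<rho>\<^sup>2" "\<rho>\<^sup>2 < 1" using r by (simp_all add: power_less_one_iff abs_square_less_1)
  ultimately show ?thesis using that by blast
qed

text \<open>A solution equals every \<open>(W\<^sup>k)\<^sup>\<dagger> X W\<^sup>k\<close>, and these tend to zero.\<close>

lemma stein_homogeneous:
  assumes X: "X \<in> carrier_mat n n" and e: "X = W\<^sup>\<dagger> * X * W"
  shows "X = 0\<^sub>m n n"
proof (rule eq_matI)
  have s: "stein_term W X k = X" for k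
    by (induction k) (simp_all add: stein_term_0 stein_term_Suc X e[symmetric])
  obtain q C where q: "0 < q" "q < 1" and b: "\<And>k i j. i < n \<Longrightarrow> j < n \<Longrightarrow> cmod (stein_term W X k $$ (i,j)) \<le> C * q ^ k"
    using stein_term_bound[OF X] by blast
  fix i j assume "i < dim_row (0\<^sub>m n n :: complex mat)" "j < dim_col (0\<^sub>m n n :: complex mat)"
  then have ij: "i < n" "j < n" by simp_all
  have "(\<lambda>k. q ^ k) \<longlonglongrightarrow> 0" using q by (intro LIMSEQ_power_zero) auto
  then have "(\<lambda>k. C * q ^ k) \<longlonglongrightarrow> C * 0" by (intro tendsto_mult tendsto_const)
  then have "cmod (X $$ (i,j)) \<le> C * 0"
    by (rule LIMSEQ_le_const) (use b[OF ij] in \<open>auto simp: s\<close>)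
  then show "X $$ (i,j) = 0\<^sub>m n n $$ (i,j)" using ij by simp
qed (use X in auto)

lemma stein_exists:
  assumes Q: "Q \<in> carrier_mat n n"
  shows "\<exists>P \<in> carrier_mat n n. P - W\<^sup>\<dagger> * P * W = Q"
proof -
  obtain q C where q: "0 < q" "q < 1" and b: "\<And>k i j. i < n \<Longrightarrow> j < n \<Longrightarrow> cmod (stein_term W Q k $$ (i,j)) \<le> C * q ^ k"
    using stein_term_bound[OF Q] by blast
  define P where "P = mat n n (\<lambda>(i,j). \<Sum>k. stein_term W Q k $$ (i,j))"
  have P: "P \<in> carrier_mat n n" by (simp add: P_def)
  note [simp] = carrier_matD[OF P] carrier_matD[OF Q]
  have s: "(\<lambda>k. stein_term W Q k $$ (i,j)) sums P $$ (i,j)" if "i < n" "j < n" for i j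
  proof -
    have "summable (\<lambda>k. C * q ^ k)" using q by (intro summable_mult summable_geometric) simp
    then have "summable (\<lambda>k. stein_term W Q k $$ (i,j))"
      by (rule summable_comparison_test'[where N = 0]) (use b that in simp)
    then show ?thesis using that by (simp add: P_def summable_sums)
  qed
  have ex: "(W\<^sup>\<dagger> * X * W) $$ (i,j) = (\<Sum>b<n. (\<Sum>a<n. cnj (W $$ (a,i)) * X $$ (a,b)) * W $$ (b,j))"
    if "X \<in> carrier_mat n n" "i < n" "j < n" for X i j
    using that by (simp add: scalar_prod_def lessThan_atLeast0)
  have "P - W\<^sup>\<dagger> * P * W = Q"
  proof (rule eq_matI)
    fix i j assume "i < dim_row Q" "j < dim_col Q"
    then have ij: "i < n" "j < n" by simp_all
    \<comment> \<open>Conjugation with \<open>W\<close> shifts the series by one term, so only the initial term \<open>Q\<close> survives in the difference.\<close>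
    have "(\<lambda>k. (W\<^sup>\<dagger> * stein_term W Q k * W) $$ (i,j)) sums (W\<^sup>\<dagger> * P * W) $$ (i,j)"
      unfolding ex[OF P ij] using s
      by (subst ex[OF _ ij]) (auto intro!: carrier_matI sums_sum sums_mult2 sums_mult)
    then have "(\<lambda>k. stein_term W Q (Suc k) $$ (i,j)) sums (W\<^sup>\<dagger> * P * W) $$ (i,j)"
      by (simp add: stein_term_Suc Q)
    then have "(\<lambda>k. stein_term W Q k $$ (i,j)) sums ((W\<^sup>\<dagger> * P * W) $$ (i,j) + stein_term W Q 0 $$ (i,j))"
      by (rule sums_Suc)
    from sums_unique2[OF this s[OF ij]]
    have "P $$ (i,j) = (W\<^sup>\<dagger> * P * W) $$ (i,j) + Q $$ (i,j)" by (simp only: stein_term_0[OF Q])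
    moreover have "(P - W\<^sup>\<dagger> * P * W) $$ (i,j) = P $$ (i,j) - (W\<^sup>\<dagger> * P * W) $$ (i,j)" using ij by (subst index_minus_mat) simp_all
    ultimately show "(P - W\<^sup>\<dagger> * P * W) $$ (i,j) = Q $$ (i,j)" by simp
  qed simp_all
  then show ?thesis using P by blast
qed

lemma stein_ex1:
  assumes Q: "Q \<in> carrier_mat n n"
  shows "\<exists>!P. P \<in> carrier_mat n n \<and> P - W\<^sup>\<dagger> * P * W = Q"
proof (rule ex_ex1I)
  show "\<exists>P. P \<in> carrier_mat n n \<and> P - W\<^sup>\<dagger> * P * W = Q" using stein_exists[OF Q] by blast
  fix P P' assume a: "P \<in> carrier_mat n n \<and> P - W\<^sup>\<dagger> * P * W = Q" "P' \<in> carrier_mat n n \<and> P' - W\<^sup>\<dagger> * P' * W = Q"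
  note [simp] = carrier_matD[OF conjunct1[OF a(1)]] carrier_matD[OF conjunct1[OF a(2)]]
  let ?X = "P - P'"
  have "?X - W\<^sup>\<dagger> * ?X * W = (P - W\<^sup>\<dagger> * P * W) - (P' - W\<^sup>\<dagger> * P' * W)"
    by (simp add: mat_ring mat_ac)
  also have "\<dots> = 0\<^sub>m n n" unfolding conjunct2[OF a(1)] conjunct2[OF a(2)] using Q by simp
  finally have z: "?X - W\<^sup>\<dagger> * ?X * W = 0\<^sub>m n n" .
  have sub: "A = B" if "A - B = 0\<^sub>m n n" "A \<in> carrier_mat n n" "B \<in> carrier_mat n n" for A B :: "complex mat"
  proof (rule eq_matI)
    fix i j assume "i < dim_row B" "j < dim_col B"
    then have "A $$ (i,j) - B $$ (i,j) = (A - B) $$ (i,j)" "i < n" "j < n" using that(2,3) by simp_all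
    then show "A $$ (i,j) = B $$ (i,j)" unfolding that(1) by simp
  qed (use that in auto)
  have "?X = 0\<^sub>m n n" by (rule stein_homogeneous[OF _ sub[OF z]]) (auto intro: carrier_matI)
  then show "P = P'" by (rule sub) (use a in auto)
qed

end

lemma stein_sol_solves:
  assumes "W \<in> carrier_mat n n" "stable W" "U \<in> carrier_mat p n" "V \<in> carrier_mat p n"
  shows "stein_sol W U V \<in> carrier_mat n n"
    "stein_sol W U V - W\<^sup>\<dagger> * stein_sol W U V * W = U\<^sup>\<dagger> * U - V\<^sup>\<dagger> * V"
proof -
  have "U\<^sup>\<dagger> * U - V\<^sup>\<dagger> * V \<in> carrier_mat n n" using assms by (auto intro: carrier_matI)
  from theI'[OF stein_ex1[OF assms(1,2) this]] assms(1)
  show "stein_sol W U V \<in> carrier_mat n n"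
    "stein_sol W U V - W\<^sup>\<dagger> * stein_sol W U V * W = U\<^sup>\<dagger> * U - V\<^sup>\<dagger> * V"
    by (auto simp: stein_sol_def)
qed


section \<open>The unitary matrices of the data set\<close>

text \<open>With \<open>N = (1 - W\<^sup>\<dagger>)\<^sup>-\<^sup>1\<close> these are the blocks that complete the isometric column of \<open>U\<close> and \<open>W\<close> to a unitary
  matrix.  In terms of \<open>E = N U\<^sup>\<dagger>\<close> they read \<open>X = 1 - U E\<close> and \<open>Y = E - W E\<close>, and \<open>U\<^sup>\<dagger> = E - W\<^sup>\<dagger> E\<close>
  turns both claims into consequences of the isometry relation.\<close>

lemma isometry_completion:
  fixes U :: "complex mat"
  assumes c: "W \<in> carrier_mat d d" "U \<in> carrier_mat p d" "N \<in> carrier_mat d d"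
  and iso: "U\<^sup>\<dagger> * U + W\<^sup>\<dagger> * W = 1\<^sub>m d"
  and N: "N * (1\<^sub>m d - W\<^sup>\<dagger>) = 1\<^sub>m d" "(1\<^sub>m d - W\<^sup>\<dagger>) * N = 1\<^sub>m d"
  and X: "X = 1\<^sub>m p - U * N * U\<^sup>\<dagger>" and Y: "Y = (1\<^sub>m d - W) * N * U\<^sup>\<dagger>"
  shows "U\<^sup>\<dagger> * X + W\<^sup>\<dagger> * Y = 0\<^sub>m d p" "X\<^sup>\<dagger> * X + Y\<^sup>\<dagger> * Y = 1\<^sub>m p"
proof -
  note [simp] = c[THEN carrier_matD(1)] c[THEN carrier_matD(2)]
  define E where "E = N * U\<^sup>\<dagger>"
  have [simp]: "dim_row E = d" "dim_col E = p" by (simp_all add: E_def)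
  have X': "X = 1\<^sub>m p - U * E" and Y': "Y = E - W * E" unfolding X Y E_def by (simp_all add: mat_ring)
  have "(1\<^sub>m d - W\<^sup>\<dagger>) * E = U\<^sup>\<dagger>" unfolding E_def by (rule mat_inv_cancel[OF N(2)]) simp_all
  then have Uh: "U\<^sup>\<dagger> = E - W\<^sup>\<dagger> * E" by (simp add: mat_ring)
  have isom: "U\<^sup>\<dagger> * (U * Z) + W\<^sup>\<dagger> * (W * Z) = Z" if "dim_row Z = d" for Z
  proof -
    have "U\<^sup>\<dagger> * (U * Z) + W\<^sup>\<dagger> * (W * Z) = (U\<^sup>\<dagger> * U + W\<^sup>\<dagger> * W) * Z" using that by (simp add: mat_ring)
    then show ?thesis unfolding iso using that by (simp add: mat_one)
  qed
  have "U\<^sup>\<dagger> * X + W\<^sup>\<dagger> * Y = U\<^sup>\<dagger> + W\<^sup>\<dagger> * E - (U\<^sup>\<dagger> * (U * E) + W\<^sup>\<dagger> * (W * E))"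
    unfolding X' Y' by (simp add: mat_ring mat_ac)
  also have "\<dots> = U\<^sup>\<dagger> + W\<^sup>\<dagger> * E - E" by (simp add: isom)
  also have "\<dots> = 0\<^sub>m d p" unfolding Uh by (simp add: mat_ring mat_ac)
  finally show z: "U\<^sup>\<dagger> * X + W\<^sup>\<dagger> * Y = 0\<^sub>m d p" .
  have [simp]: "dim_row X = p" "dim_col X = p" "dim_row Y = d" "dim_col Y = p" by (simp_all add: X Y)
  have "X\<^sup>\<dagger> * X + Y\<^sup>\<dagger> * Y = X - E\<^sup>\<dagger> * (U\<^sup>\<dagger> * X + W\<^sup>\<dagger> * Y) + E\<^sup>\<dagger> * Y"
    unfolding arg_cong[OF X', of mat_adjoint] arg_cong[OF Y', of mat_adjoint] by (simp add: adj_simps mat_ring mat_ac)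
  also have "\<dots> = 1\<^sub>m p - U * E + E\<^sup>\<dagger> * (E - W * E)" unfolding z by (simp add: mat_ring X' Y')
  also have "U = E\<^sup>\<dagger> - E\<^sup>\<dagger> * W" using arg_cong[OF Uh, of mat_adjoint] by (simp add: adj_simps)
  finally show "X\<^sup>\<dagger> * X + Y\<^sup>\<dagger> * Y = 1\<^sub>m p" by (simp add: mat_ring mat_ac)
qed

text \<open>The Gram matrix of the block matrix with rows \<open>(X, Ut)\<close> and \<open>(T Y, Wt)\<close> has the diagonal blocks
  \<open>X\<^sup>\<dagger> X + (T Y)\<^sup>\<dagger> (T Y)\<close> and \<open>K\<close>, and the off-diagonal block \<open>L\<close>.  That block matrix is the unitary one with
  rows \<open>(X, U)\<close> and \<open>(Y, W)\<close>, multiplied by \<open>diag(1, T)\<close> from the left and by \<open>diag(1, T\<^sup>-\<^sup>1)\<close> from the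
  right, so its inverse is explicit, and \<open>Z\<close> is the upper left corner of the inverse Gram matrix.
  The corner of an inverse is the inverse of the Schur complement.\<close>

lemma schur_complement_inverse:
  fixes X :: "complex mat"
  assumes c: "X \<in> carrier_mat p p" "U \<in> carrier_mat p d" "Y \<in> carrier_mat d p" "W \<in> carrier_mat d d"
    "T \<in> carrier_mat d d" "Ti \<in> carrier_mat d d" "Ki \<in> carrier_mat d d"
  and u: "(four_block_mat X U Y W)\<^sup>\<dagger> * four_block_mat X U Y W = 1\<^sub>m (p + d)"
  and T: "T * Ti = 1\<^sub>m d" "Ti * T = 1\<^sub>m d" "T\<^sup>\<dagger> = T" "Ti\<^sup>\<dagger> = Ti"
  and Ut: "Ut = U * Ti" and Wt: "Wt = T * W * Ti"
  and K: "K = Ut\<^sup>\<dagger> * Ut + Wt\<^sup>\<dagger> * Wt" and L: "L = Ut\<^sup>\<dagger> * X + Wt\<^sup>\<dagger> * (T * Y)"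
  and Z: "Z = X\<^sup>\<dagger> * X + Y\<^sup>\<dagger> * (Ti * Ti) * Y"
  and Ki: "Ki * K = 1\<^sub>m d"
  shows "(X\<^sup>\<dagger> * X + (T * Y)\<^sup>\<dagger> * (T * Y) - L\<^sup>\<dagger> * (Ki * L)) * Z = 1\<^sub>m p"
proof -
  note [simp] = c[THEN carrier_matD(1)] c[THEN carrier_matD(2)]
  have TTi: "T * (Ti * Q) = Q" if "dim_row Q = d" for Q using that by (simp add: mat_inv_cancel[OF T(1)])
  have TiT: "Ti * (T * Q) = Q" if "dim_row Q = d" for Q using that by (simp add: mat_inv_cancel[OF T(2)])
  have [simp]: "dim_row Ut = p" "dim_col Ut = d" "dim_row Wt = d" "dim_col Wt = d"
    "dim_row K = d" "dim_col K = d" "dim_row L = d" "dim_col L = p" "dim_row Z = p" "dim_col Z = p"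
    by (simp_all add: Ut Wt K L Z)
  note u1 = four_block_unitaryD[OF c(1-4) u]
  have F: "four_block_mat X U Y W \<in> carrier_mat (p + d) (p + d)" by (auto intro: carrier_matI)
  have f: "(four_block_mat (X\<^sup>\<dagger>) (Y\<^sup>\<dagger>) (U\<^sup>\<dagger>) (W\<^sup>\<dagger>))\<^sup>\<dagger> * four_block_mat (X\<^sup>\<dagger>) (Y\<^sup>\<dagger>) (U\<^sup>\<dagger>) (W\<^sup>\<dagger>) = 1\<^sub>m (p + d)"
    using unitary_matI(2)[OF F u] by (simp add: adj_four_block)
  have u2: "X * X\<^sup>\<dagger> + U * U\<^sup>\<dagger> = 1\<^sub>m p" "Y * X\<^sup>\<dagger> + W * U\<^sup>\<dagger> = 0\<^sub>m d p" "X * Y\<^sup>\<dagger> + U * W\<^sup>\<dagger> = 0\<^sub>m p d" "Y * Y\<^sup>\<dagger> + W * W\<^sup>\<dagger> = 1\<^sub>m d"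
    using four_block_unitaryD[OF _ _ _ _ f] by (simp_all add: carrier_matI)
  define A where "A = Ti * (Ti * Y)"
  have [simp]: "dim_row A = d" "dim_col A = p" by (simp_all add: A_def)
  have Z': "Z = X\<^sup>\<dagger> * X + Y\<^sup>\<dagger> * A" unfolding Z A_def by (simp add: mat_ring)
  \<comment> \<open>The block below \<open>Z\<close> in the first block column of the inverse Gram matrix.\<close>
  define Z2 where "Z2 = T * (U\<^sup>\<dagger> * X + W\<^sup>\<dagger> * A)"
  have [simp]: "dim_row Z2 = d" "dim_col Z2 = p" by (simp_all add: Z2_def)
  have "X * Z + Ut * Z2 = (X * X\<^sup>\<dagger> + U * U\<^sup>\<dagger>) * X + (X * Y\<^sup>\<dagger> + U * W\<^sup>\<dagger>) * A"
    unfolding Z' Z2_def Ut by (simp add: mat_ring mat_ac TiT)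
  then have r1: "X * Z + Ut * Z2 = X" unfolding u2 by (simp add: mat_ring)
  have "T * Y * Z + Wt * Z2 = T * ((Y * X\<^sup>\<dagger> + W * U\<^sup>\<dagger>) * X) + T * ((Y * Y\<^sup>\<dagger> + W * W\<^sup>\<dagger>) * A)"
    unfolding Z' Z2_def Wt by (simp add: mat_ring mat_ac TiT)
  also have "\<dots> = T * A" unfolding u2 by (simp add: mat_ring)
  also have "\<dots> = Ti * Y" unfolding A_def by (simp add: TTi)
  finally have r2: "T * Y * Z + Wt * Z2 = Ti * Y" .
  have "L * Z + K * Z2 = Ut\<^sup>\<dagger> * (X * Z + Ut * Z2) + Wt\<^sup>\<dagger> * (T * Y * Z + Wt * Z2)"
    unfolding L K by (simp add: mat_ring mat_ac)
  also have "\<dots> = Ti * (U\<^sup>\<dagger> * X + W\<^sup>\<dagger> * Y)"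
    unfolding r1 r2 unfolding Ut Wt by (simp add: adj_simps T mat_ring TTi)
  also have "\<dots> = 0\<^sub>m d p" unfolding u1 by (simp add: mat_ring)
  finally have "Ki * (L * Z) + Ki * (K * Z2) = 0\<^sub>m d p" by (simp add: mat_mult_add[symmetric] mat_zero)
  then have "Ki * (L * Z) + Z2 = 0\<^sub>m d p" by (simp add: mat_inv_cancel[OF Ki])
  then have k: "Ki * (L * Z) - (- Z2) = 0\<^sub>m d p - 0\<^sub>m d p" by (simp add: mat_ring)
  have kz: "Ki * (L * Z) = - Z2" using mat_eq_of_diff[OF k] by (simp add: mat_zero)
  have "(X\<^sup>\<dagger> * X + (T * Y)\<^sup>\<dagger> * (T * Y) - L\<^sup>\<dagger> * (Ki * L)) * Z =
    X\<^sup>\<dagger> * (X * Z) + (T * Y)\<^sup>\<dagger> * (T * Y * Z) - L\<^sup>\<dagger> * (Ki * (L * Z))" by (simp add: mat_ring)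
  also have "\<dots> = X\<^sup>\<dagger> * (X * Z + Ut * Z2) + (T * Y)\<^sup>\<dagger> * (T * Y * Z + Wt * Z2)"
    unfolding kz arg_cong[OF L, of mat_adjoint] by (simp add: adj_simps mat_ring mat_ac)
  also have "\<dots> = X\<^sup>\<dagger> * X + Y\<^sup>\<dagger> * Y" unfolding r1 r2 by (simp add: adj_mult T mat_ring TTi)
  finally show ?thesis unfolding u1 .
qed

text \<open>The columns \<open>(Ut, Wt) Rk\<close> are orthonormal.  Subtracting from \<open>(X, Yt)\<close> its projection onto them leaves
  the Schur complement as Gram matrix, which \<open>Zs\<close> normalizes.\<close>

lemma schur_complement_normalization:
  fixes X :: "complex mat"
  assumes c: "X \<in> carrier_mat p p" "Ut \<in> carrier_mat p d" "Yt \<in> carrier_mat d p" "Wt \<in> carrier_mat d d"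
   "Zs \<in> carrier_mat p p" "Ki \<in> carrier_mat d d" "Rk \<in> carrier_mat d d"
  and K: "K = Ut\<^sup>\<dagger> * Ut + Wt\<^sup>\<dagger> * Wt" and L: "L = Ut\<^sup>\<dagger> * X + Wt\<^sup>\<dagger> * Yt"
  and Ki: "K * Ki = 1\<^sub>m d" 
  and Rk: "Rk\<^sup>\<dagger> = Rk" "Rk * (K * Rk) = 1\<^sub>m d"
  and Zs: "Zs\<^sup>\<dagger> = Zs" "(X\<^sup>\<dagger> * X + Yt\<^sup>\<dagger> * Yt - L\<^sup>\<dagger> * (Ki * L)) * (Zs * Zs) = 1\<^sub>m p"
  and M: "M = X * Zs - Ut * (Ki * L * Zs)" and B: "B = Yt * Zs - Wt * (Ki * L * Zs)"
  shows "Ut\<^sup>\<dagger> * M + Wt\<^sup>\<dagger> * B = 0\<^sub>m d p"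
    "(four_block_mat M (Ut * Rk) B (Wt * Rk))\<^sup>\<dagger> * four_block_mat M (Ut * Rk) B (Wt * Rk) = 1\<^sub>m (p + d)"
proof -
  note [simp] = c[THEN carrier_matD(1)] c[THEN carrier_matD(2)]
  have [simp]: "dim_row K = d" "dim_col K = d" "dim_row L = d" "dim_col L = p"
     "dim_row M = p" "dim_col M = p" "dim_row B = d" "dim_col B = p" by (simp_all add: K L M B)
  have KKi: "K * (Ki * Z) = Z" if "dim_row Z = d" for Z using that by (simp add: mat_inv_cancel[OF Ki])
  have "Ut\<^sup>\<dagger> * M + Wt\<^sup>\<dagger> * B = L * Zs - K * (Ki * (L * Zs))"
    unfolding M B L K by (simp add: mat_ring mat_ac)
  also have "\<dots> = 0\<^sub>m d p" by (simp add: KKi mat_ring)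
  finally show z: "Ut\<^sup>\<dagger> * M + Wt\<^sup>\<dagger> * B = 0\<^sub>m d p" .
  define S where "S = X\<^sup>\<dagger> * X + Yt\<^sup>\<dagger> * Yt - L\<^sup>\<dagger> * (Ki * L)"
  have [simp]: "dim_row S = p" "dim_col S = p" by (simp_all add: S_def)
  have "M\<^sup>\<dagger> * M + B\<^sup>\<dagger> * B = Zs * (X\<^sup>\<dagger> * M + Yt\<^sup>\<dagger> * B) - Zs * (L\<^sup>\<dagger> * (Ki\<^sup>\<dagger> * (Ut\<^sup>\<dagger> * M + Wt\<^sup>\<dagger> * B)))"
    unfolding arg_cong[OF M, of mat_adjoint] arg_cong[OF B, of mat_adjoint] by (simp add: adj_simps mat_ring mat_ac Zs(1))
  also have "\<dots> = Zs * (X\<^sup>\<dagger> * M + Yt\<^sup>\<dagger> * B)" unfolding z by (simp add: mat_ring)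
  also have "X\<^sup>\<dagger> * M + Yt\<^sup>\<dagger> * B = S * Zs"
    unfolding M B S_def arg_cong[OF L, of mat_adjoint] by (simp add: adj_simps mat_ring mat_ac)
  also have "Zs * (S * Zs) = 1\<^sub>m p"
  proof (rule mat_mult_left_right_inverse[of _ p])
    show "S * Zs * Zs = 1\<^sub>m p" using Zs(2) unfolding S_def[symmetric] by (simp add: mat_assoc)
  qed (auto intro: carrier_matI)
  finally have 1: "M\<^sup>\<dagger> * M + B\<^sup>\<dagger> * B = 1\<^sub>m p" .
  show "(four_block_mat M (Ut * Rk) B (Wt * Rk))\<^sup>\<dagger> * four_block_mat M (Ut * Rk) B (Wt * Rk) = 1\<^sub>m (p + d)"
  proof (rule four_block_unitaryI)
    have "(Ut * Rk)\<^sup>\<dagger> * M + (Wt * Rk)\<^sup>\<dagger> * B = Rk * (Ut\<^sup>\<dagger> * M + Wt\<^sup>\<dagger> * B)" by (simp add: adj_mult Rk mat_ring)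
    then show "(Ut * Rk)\<^sup>\<dagger> * M + (Wt * Rk)\<^sup>\<dagger> * B = 0\<^sub>m d p" unfolding z by (simp add: mat_ring)
    have "(Ut * Rk)\<^sup>\<dagger> * (Ut * Rk) + (Wt * Rk)\<^sup>\<dagger> * (Wt * Rk) = Rk * (K * Rk)" unfolding K by (simp add: adj_mult Rk mat_ring)
    then show "(Ut * Rk)\<^sup>\<dagger> * (Ut * Rk) + (Wt * Rk)\<^sup>\<dagger> * (Wt * Rk) = 1\<^sub>m d" unfolding Rk(2) .
  qed (auto intro: carrier_matI 1)
qed

lemma halmos_unitary:
  assumes V: "V \<in> carrier_mat p d" and Rp: "Rp = minv (msqrt (1\<^sub>m p + V * V\<^sup>\<dagger>))" and Rd: "Rd = minv (msqrt (1\<^sub>m d + V\<^sup>\<dagger> * V))"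
  shows "(four_block_mat Rp (V * Rd) (- (V\<^sup>\<dagger> * Rp)) Rd)\<^sup>\<dagger> * four_block_mat Rp (V * Rd) (- (V\<^sup>\<dagger> * Rp)) Rd = 1\<^sub>m (p + d)"
proof -
  note [simp] = carrier_matD[OF V]
  have "pos_def (1\<^sub>m p + V * V\<^sup>\<dagger>)" using pos_def_one_plus_gram[OF adj_carrier[OF V]] by simp
  note a = pos_def_inverse_sqrt[OF this _ Rp, of p]
  note b = pos_def_inverse_sqrt[OF pos_def_one_plus_gram[OF V] _ Rd, of d]
  have c: "1\<^sub>m p + V * V\<^sup>\<dagger> \<in> carrier_mat p p" "1\<^sub>m d + V\<^sup>\<dagger> * V \<in> carrier_mat d d" by (auto intro: carrier_matI)
  note a = a[OF c(1)] and b = b[OF c(2)]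
  note [simp] = carrier_matD[OF a(1)] carrier_matD[OF b(1)]
  show ?thesis
  proof (rule four_block_unitaryI)
    have "Rp\<^sup>\<dagger> * Rp + (- (V\<^sup>\<dagger> * Rp))\<^sup>\<dagger> * (- (V\<^sup>\<dagger> * Rp)) = Rp * ((1\<^sub>m p + V * V\<^sup>\<dagger>) * Rp)"
      by (simp add: adj_simps a(2) mat_ring)
    then show "Rp\<^sup>\<dagger> * Rp + (- (V\<^sup>\<dagger> * Rp))\<^sup>\<dagger> * (- (V\<^sup>\<dagger> * Rp)) = 1\<^sub>m p" unfolding a(5) .
    have "(V * Rd)\<^sup>\<dagger> * (V * Rd) + Rd\<^sup>\<dagger> * Rd = Rd * ((1\<^sub>m d + V\<^sup>\<dagger> * V) * Rd)"
      by (simp add: adj_simps b(2) mat_ring mat_ac)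
    then show "(V * Rd)\<^sup>\<dagger> * (V * Rd) + Rd\<^sup>\<dagger> * Rd = 1\<^sub>m d" unfolding b(5) .
    show "(V * Rd)\<^sup>\<dagger> * Rp + Rd\<^sup>\<dagger> * (- (V\<^sup>\<dagger> * Rp)) = 0\<^sub>m d p" by (simp add: adj_simps b(2) mat_ring)
  qed (auto intro: carrier_matI)
qed

text \<open>Everything about \<^const>\<open>tau\<close> that the realization argument needs.  Here \<open>T\<close> is the square root of the
  Stein solution, \<open>Sq\<close> that of \<open>1 + (V Ti)\<^sup>\<dagger> (V Ti)\<close>, and \<open>Ti\<close>, \<open>Rd\<close> are their inverses.  The last two
  equations say that the block columns of \<open>\<U>\<close>, respectively \<open>\<V>\<close>, are orthogonal to each other.\<close>

lemma tau_structure: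
  assumes adm: "admissible p d W U V"
    and iso: "U\<^sup>\<dagger> * U + W\<^sup>\<dagger> * W = 1\<^sub>m d"
    and tau: "(\<U>, \<V>) = tau W U V"
  obtains P T Ti Sq Rd Mu bu Mv bv where
   "stein_sol W U V = P" "P \<in> carrier_mat d d" "P - W\<^sup>\<dagger> * P * W = U\<^sup>\<dagger> * U - V\<^sup>\<dagger> * V" "P = T * T"
   "T \<in> carrier_mat d d" "Ti \<in> carrier_mat d d" "T * Ti = 1\<^sub>m d" "Ti * T = 1\<^sub>m d"
   "Sq \<in> carrier_mat d d" "Rd \<in> carrier_mat d d" "Rd * Sq = 1\<^sub>m d" "Sq * Rd = 1\<^sub>m d"
   "Mu \<in> carrier_mat p p" "Mv \<in> carrier_mat p p" "bu \<in> carrier_mat d p" "bv \<in> carrier_mat d p"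
   "\<U> = four_block_mat Mu (U * Ti * Rd) bu (T * W * Ti * Rd)"
   "\<V> = four_block_mat Mv (V * Ti * Rd) bv Rd"
   "\<U>\<^sup>\<dagger> * \<U> = 1\<^sub>m (p + d)" "\<V>\<^sup>\<dagger> * \<V> = 1\<^sub>m (p + d)"
   "U\<^sup>\<dagger> * Mu = - (W\<^sup>\<dagger> * (T * bu))" "V\<^sup>\<dagger> * Mv = - (T * bv)"
proof -
  have W: "W \<in> carrier_mat d d" and U: "U \<in> carrier_mat p d" and V: "V \<in> carrier_mat p d" and st: "stable W"
    and pd: "pos_def (stein_sol W U V)" using adm by (auto simp: admissible_def)
  note [simp] = carrier_matD[OF W] carrier_matD[OF U] carrier_matD[OF V]
  define P where "P = stein_sol W U V"
  note P = stein_sol_solves[OF W st U V, folded P_def] pd[folded P_def]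
  define T where "T = msqrt P"
  define Ti where "Ti = minv T"
  note T = msqrt_pos_def[OF P(3,1), folded T_def]
  note Ti = pos_def_inverse_sqrt[OF P(3,1) Ti_def[unfolded T_def], folded T_def]
  note [simp] = carrier_matD[OF P(1)] carrier_matD[OF T(3)] carrier_matD[OF Ti(1)]
  have PTi: "minv P = Ti * Ti"
  proof (rule minv_unique[OF P(1)])
    show "Ti * Ti * P = 1\<^sub>m d" unfolding T(2)[symmetric] by (simp add: mat_assoc mat_inv_cancel[OF Ti(3)] Ti(3))
  qed (auto intro: carrier_matI)
  define Ut where "Ut = U * Ti"
  define Wt where "Wt = T * W * Ti"
  define Vt where "Vt = V * Ti"
  have Vt: "Vt \<in> carrier_mat p d" unfolding Vt_def by (auto intro: carrier_matI)
  have [simp]: "dim_row Ut = p" "dim_col Ut = d" "dim_row Wt = d" "dim_col Wt = d" "dim_row Vt = p" "dim_col Vt = d"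
    by (simp_all add: Ut_def Wt_def Vt_def)
  have dW: "det (1\<^sub>m d - W) \<noteq> 0" by (rule stable_one_minus_det[OF W st])
  have IW: "1\<^sub>m d - W \<in> carrier_mat d d" by (simp add: carrier_matI)
  note N0 = minv_inverse[OF IW dW]
  note [simp] = carrier_matD[OF N0(1)]
  define N where "N = minv (1\<^sub>m d - W\<^sup>\<dagger>)"
  have Nadj: "N = (minv (1\<^sub>m d - W))\<^sup>\<dagger>"
    using minv_adj[OF IW dW] by (simp add: N_def adj_diff adj_one)
  have [simp]: "dim_row N = d" "dim_col N = d" by (simp_all add: Nadj)
  have N1: "N * (1\<^sub>m d - W\<^sup>\<dagger>) = 1\<^sub>m d"
  proof -
    have "N * (1\<^sub>m d - W\<^sup>\<dagger>) = ((1\<^sub>m d - W) * minv (1\<^sub>m d - W))\<^sup>\<dagger>" unfolding Nadj by (simp add: adj_mult adj_diff adj_one)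
    then show ?thesis unfolding N0(2) by (simp add: adj_one)
  qed
  have N2: "(1\<^sub>m d - W\<^sup>\<dagger>) * N = 1\<^sub>m d"
  proof -
    have "(1\<^sub>m d - W\<^sup>\<dagger>) * N = (minv (1\<^sub>m d - W) * (1\<^sub>m d - W))\<^sup>\<dagger>" unfolding Nadj by (simp add: adj_mult adj_diff adj_one)
    then show ?thesis unfolding N0(3) by (simp add: adj_one)
  qed
  have Nc: "N \<in> carrier_mat d d" by (simp add: carrier_matI)
  define X where "X = 1\<^sub>m p - U * N * U\<^sup>\<dagger>"
  define Y where "Y = (1\<^sub>m d - W) * N * U\<^sup>\<dagger>"
  have XY: "X \<in> carrier_mat p p" "Y \<in> carrier_mat d p" by (auto simp: X_def Y_def intro: carrier_matI)
  note [simp] = carrier_matD[OF XY(1)] carrier_matD[OF XY(2)]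
  note comp = isometry_completion[OF W U Nc iso N1 N2 X_def Y_def]
  have Om: "(four_block_mat X U Y W)\<^sup>\<dagger> * four_block_mat X U Y W = 1\<^sub>m (p + d)"
    by (rule four_block_unitaryI[OF XY(1) U XY(2) W comp(2,1) iso])
  \<comment> \<open>The Stein equation, conjugated with \<open>T\<^sup>-\<^sup>1\<close>, identifies the matrix \<open>K\<close> of \<open>\<U>\<close> with the one of \<open>\<V>\<close>.\<close>
  define K where "K = Ut\<^sup>\<dagger> * Ut + Wt\<^sup>\<dagger> * Wt"
  have K1: "K = 1\<^sub>m d + Vt\<^sup>\<dagger> * Vt"
  proof -
    have "P - W\<^sup>\<dagger> * P * W = U\<^sup>\<dagger> * U - V\<^sup>\<dagger> * V" by (rule P(2))
    from mat_eq_of_diff[OF this] have "U\<^sup>\<dagger> * U + W\<^sup>\<dagger> * P * W = P + V\<^sup>\<dagger> * V" by simp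
    then have "Ti * ((U\<^sup>\<dagger> * U + W\<^sup>\<dagger> * P * W) * Ti) = Ti * ((P + V\<^sup>\<dagger> * V) * Ti)" by simp
    then show ?thesis
      unfolding K_def Ut_def Wt_def Vt_def T(2)[symmetric]
      by (simp add: adj_simps mat_ring T(4) Ti(2-4) mat_inv_cancel[OF Ti(3)] mat_inv_cancel[OF Ti(4)])
  qed
  have Kc: "K \<in> carrier_mat d d" by (auto simp: K_def intro: carrier_matI)
  note [simp] = carrier_matD[OF Kc]
  have Kp: "pos_def K" unfolding K1 by (rule pos_def_one_plus_gram[OF Vt])
  define Rd where "Rd = minv (msqrt K)"
  define Sq where "Sq = msqrt K"
  note R = pos_def_inverse_sqrt[OF Kp Kc Rd_def, folded Sq_def]
  note S = msqrt_pos_def[OF Kp Kc, folded Sq_def]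
  note [simp] = carrier_matD[OF R(1)] carrier_matD[OF S(3)]
  note Ki = minv_inverse[OF Kc pos_def_det[OF Kp Kc]]
  note [simp] = carrier_matD[OF Ki(1)]
  define L where "L = Ut\<^sup>\<dagger> * X + Wt\<^sup>\<dagger> * (T * Y)"
  define Z where "Z = X\<^sup>\<dagger> * X + Y\<^sup>\<dagger> * (Ti * Ti) * Y"
  have [simp]: "dim_row L = d" "dim_col L = p" "dim_row Z = p" "dim_col Z = p" by (simp_all add: L_def Z_def)
  have Zc: "Z \<in> carrier_mat p p" by (simp add: carrier_matI)
  \<comment> \<open>A common kernel vector of \<open>X\<close> and \<open>T\<^sup>-\<^sup>1 Y\<close> vanishes because \<open>X\<^sup>\<dagger> X + Y\<^sup>\<dagger> Y = 1\<close>.\<close>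
  have Zp: "pos_def Z"
  proof -
    have "pos_def (X\<^sup>\<dagger> * X + (Ti * Y)\<^sup>\<dagger> * (Ti * Y))"
    proof (rule pos_def_gram_sum[OF XY(1), of _ d])
      show "Ti * Y \<in> carrier_mat d p" by (simp add: carrier_matI)
      fix v :: "complex vec" assume v: "v \<in> carrier_vec p" "X *\<^sub>v v = 0\<^sub>v p" "(Ti * Y) *\<^sub>v v = 0\<^sub>v d"
      note [simp] = carrier_vecD[OF v(1)]
      have "Y *\<^sub>v v = (T * (Ti * Y)) *\<^sub>v v" by (simp add: mat_inv_cancel[OF Ti(4)])
      also have "\<dots> = T *\<^sub>v ((Ti * Y) *\<^sub>v v)" by (rule mat_vec_assoc) simp_all
      also have "\<dots> = 0\<^sub>v d" unfolding v(3) by (simp add: mat_vec_zero)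
      finally have Yv: "Y *\<^sub>v v = 0\<^sub>v d" .
      have "v = (X\<^sup>\<dagger> * X + Y\<^sup>\<dagger> * Y) *\<^sub>v v" unfolding comp(2) using v(1) by simp
      also have "\<dots> = X\<^sup>\<dagger> *\<^sub>v (X *\<^sub>v v) + Y\<^sup>\<dagger> *\<^sub>v (Y *\<^sub>v v)"
        by (subst mat_vec_add) (simp_all only: mat_vec_assoc index_mult_mat adj_dim carrier_matD[OF XY(1)] carrier_matD[OF XY(2)] carrier_vecD[OF v(1)])
      also have "\<dots> = 0\<^sub>v p" unfolding Yv v(2) by (simp add: mat_vec_zero)
      finally show "v = 0\<^sub>v p" .
    qed
    then show ?thesis unfolding Z_def by (simp add: adj_mult Ti(2) mat_assoc)
  qed
  note Zs = msqrt_pos_def[OF Zp Zc]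
  note [simp] = carrier_matD[OF Zs(3)]
  define Mu where "Mu = X * msqrt Z - Ut * (minv K * L * msqrt Z)"
  define bu where "bu = T * Y * msqrt Z - Wt * (minv K * L * msqrt Z)"
  define Mv where "Mv = minv (msqrt (1\<^sub>m p + Vt * Vt\<^sup>\<dagger>))"
  define bv where "bv = - (Vt\<^sup>\<dagger> * Mv)"
  have "1\<^sub>m p + Vt * Vt\<^sup>\<dagger> \<in> carrier_mat p p" by (simp add: carrier_matI)
  then have Mvc: "Mv \<in> carrier_mat p p"
    using pos_def_inverse_sqrt(1)[OF _ _ Mv_def] pos_def_one_plus_gram[OF adj_carrier[OF Vt]] by simp
  note [simp] = carrier_matD[OF Mvc]
  have Utc: "Ut \<in> carrier_mat p d" "T * Y \<in> carrier_mat d p" "Wt \<in> carrier_mat d d" by (simp_all add: carrier_matI)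
  have Mc: "Mu \<in> carrier_mat p p" "bu \<in> carrier_mat d p" "bv \<in> carrier_mat d p"
    by (auto simp: Mu_def bu_def bv_def intro: carrier_matI)
  have tauU: "\<U> = four_block_mat Mu (Ut * Rd) bu (Wt * Rd)"
  proof -
    have "\<U> = four_block_mat X Ut (T * Y) Wt *
        four_block_mat (msqrt Z) (0\<^sub>m p d) (- (minv K * L * msqrt Z)) Rd"
      using tau unfolding tau_def Let_def carrier_matD[OF U] carrier_matD[OF W] P_def[symmetric] T_def[symmetric] Ti_def[symmetric]
        N_def[symmetric] X_def[symmetric] Y_def[symmetric] Ut_def[symmetric] Wt_def[symmetric] Vt_def[symmetric] K_def[symmetric] PTi 
        Z_def[symmetric] Rd_def[symmetric]
      by (simp add: L_def mat_assoc)
    also have "\<dots> = four_block_mat Mu (Ut * Rd) bu (Wt * Rd)"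
      unfolding Mu_def bu_def by (subst four_block_mult) (simp_all add: mat_ring)
    finally show ?thesis .
  qed
  have tauV: "\<V> = four_block_mat Mv (Vt * Rd) bv Rd"
    using tau unfolding tau_def Let_def carrier_matD[OF U] carrier_matD[OF W] P_def[symmetric] T_def[symmetric] Ti_def[symmetric]
        Vt_def[symmetric] Mv_def[symmetric] K1[symmetric] Rd_def[symmetric] bv_def[symmetric]
    by simp
  have schur: "(X\<^sup>\<dagger> * X + (T * Y)\<^sup>\<dagger> * (T * Y) - L\<^sup>\<dagger> * (minv K * L)) * (msqrt Z * msqrt Z) = 1\<^sub>m p"
    unfolding Zs(2)
    by (rule schur_complement_inverse[OF XY(1) U XY(2) W T(3) Ti(1) Ki(1) Om Ti(4,3) T(4) Ti(2) Ut_def Wt_def K_def L_def Z_def Ki(3)])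
  note norm = schur_complement_normalization[OF XY(1) Utc Zs(3) Ki(1) R(1) K_def L_def Ki(2) R(2,5) Zs(4) schur Mu_def bu_def]
  have UU: "\<U>\<^sup>\<dagger> * \<U> = 1\<^sub>m (p + d)" unfolding tauU by (rule norm(2))
  have VV: "\<V>\<^sup>\<dagger> * \<V> = 1\<^sub>m (p + d)" unfolding tauV bv_def
    by (rule halmos_unitary[OF Vt Mv_def Rd_def[unfolded K1]])
  have oU: "U\<^sup>\<dagger> * Mu = - (W\<^sup>\<dagger> * (T * bu))"
  proof -
    note [simp] = carrier_matD[OF Mc(1)] carrier_matD[OF Mc(2)]
    have "T * (Ut\<^sup>\<dagger> * Mu + Wt\<^sup>\<dagger> * bu) = U\<^sup>\<dagger> * Mu + W\<^sup>\<dagger> * (T * bu)"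
      unfolding Ut_def Wt_def by (simp add: adj_simps mat_ring T(4) Ti(2) mat_inv_cancel[OF Ti(4)])
    then have "U\<^sup>\<dagger> * Mu + W\<^sup>\<dagger> * (T * bu) = 0\<^sub>m d p" unfolding norm(1) by (simp add: mat_zero)
    then have "U\<^sup>\<dagger> * Mu - (- (W\<^sup>\<dagger> * (T * bu))) = 0\<^sub>m d p - 0\<^sub>m d p"
      by (simp add: mat_diff mat_uminus_uminus mat_zero)
    from mat_eq_of_diff[OF this] show ?thesis by (simp add: mat_zero)
  qed
  have oV: "V\<^sup>\<dagger> * Mv = - (T * bv)"
    unfolding bv_def Vt_def by (simp add: adj_simps mat_ring Ti(2) mat_inv_cancel[OF Ti(4)])
  show ?thesis
    by (rule that[OF P_def[symmetric] P(1,2) T(2)[symmetric] T(3) Ti(1,4,3) S(3) R(1,3,4) Mc(1) Mvc Mc(2,3)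
      tauU[unfolded Ut_def Wt_def] tauV[unfolded Vt_def] UU VV oU oV])
qed


section \<open>The action of the linear fractional coefficient matrix\<close>

text \<open>The computation behind \<open>Theta_apply\<close>, over an arbitrary field and with independent symbols \<open>Wh\<close>, \<open>Uh\<close>,
  \<open>Vh\<close>, \<open>Nh\<close> for the adjoints, because the matrices will have rational functions as entries.  The Stein
  equation and the relations between \<open>mu\<close>, \<open>mv\<close> and \<open>g\<close>, \<open>b\<close> produce a factor \<open>1 - Wh\<close> that cancels \<open>Nh\<close>;
  what remains is the resolvent identity between the points \<open>1\<close> and \<open>z\<close>.\<close>

lemma state_shift_identity:
  fixes W :: "'a::field mat"
  assumes c: "W \<in> carrier_mat d d" "Wh \<in> carrier_mat d d" "T \<in> carrier_mat d d" "Ti \<in> carrier_mat d d"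
    "N \<in> carrier_mat d d" "Nh \<in> carrier_mat d d" "S \<in> carrier_mat d d"  "P \<in> carrier_mat d d" "Pv \<in> carrier_mat d d"
    "U \<in> carrier_mat p d" "V \<in> carrier_mat p d" "Uh \<in> carrier_mat d p" "Vh \<in> carrier_mat d p"
    "mu \<in> carrier_mat p p" "mv \<in> carrier_mat p p" "g \<in> carrier_mat d p" "b \<in> carrier_mat d p"
   and st: "P - Wh * P * W = Uh * U - Vh * V"
   and Tt: "P = T * T" "T * Ti = 1\<^sub>m d" "Ti * T = 1\<^sub>m d"
   and Pv: "Pv * P = 1\<^sub>m d"
   and N: "(1\<^sub>m d - W) * N = 1\<^sub>m d" and Nh: "Nh * (1\<^sub>m d - Wh) = 1\<^sub>m d"
   and S: "(z \<cdot>\<^sub>m 1\<^sub>m d - W) * S = 1\<^sub>m d" "S * (z \<cdot>\<^sub>m 1\<^sub>m d - W) = 1\<^sub>m d"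
   and o: "Uh * mu = - (Wh * (T * g))" "Vh * mv = - (T * b)"
   and q: "q = N * (Ti * (g - b))"
  shows "q - (z - 1) \<cdot>\<^sub>m (S * (Pv * (Nh * (Uh * (mu + U * q) - Vh * (mv + V * q))))) = S * (Ti * (g - z \<cdot>\<^sub>m b))"
proof -
  note [simp] = c[THEN carrier_matD(1)] c[THEN carrier_matD(2)]
  have [simp]: "dim_row q = d" "dim_col q = p" by (simp_all add: q)
  have q1: "q - W * q = Ti * (g - b)"
  proof -
    have "q - W * q = (1\<^sub>m d - W) * q" by (simp add: mat_ring)
    also have "\<dots> = Ti * (g - b)" unfolding q by (rule mat_inv_cancel[OF N]) simp_all
    finally show ?thesis .
  qed
  have PTi: "P * (Ti * X) = T * X" if "dim_row X = d" for X
    using that unfolding Tt(1) by (simp add: mat_assoc mat_inv_cancel[OF Tt(2)])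
  have TTi: "T * (Ti * X) = X" if "dim_row X = d" for X
    using that by (simp add: mat_inv_cancel[OF Tt(2)])
  have "T * g - T * b = T * (g - b)" by (simp add: mat_ring)
  also have "\<dots> = P * (q - W * q)" unfolding q1 by (simp add: PTi)
  also have "\<dots> = P * q - P * (W * q)" by (simp add: mat_ring)
  finally have "T * g - T * b = P * q - P * (W * q)" .
  from mat_eq_of_diff[OF this] have tb: "T * g + P * (W * q) = P * q + T * b" by simp
  have "Uh * (mu + U * q) - Vh * (mv + V * q) = - (Wh * (T * g)) + T * b + (Uh * U - Vh * V) * q"
    by (simp add: mat_ring o mat_ac)
  also have "\<dots> = - (Wh * (T * g)) + T * b + (P - Wh * P * W) * q" unfolding st ..
  also have "\<dots> = (P * q + T * b) - (Wh * (T * g) + Wh * (P * (W * q)))"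
    by (simp add: mat_ring mat_ac)
  also have "\<dots> = (1\<^sub>m d - Wh) * (T * g + P * (W * q))"
    unfolding tb[symmetric] by (simp add: mat_ring mat_ac)
  finally have "Pv * (Nh * (Uh * (mu + U * q) - Vh * (mv + V * q))) = Pv * (T * g + P * (W * q))"
    by (simp add: mat_inv_cancel[OF Nh])
  also have "\<dots> = Pv * (P * (Ti * g + W * q))" by (simp add: mat_mult_add PTi)
  also have "\<dots> = Ti * g + W * q" by (rule mat_inv_cancel[OF Pv]) simp_all
  finally have w: "Pv * (Nh * (Uh * (mu + U * q) - Vh * (mv + V * q))) = Ti * g + W * q" .
  \<comment> \<open>It suffices to compare both sides after multiplication by \<open>z - W\<close>.\<close>
  let ?E = "q - (z - 1) \<cdot>\<^sub>m (S * (Ti * g + W * q))"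
  have tib: "Ti * g + W * q = q + Ti * b"
  proof -
    have "q - W * q = Ti * g - Ti * b" unfolding q1 by (simp add: mat_ring)
    from mat_eq_of_diff[OF this] have "q + Ti * b = Ti * g + W * q" by simp
    then show ?thesis by simp
  qed
  have "(z \<cdot>\<^sub>m 1\<^sub>m d - W) * ?E = (z \<cdot>\<^sub>m 1\<^sub>m d - W) * q - (z - 1) \<cdot>\<^sub>m ((z \<cdot>\<^sub>m 1\<^sub>m d - W) * (S * (Ti * g + W * q)))"
    by (simp add: mat_ring mat_ac)
  also have "(z \<cdot>\<^sub>m 1\<^sub>m d - W) * (S * (Ti * g + W * q)) = Ti * g + W * q"
    by (rule mat_inv_cancel[OF S(1)]) simp_all
  also have "(z \<cdot>\<^sub>m 1\<^sub>m d - W) * q - (z - 1) \<cdot>\<^sub>m (Ti * g + W * q) = z \<cdot>\<^sub>m q + (Ti * g) - z \<cdot>\<^sub>m (Ti * g + W * q)"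
    by (simp add: mat_ring mat_ac mat_cancel_over)
  also have "\<dots> = Ti * (g - z \<cdot>\<^sub>m b)"
    unfolding tib by (simp add: mat_ring mat_ac)
  finally have "(z \<cdot>\<^sub>m 1\<^sub>m d - W) * ?E = Ti * (g - z \<cdot>\<^sub>m b)" .
  then have "S * (Ti * (g - z \<cdot>\<^sub>m b)) = S * ((z \<cdot>\<^sub>m 1\<^sub>m d - W) * ?E)" by simp
  also have "\<dots> = ?E" by (rule mat_inv_cancel[OF S(2)]) simp_all
  finally show ?thesis unfolding w by simp
qed

lemma signature_dim[simp]: "dim_row (signature_mat p) = p + p" "dim_col (signature_mat p) = p + p"
  by (simp_all add: signature_mat_def)

lemma rat_signature_mult:
  assumes "h1 \<in> carrier_mat p m" "h2 \<in> carrier_mat p m"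
  shows "rat_const (signature_mat p) * (h1 @\<^sub>r h2) = h1 @\<^sub>r (- h2)"
  using assms by (simp add: signature_mat_def rat_const_simps four_block_mult_append_rows mat_ring)

text \<open>Multiplication by \<^const>\<open>Theta\<close> replaces the internal state \<open>q\<close>, formed at the point \<open>1\<close>, by the state
  \<open>r\<close>, formed at the variable \<open>z\<close>.\<close>

lemma Theta_apply:
  assumes c: "W \<in> carrier_mat d d" "U \<in> carrier_mat p d" "V \<in> carrier_mat p d" "P \<in> carrier_mat d d"
    "T \<in> carrier_mat d d" "Ti \<in> carrier_mat d d"
  and r: "mu \<in> carrier_mat p p" "mv \<in> carrier_mat p p" "g \<in> carrier_mat d p" "b \<in> carrier_mat d p"
  and P: "stein_sol W U V = P" "P - W\<^sup>\<dagger> * P * W = U\<^sup>\<dagger> * U - V\<^sup>\<dagger> * V" "P = T * T" 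
  and Ti: "T * Ti = 1\<^sub>m d" "Ti * T = 1\<^sub>m d"
  and det1: "det (1\<^sub>m d - W) \<noteq> 0"
  and o: "rat_const (U\<^sup>\<dagger>) * mu = - (rat_const (W\<^sup>\<dagger>) * (rat_const T * g))" "rat_const (V\<^sup>\<dagger>) * mv = - (rat_const T * b)"
  and q: "q = rat_const (minv (1\<^sub>m d - W)) * (rat_const Ti * (g - b))"
  and rr: "r = resolvent W * (rat_const Ti * (g - rat_var \<cdot>\<^sub>m b))"
  shows "Theta W U V * ((mu + rat_const U * q) @\<^sub>r (mv + rat_const V * q))
    = (mu + rat_const U * r) @\<^sub>r (mv + rat_const V * r)"
proof -
  let ?N = "minv (1\<^sub>m d - W)"
  note [simp] = c[THEN carrier_matD(1)] c[THEN carrier_matD(2)] r[THEN carrier_matD(1)] r[THEN carrier_matD(2)]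
  have IW: "1\<^sub>m d - W \<in> carrier_mat d d" by (simp add: carrier_matI)
  note N = minv_inverse[OF IW det1]
  note [simp] = carrier_matD[OF N(1)]
  have detP: "det P \<noteq> 0"
  proof (rule det_nonzero_of_left_inverse[of _ d "Ti * Ti"])
    show "Ti * Ti * P = 1\<^sub>m d" unfolding P(3) by (simp add: mat_assoc mat_inv_cancel[OF Ti(2)] Ti(2))
  qed (auto intro: carrier_matI)
  note Pv = minv_inverse[OF c(4) detP]
  note [simp] = carrier_matD[OF Pv(1)] resolvent_dim[OF c(1)]
  have [simp]: "dim_row q = d" "dim_col q = p" "dim_row r = d" "dim_col r = p" by (simp_all add: q rr)
  note S = resolvent_inverse[OF c(1)]
  have NW: "rat_const (?N\<^sup>\<dagger>) * (1\<^sub>m d - rat_const (W\<^sup>\<dagger>)) = 1\<^sub>m d"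
  proof -
    have "?N\<^sup>\<dagger> * (1\<^sub>m d - W\<^sup>\<dagger>) = ((1\<^sub>m d - W) * ?N)\<^sup>\<dagger>" by (simp add: adj_simps)
    also have "\<dots> = 1\<^sub>m d" unfolding N(2) by (simp add: adj_simps)
    finally have "rat_const (?N\<^sup>\<dagger> * (1\<^sub>m d - W\<^sup>\<dagger>)) = 1\<^sub>m d" by (simp only: rat_const_one)
    then show ?thesis by (simp add: rat_const_simps)
  qed
  let ?h1 = "mu + rat_const U * q" let ?h2 = "mv + rat_const V * q"
  let ?w = "rat_const (minv P) * (rat_const (?N\<^sup>\<dagger>) * (rat_const (U\<^sup>\<dagger>) * ?h1 - rat_const (V\<^sup>\<dagger>) * ?h2))"
  have core: "q - (rat_var - 1) \<cdot>\<^sub>m (resolvent W * ?w) = r"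
    unfolding rr
  proof (rule state_shift_identity[of "rat_const W" d "rat_const (W\<^sup>\<dagger>)" "rat_const T" "rat_const Ti" "rat_const ?N" "rat_const (?N\<^sup>\<dagger>)"
      "resolvent W" "rat_const P" "rat_const (minv P)" "rat_const U" p "rat_const V" "rat_const (U\<^sup>\<dagger>)" "rat_const (V\<^sup>\<dagger>)" mu mv g b])
    show "rat_const P - rat_const (W\<^sup>\<dagger>) * rat_const P * rat_const W = rat_const (U\<^sup>\<dagger>) * rat_const U - rat_const (V\<^sup>\<dagger>) * rat_const V"
      using arg_cong[OF P(2), of rat_const] by (simp add: rat_const_simps)
    show "rat_const P = rat_const T * rat_const T" unfolding P(3) by (simp add: rat_const_mult)
    show "rat_const T * rat_const Ti = 1\<^sub>m d" using arg_cong[OF Ti(1), of rat_const] by (simp add: rat_const_simps)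
    show "rat_const Ti * rat_const T = 1\<^sub>m d" using arg_cong[OF Ti(2), of rat_const] by (simp add: rat_const_simps)
    show "rat_const (minv P) * rat_const P = 1\<^sub>m d" using arg_cong[OF Pv(3), of rat_const] by (simp add: rat_const_simps)
    show "(1\<^sub>m d - rat_const W) * rat_const ?N = 1\<^sub>m d" using arg_cong[OF N(2), of rat_const] by (simp add: rat_const_simps)
  qed (use c r N Pv S NW o q in \<open>simp_all add: carrier_matI\<close>)
  have TT: "Theta W U V = 1\<^sub>m (p + p) - (rat_var - 1) \<cdot>\<^sub>m ((rat_const U @\<^sub>r rat_const V) * (resolvent W * (rat_const (minv P) * (rat_const (?N\<^sup>\<dagger>) *
    ((rat_const (U\<^sup>\<dagger>) @\<^sub>c rat_const (V\<^sup>\<dagger>)) * rat_const (signature_mat p))))))"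
    unfolding Theta_def Let_def P(1) by (simp add: adj_append_rows rat_const_simps mat_assoc mult_2)
  have "Theta W U V * (?h1 @\<^sub>r ?h2) = (?h1 @\<^sub>r ?h2) - (rat_var - 1) \<cdot>\<^sub>m ((rat_const U @\<^sub>r rat_const V) * (resolvent W * (rat_const (minv P) * (rat_const (?N\<^sup>\<dagger>) *
    ((rat_const (U\<^sup>\<dagger>) @\<^sub>c rat_const (V\<^sup>\<dagger>)) * (rat_const (signature_mat p) * (?h1 @\<^sub>r ?h2)))))))"
    unfolding TT by (simp add: mat_minus_mult mat_assoc mat_one mat_smult(1))
  also have "rat_const (signature_mat p) * (?h1 @\<^sub>r ?h2) = ?h1 @\<^sub>r (- ?h2)" by (rule rat_signature_mult[where m = p]) (simp_all add: carrier_matI)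
  also have "(rat_const (U\<^sup>\<dagger>) @\<^sub>c rat_const (V\<^sup>\<dagger>)) * (?h1 @\<^sub>r (- ?h2)) = rat_const (U\<^sup>\<dagger>) * ?h1 - rat_const (V\<^sup>\<dagger>) * ?h2"
    by (subst append_cols_mult) (simp_all add: mat_mult_uminus mat_diff)
  also have "(?h1 @\<^sub>r ?h2) - (rat_var - 1) \<cdot>\<^sub>m ((rat_const U @\<^sub>r rat_const V) * (resolvent W * ?w))
    = (mu + rat_const U * (q - (rat_var - 1) \<cdot>\<^sub>m (resolvent W * ?w))) @\<^sub>r (mv + rat_const V * (q - (rat_var - 1) \<cdot>\<^sub>m (resolvent W * ?w)))"
  proof -
    define w where "w = resolvent W * ?w"
    have [simp]: "dim_row w = d" "dim_col w = p" by (simp_all add: w_def)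
    show ?thesis unfolding w_def[symmetric]
      by (simp add: append_rows_mult append_rows_smult append_rows_uminus append_rows_add mat_diff mat_mult_add mat_mult_uminus
          mat_add_assoc mat_smult(2) del: mat_smult(5,6))
  qed
  finally show ?thesis unfolding core .
qed

text \<open>The coupling matrix \<open>H\<close> is the transfer function of the loop at \<open>z = 1\<close>: for
  \<open>E = (1 - W)\<^sup>-\<^sup>1 T\<^sup>-\<^sup>1\<close>, the state \<open>q\<close> solves the loop equation there.\<close>

lemma H_mat_apply:
  assumes c: "Mu \<in> carrier_mat p p" "au \<in> carrier_mat p d" "bu \<in> carrier_mat d p" "Ku \<in> carrier_mat d d"
    "Mv \<in> carrier_mat p p" "av \<in> carrier_mat p d" "bv \<in> carrier_mat d p" "Kv \<in> carrier_mat d d"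
   and c2: "U \<in> carrier_mat p d" "V \<in> carrier_mat p d" "E \<in> carrier_mat d d"
   and G: "G \<in> carrier_mat p p"
   and Ei: "minv (Kv - Ku) \<in> carrier_mat d d"
   and e: "au * minv (Kv - Ku) = U * E" "av * minv (Kv - Ku) = V * E"
   and q: "q = rat_const E * (rat_const bu * G - rat_const bv)"
  shows "rat_const (H_mat p (four_block_mat Mu au bu Ku) (four_block_mat Mv av bv Kv)) * (G @\<^sub>r 1\<^sub>m p) =
    (rat_const Mu * G + rat_const U * q) @\<^sub>r (rat_const Mv + rat_const V * q)"
    "H_mat p (four_block_mat Mu au bu Ku) (four_block_mat Mv av bv Kv) \<in> carrier_mat (p + p) (p + p)"
proof -
  let ?H = "H_mat p (four_block_mat Mu au bu Ku) (four_block_mat Mv av bv Kv)"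
  note [simp] = c[THEN carrier_matD(1)] c[THEN carrier_matD(2)] c2[THEN carrier_matD(1)] c2[THEN carrier_matD(2)] 
    carrier_matD[OF G] carrier_matD[OF Ei]
  have H: "?H = four_block_mat Mu (0\<^sub>m p p) (0\<^sub>m p p) Mv + (au @\<^sub>r av) * minv (Kv - Ku) * (bu @\<^sub>c bv) * signature_mat p"
    unfolding H_mat_def split_block_four_block[OF c(1-4)] split_block_four_block[OF c(5-8)] by (simp add: adj_append_rows)
  also have "(au @\<^sub>r av) * minv (Kv - Ku) = (U @\<^sub>r V) * E" by (simp add: append_rows_mult e)
  finally have H: "?H = four_block_mat Mu (0\<^sub>m p p) (0\<^sub>m p p) Mv + (U @\<^sub>r V) * E * (bu @\<^sub>c bv) * signature_mat p" .
  show "?H \<in> carrier_mat (p + p) (p + p)" unfolding H by (auto intro: carrier_matI)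
  have [simp]: "dim_row q = d" "dim_col q = p" by (simp_all add: q)
  have "rat_const ?H * (G @\<^sub>r 1\<^sub>m p) = four_block_mat (rat_const Mu) (0\<^sub>m p p) (0\<^sub>m p p) (rat_const Mv) * (G @\<^sub>r 1\<^sub>m p) +
    (rat_const U @\<^sub>r rat_const V) * (rat_const E * ((rat_const bu @\<^sub>c rat_const bv) * (rat_const (signature_mat p) * (G @\<^sub>r 1\<^sub>m p))))"
    unfolding H by (simp add: rat_const_simps mat_add_mult mat_assoc)
  also have "rat_const (signature_mat p) * (G @\<^sub>r 1\<^sub>m p) = G @\<^sub>r (- 1\<^sub>m p)" by (rule rat_signature_mult[where m = p]) (auto intro: carrier_matI)
  also have "(rat_const bu @\<^sub>c rat_const bv) * (G @\<^sub>r (- 1\<^sub>m p)) = rat_const bu * G - rat_const bv"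
    by (subst append_cols_mult) (simp_all add: mat_mult_uminus mat_diff mat_one)
  also have "rat_const E * (rat_const bu * G - rat_const bv) = q" unfolding q ..
  finally show "rat_const ?H * (G @\<^sub>r 1\<^sub>m p) = (rat_const Mu * G + rat_const U * q) @\<^sub>r (rat_const Mv + rat_const V * q)"
    by (simp add: four_block_mult_append_rows append_rows_mult append_rows_add mat_zero mat_one)
qed

text \<open>A linear fractional transformation is the quotient of the two blocks of \<open>\<Theta> (G, 1)\<close>.\<close>

lemma lft_of_columns:
  assumes T: "\<Theta> \<in> carrier_mat (p + p) (p + p)" and G: "G \<in> carrier_mat p p"
    and e: "\<Theta> * (G @\<^sub>r 1\<^sub>m p) = y @\<^sub>r u" and y: "y \<in> carrier_mat p p" and u: "u \<in> carrier_mat p p"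
  shows "lft p \<Theta> G = y * minv u" "det u \<noteq> 0 \<Longrightarrow> lft_defined p \<Theta> G"
proof -
  obtain A B C D where t: "\<Theta> = four_block_mat A B C D"
    and c: "A \<in> carrier_mat p p" "B \<in> carrier_mat p p" "C \<in> carrier_mat p p" "D \<in> carrier_mat p p"
    using four_block_decomp[OF T] by blast
  note [simp] = c[THEN carrier_matD(1)] c[THEN carrier_matD(2)] carrier_matD[OF G]
  have "y @\<^sub>r u = (A * G + B) @\<^sub>r (C * G + D)"
    unfolding e[symmetric] t by (simp add: four_block_mult_append_rows mat_one)
  from append_rows_inject[OF this] have "y = A * G + B" "u = C * G + D" using y u by simp_all
  moreover have "split_block \<Theta> p p = (A,B,C,D)" unfolding t by (rule split_block_four_block[OF c])
  ultimately show "lft p \<Theta> G = y * minv u" "det u \<noteq> 0 \<Longrightarrow> lft_defined p \<Theta> G"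
    using invertible_mat_det[OF u] by (auto simp: lft_def lft_defined_def)
qed


section \<open>The closed loop\<close>

text \<open>\<open>f\<close> is the signal that bypasses the given realization, \<open>\<xi>\<close> the state of that realization, and \<open>s\<close>
  the new state.  The assumption on \<open>f\<close> is the loop equation: the second block of \<open>\<U> (G, f)\<close>
  is \<open>z s\<close>.  Then \<open>w = (s, \<xi>)\<close> is the state of \<open>R'\<close> driven by \<open>u\<close>, and \<open>y\<close> is its output.\<close>

lemma closed_loop_realization:
  assumes c: "Mu \<in> carrier_mat p p" "au \<in> carrier_mat p d" "bu \<in> carrier_mat d p" "Ku \<in> carrier_mat d d"
    "Mv \<in> carrier_mat p p" "av \<in> carrier_mat p d" "bv \<in> carrier_mat d p" "Kv \<in> carrier_mat d d"
    "D \<in> carrier_mat p p" "C \<in> carrier_mat p k" "B \<in> carrier_mat k p" "A \<in> carrier_mat k k"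
   and uv: "(four_block_mat Mv av bv Kv)\<^sup>\<dagger> * four_block_mat Mv av bv Kv = 1\<^sub>m (p + d)"
   and G: "G = rat_const D + rat_const C * resolvent A * rat_const B"
   and R': "R' =
      four_block_mat (four_block_mat Mu au bu Ku) (0\<^sub>m (p + d) k) (0\<^sub>m k (p + d)) (1\<^sub>m k) *
      four_block_mat
        (four_block_mat D (0\<^sub>m p d) (0\<^sub>m d p) (1\<^sub>m d)) (C @\<^sub>r 0\<^sub>m d k)
        (B @\<^sub>c 0\<^sub>m k d) A *
      four_block_mat ((four_block_mat Mv av bv Kv)\<^sup>\<dagger>) (0\<^sub>m (p + d) k) (0\<^sub>m k (p + d)) (1\<^sub>m k)"
   and f: "f \<in> carrier_mat d p"
   and st: "rat_var \<cdot>\<^sub>m (rat_const bv + rat_const Kv * f) = rat_const bu * G + rat_const Ku * f"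
   and u: "u = rat_const Mv + rat_const av * f"
   and y: "y = rat_const Mu * G + rat_const au * f"
  shows "det u \<noteq> 0" "realization_mat p (d + k) R' (y * minv u)"
proof -
  note [simp] = c[THEN carrier_matD(1)] c[THEN carrier_matD(2)] carrier_matD[OF f] resolvent_dim[OF c(12)]
  let ?V = "four_block_mat Mv av bv Kv"
  define s where "s = rat_const bv + rat_const Kv * f"
  define \<xi> where "\<xi> = resolvent A * rat_const B"
  have [simp]: "dim_row s = d" "dim_col s = p" "dim_row \<xi> = k" "dim_col \<xi> = p" "dim_row u = p" "dim_col u = p"
    "dim_row y = p" "dim_col y = p" "dim_row G = p" "dim_col G = p"
    by (simp_all add: s_def \<xi>_def u y G)
  have G': "G = rat_const D + rat_const C * \<xi>" unfolding G \<xi>_def by (simp add: mat_assoc)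
  have x: "rat_const B + rat_const A * \<xi> = rat_var \<cdot>\<^sub>m \<xi>"
  proof -
    have "(rat_var \<cdot>\<^sub>m 1\<^sub>m k - rat_const A) * \<xi> = rat_const B"
      unfolding \<xi>_def by (rule mat_inv_cancel[OF resolvent_inverse(2)[OF c(12)]]) simp_all
    then have "rat_var \<cdot>\<^sub>m \<xi> - rat_const A * \<xi> = rat_const B - 0\<^sub>m k p" by (simp add: mat_ring)
    from mat_eq_of_diff[OF this] show ?thesis by (simp add: mat_zero)
  qed
  have us: "u @\<^sub>r s = rat_const ?V * (1\<^sub>m p @\<^sub>r f)"
    by (simp add: rat_const_simps four_block_mult_append_rows u s_def mat_one)
  have "rat_const (?V\<^sup>\<dagger>) * (rat_const ?V * (1\<^sub>m p @\<^sub>r f)) = 1\<^sub>m p @\<^sub>r f"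
  proof (rule mat_inv_cancel)
    show "rat_const (?V\<^sup>\<dagger>) * rat_const ?V = 1\<^sub>m (p + d)"
      using arg_cong[OF uv, of rat_const] by (simp add: rat_const_mult rat_const_one)
  qed simp_all
  then have Vus: "rat_const (?V\<^sup>\<dagger>) * (u @\<^sub>r s) = 1\<^sub>m p @\<^sub>r f" unfolding us .
  let ?P3 = "four_block_mat (rat_const (?V\<^sup>\<dagger>)) (0\<^sub>m (p + d) k) (0\<^sub>m k (p + d)) (1\<^sub>m k)"
  let ?P2 = "four_block_mat (four_block_mat (rat_const D) (0\<^sub>m p d) (0\<^sub>m d p) (1\<^sub>m d)) (rat_const C @\<^sub>r 0\<^sub>m d k)
        (rat_const B @\<^sub>c 0\<^sub>m k d) (rat_const A)"
  let ?P1 = "four_block_mat (four_block_mat (rat_const Mu) (rat_const au) (rat_const bu) (rat_const Ku)) (0\<^sub>m (p + d) k) (0\<^sub>m k (p + d)) (1\<^sub>m k)"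
  have R: "rat_const R' = ?P1 * (?P2 * ?P3)"
    unfolding R' by (simp add: rat_const_simps mat_assoc)
  define w where "w = s @\<^sub>r \<xi>"
  have [simp]: "dim_row w = d + k" "dim_col w = p" by (simp_all add: w_def)
  have P3: "?P3 * ((u @\<^sub>r s) @\<^sub>r \<xi>) = (1\<^sub>m p @\<^sub>r f) @\<^sub>r \<xi>"
    by (simp add: four_block_mult_append_rows Vus mat_zero mat_one)
  have P2: "?P2 * ((1\<^sub>m p @\<^sub>r f) @\<^sub>r \<xi>) = (G @\<^sub>r f) @\<^sub>r (rat_var \<cdot>\<^sub>m \<xi>)"
    by (simp add: four_block_mult_append_rows append_cols_mult append_rows_mult append_rows_add mat_zero mat_one x G')
  have P1: "?P1 * ((G @\<^sub>r f) @\<^sub>r (rat_var \<cdot>\<^sub>m \<xi>)) = (y @\<^sub>r (rat_var \<cdot>\<^sub>m s)) @\<^sub>r (rat_var \<cdot>\<^sub>m \<xi>)"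
    by (simp add: four_block_mult_append_rows mat_zero mat_one y s_def st)
  have "rat_const R' * (u @\<^sub>r w) = rat_const R' * ((u @\<^sub>r s) @\<^sub>r \<xi>)" unfolding w_def by (simp add: append_rows_assoc)
  also have "\<dots> = ?P1 * (?P2 * (?P3 * ((u @\<^sub>r s) @\<^sub>r \<xi>)))" unfolding R by (simp add: mat_assoc)
  also have "\<dots> = y @\<^sub>r (rat_var \<cdot>\<^sub>m w)" unfolding P3 P2 P1 w_def by (simp add: append_rows_assoc append_rows_smult)
  finally have act: "rat_const R' * (u @\<^sub>r w) = y @\<^sub>r (rat_var \<cdot>\<^sub>m w)" .
  have Rc: "R' \<in> carrier_mat (p + (d + k)) (p + (d + k))" unfolding R' by (auto intro: carrier_matI)
  obtain D1 C1 B1 A1 where R1: "R' = four_block_mat D1 C1 B1 A1"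
    and c1: "D1 \<in> carrier_mat p p" "C1 \<in> carrier_mat p (d + k)" "B1 \<in> carrier_mat (d + k) p" "A1 \<in> carrier_mat (d + k) (d + k)"
    using four_block_decomp[OF Rc] by blast
  note [simp] = c1[THEN carrier_matD(1)] c1[THEN carrier_matD(2)] resolvent_dim[OF c1(4)]
  have "(rat_const D1 * u + rat_const C1 * w) @\<^sub>r (rat_const B1 * u + rat_const A1 * w) = y @\<^sub>r (rat_var \<cdot>\<^sub>m w)"
    using act unfolding R1 by (simp add: rat_const_simps four_block_mult_append_rows)
  from append_rows_inject[OF this]
  have o: "rat_const D1 * u + rat_const C1 * w = y" and i: "rat_const B1 * u + rat_const A1 * w = rat_var \<cdot>\<^sub>m w" by simp_all
  define X where "X = resolvent A1 * rat_const B1"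
  have [simp]: "dim_row X = d + k" "dim_col X = p" by (simp_all add: X_def)
  have wX: "w = X * u"
  proof -
    have "(rat_var \<cdot>\<^sub>m 1\<^sub>m (d + k) - rat_const A1) * w = rat_var \<cdot>\<^sub>m w - rat_const A1 * w" by (simp add: mat_ring)
    also have "\<dots> = rat_const B1 * u" unfolding i[symmetric] by (simp add: mat_ring)
    finally have "resolvent A1 * ((rat_var \<cdot>\<^sub>m 1\<^sub>m (d + k) - rat_const A1) * w) = X * u" unfolding X_def by (simp add: mat_assoc)
    also have "resolvent A1 * ((rat_var \<cdot>\<^sub>m 1\<^sub>m (d + k) - rat_const A1) * w) = w"
      by (rule mat_inv_cancel[OF resolvent_inverse(3)[OF c1(4)]]) simp_all
    finally show ?thesis .
  qed
  \<comment> \<open>\<open>s\<close> is a matrix times \<open>u\<close>, and \<open>1\<close> is recovered from \<open>u\<close> and \<open>s\<close> by \<open>\<V>\<^sup>\<dagger>\<close>; so \<open>u\<close> has a left inverse.\<close>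
  obtain X1 X2 where X12: "X = X1 @\<^sub>r X2" "X1 \<in> carrier_mat d p" "X2 \<in> carrier_mat k p"
    using append_rows_split[OF carrier_matI[of X "d + k" p]] \<open>dim_row X = d + k\<close> \<open>dim_col X = p\<close> by blast
  note [simp] = carrier_matD[OF X12(2)] carrier_matD[OF X12(3)]
  have "s @\<^sub>r \<xi> = (X1 * u) @\<^sub>r (X2 * u)" using wX unfolding w_def X12(1) by (simp add: append_rows_mult)
  from append_rows_inject(1)[OF this] have sX: "s = X1 * u" by simp
  have "(rat_const (Mv\<^sup>\<dagger>) * u + rat_const (bv\<^sup>\<dagger>) * s) @\<^sub>r (rat_const (av\<^sup>\<dagger>) * u + rat_const (Kv\<^sup>\<dagger>) * s) = 1\<^sub>m p @\<^sub>r f"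
    using Vus by (simp add: adj_four_block rat_const_simps four_block_mult_append_rows)
  from append_rows_inject(1)[OF this] have "rat_const (Mv\<^sup>\<dagger>) * u + rat_const (bv\<^sup>\<dagger>) * s = 1\<^sub>m p" by simp
  then have inv: "(rat_const (Mv\<^sup>\<dagger>) + rat_const (bv\<^sup>\<dagger>) * X1) * u = 1\<^sub>m p" unfolding sX by (simp add: mat_ring)
  have uc: "u \<in> carrier_mat p p" by (simp add: carrier_matI)
  show du: "det u \<noteq> 0" by (rule det_nonzero_of_left_inverse[OF uc _ inv]) (simp add: carrier_matI)
  note mu = minv_inverse[OF uc du]
  note [simp] = carrier_matD[OF mu(1)]
  have "y = (rat_const D1 + rat_const C1 * X) * u" unfolding o[symmetric] wX by (simp add: mat_ring)
  then have "y * minv u = (rat_const D1 + rat_const C1 * X) * (u * minv u)" by (simp add: mat_assoc)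
  also have "\<dots> = rat_const D1 + rat_const C1 * resolvent A1 * rat_const B1" unfolding mu(2) X_def by (simp add: mat_one mat_assoc)
  finally have "y * minv u = rat_const D1 + rat_const C1 * resolvent A1 * rat_const B1" .
  then show "realization_mat p (d + k) R' (y * minv u)"
    unfolding realization_mat_def R1 split_block_four_block[OF c1] using Rc unfolding R1 by simp
qed


section \<open>The realization of the transformed function\<close>

theorem corollary1:
  fixes p \<delta> k :: nat
    and W U V \<U> \<V> R D C B A R' :: "complex mat"
    and G :: "complex poly fract mat"
  assumes "admissible p \<delta> W U V"
    and "U\<^sup>\<dagger> * U + W\<^sup>\<dagger> * W = 1\<^sub>m \<delta>"
    and "(\<U>, \<V>) = tau W U V"
    and "lossless p G"
    and "D \<in> carrier_mat p p" "C \<in> carrier_mat p k"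
        "B \<in> carrier_mat k p" "A \<in> carrier_mat k k"
    and "R = four_block_mat D C B A"
    and "unitary_mat R"
    and "realization_mat p k R G"
    and "R' =
      four_block_mat \<U> (0\<^sub>m (p + \<delta>) k) (0\<^sub>m k (p + \<delta>)) (1\<^sub>m k) *
      four_block_mat
        (four_block_mat D (0\<^sub>m p \<delta>) (0\<^sub>m \<delta> p) (1\<^sub>m \<delta>)) (C @\<^sub>r 0\<^sub>m \<delta> k)
        (B @\<^sub>c 0\<^sub>m k \<delta>) A *
      four_block_mat (\<V>\<^sup>\<dagger>) (0\<^sub>m (p + \<delta>) k) (0\<^sub>m k (p + \<delta>)) (1\<^sub>m k)"
  shows "coupling_defined p \<U> \<V> \<and>
    lft_defined p (Theta_hat W U V) G \<and>
    unitary_mat R' \<and>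
    realization_mat p (\<delta> + k) R' (lft p (Theta_hat W U V) G)"
proof -
  note dcba = assms(5-8)
  have W: "W \<in> carrier_mat \<delta> \<delta>" and U: "U \<in> carrier_mat p \<delta>" and V: "V \<in> carrier_mat p \<delta>" and st: "stable W"
    using assms(1) by (auto simp: admissible_def)
  obtain P T Ti Sq Rd Mu bu Mv bv where
   P: "stein_sol W U V = P" "P \<in> carrier_mat \<delta> \<delta>" "P - W\<^sup>\<dagger> * P * W = U\<^sup>\<dagger> * U - V\<^sup>\<dagger> * V" "P = T * T" and
   T: "T \<in> carrier_mat \<delta> \<delta>" "Ti \<in> carrier_mat \<delta> \<delta>" "T * Ti = 1\<^sub>m \<delta>" "Ti * T = 1\<^sub>m \<delta>" and
   Sq: "Sq \<in> carrier_mat \<delta> \<delta>" "Rd \<in> carrier_mat \<delta> \<delta>" "Rd * Sq = 1\<^sub>m \<delta>" "Sq * Rd = 1\<^sub>m \<delta>" and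
   M: "Mu \<in> carrier_mat p p" "Mv \<in> carrier_mat p p" "bu \<in> carrier_mat \<delta> p" "bv \<in> carrier_mat \<delta> p" and
   uv: "\<U> = four_block_mat Mu (U * Ti * Rd) bu (T * W * Ti * Rd)"
   "\<V> = four_block_mat Mv (V * Ti * Rd) bv Rd" and
   un: "\<U>\<^sup>\<dagger> * \<U> = 1\<^sub>m (p + \<delta>)" "\<V>\<^sup>\<dagger> * \<V> = 1\<^sub>m (p + \<delta>)" and
   o: "U\<^sup>\<dagger> * Mu = - (W\<^sup>\<dagger> * (T * bu))" "V\<^sup>\<dagger> * Mv = - (T * bv)"
    by (rule tau_structure[OF assms(1-3)])
  note [simp] = carrier_matD[OF W] carrier_matD[OF U] carrier_matD[OF V] carrier_matD[OF P(2)] carrier_matD[OF T(1)] carrier_matD[OF T(2)]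
    carrier_matD[OF Sq(1)] carrier_matD[OF Sq(2)] carrier_matD[OF M(1)] carrier_matD[OF M(2)] carrier_matD[OF M(3)] carrier_matD[OF M(4)]
    resolvent_dim[OF W]
  let ?au = "U * Ti * Rd" let ?av = "V * Ti * Rd" let ?Ku = "T * W * Ti * Rd"
  have c: "?au \<in> carrier_mat p \<delta>" "?av \<in> carrier_mat p \<delta>" "?Ku \<in> carrier_mat \<delta> \<delta>" by (auto intro: carrier_matI)
  have dW: "det (1\<^sub>m \<delta> - W) \<noteq> 0" by (rule stable_one_minus_det[OF W st])
  have IW: "1\<^sub>m \<delta> - W \<in> carrier_mat \<delta> \<delta>" by (simp add: carrier_matI)
  define N where "N = minv (1\<^sub>m \<delta> - W)"
  note N = minv_inverse[OF IW dW, folded N_def]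
  note [simp] = carrier_matD[OF N(1)]

  have TTi: "T * (Ti * X) = X" if "dim_row X = \<delta>" for X :: "complex mat" using that by (simp add: mat_inv_cancel[OF T(3)])
  have TiT: "Ti * (T * X) = X" if "dim_row X = \<delta>" for X :: "complex mat" using that by (simp add: mat_inv_cancel[OF T(4)])
  have RS: "Rd * (Sq * X) = X" if "dim_row X = \<delta>" for X :: "complex mat" using that by (simp add: mat_inv_cancel[OF Sq(3)])
  \<comment> \<open>\<open>K\<^sub>v - K\<^sub>u\<close> is invertible since it contains the factor \<open>1 - W\<close> and \<open>W\<close> is stable.\<close>
  have Kd: "Rd - ?Ku = T * ((1\<^sub>m \<delta> - W) * (Ti * Rd))" by (simp add: mat_ring TTi)
  have Kc: "Rd - ?Ku \<in> carrier_mat \<delta> \<delta>" by (simp add: carrier_matI)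
  have NI: "N * ((1\<^sub>m \<delta> - W) * X) = X" if "dim_row X = \<delta>" for X using that by (simp add: mat_inv_cancel[OF N(3)])
  have Kinv: "(Sq * (T * (N * Ti))) * (Rd - ?Ku) = 1\<^sub>m \<delta>"
    unfolding Kd by (simp add: mat_assoc TiT NI TTi Sq(4))
  have Ei: "minv (Rd - ?Ku) = Sq * (T * (N * Ti))" by (rule minv_unique[OF Kc _ Kinv]) (simp add: carrier_matI)
  have "det (Rd - ?Ku) \<noteq> 0" by (rule det_nonzero_of_left_inverse[OF Kc _ Kinv]) (simp add: carrier_matI)
  then have coup: "coupling_defined p \<U> \<V>"
    unfolding coupling_defined_def uv split_block_four_block[OF M(1) c(1) M(3) c(3)] split_block_four_block[OF M(2) c(2) M(4) Sq(2)]
    using invertible_mat_det[OF Kc] by simp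

  have Gr: "G = rat_const D + rat_const C * resolvent A * rat_const B"
    using assms(11) unfolding realization_mat_def assms(9) split_block_four_block[OF dcba] by simp
  have Gc: "G \<in> carrier_mat p p" using assms(4) by (simp add: lossless_def)
  note [simp] = carrier_matD[OF Gc]
  \<comment> \<open>In the coordinates of \<open>W\<close>, \<open>q\<close> and \<open>r\<close> solve the loop equation at the points \<open>1\<close> and \<open>z\<close>.\<close>
  define g where "g = rat_const bu * G"
  define b where "b = rat_const bv"
  define q where "q = rat_const (N * Ti) * (g - b)"
  define r where "r = resolvent W * (rat_const Ti * (g - rat_var \<cdot>\<^sub>m b))"
  have [simp]: "dim_row g = \<delta>" "dim_col g = p" "dim_row b = \<delta>" "dim_col b = p" "dim_row q = \<delta>" "dim_col q = p"
     "dim_row r = \<delta>" "dim_col r = p" by (simp_all add: g_def b_def q_def r_def)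
  let ?mu = "rat_const Mu * G" let ?mv = "rat_const Mv"
  have Hap: "rat_const (H_mat p \<U> \<V>) * (G @\<^sub>r 1\<^sub>m p) = (?mu + rat_const U * q) @\<^sub>r (?mv + rat_const V * q)"
    and Hc: "H_mat p \<U> \<V> \<in> carrier_mat (p + p) (p + p)"
  proof -
    have e: "?au * minv (Rd - ?Ku) = U * (N * Ti)" "?av * minv (Rd - ?Ku) = V * (N * Ti)"
      unfolding Ei by (simp_all add: mat_assoc RS TiT)
    have Eic: "minv (Rd - ?Ku) \<in> carrier_mat \<delta> \<delta>" unfolding Ei by (simp add: carrier_matI)
    have NTc: "N * Ti \<in> carrier_mat \<delta> \<delta>" by (simp add: carrier_matI)
    note H = H_mat_apply[OF M(1) c(1) M(3) c(3) M(2) c(2) M(4) Sq(2) U V NTc Gc Eic e q_def[unfolded g_def b_def]]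
    show "rat_const (H_mat p \<U> \<V>) * (G @\<^sub>r 1\<^sub>m p) = (?mu + rat_const U * q) @\<^sub>r (?mv + rat_const V * q)"
      unfolding uv by (rule H(1))
    show "H_mat p \<U> \<V> \<in> carrier_mat (p + p) (p + p)" unfolding uv by (rule H(2))
  qed
  have Tc: "Theta W U V \<in> carrier_mat (p + p) (p + p)"
    unfolding Theta_def Let_def by (rule carrier_matI) simp_all
  note [simp] = carrier_matD[OF Tc] carrier_matD[OF Hc]
  have That: "Theta_hat W U V = Theta W U V * rat_const (H_mat p \<U> \<V>)"
    unfolding Theta_hat_def assms(3)[symmetric] by simp
  have Tap: "Theta_hat W U V * (G @\<^sub>r 1\<^sub>m p) = (?mu + rat_const U * r) @\<^sub>r (?mv + rat_const V * r)"
  proof -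
    have "Theta_hat W U V * (G @\<^sub>r 1\<^sub>m p) = Theta W U V * ((?mu + rat_const U * q) @\<^sub>r (?mv + rat_const V * q))"
      unfolding That Hap[symmetric] by (simp add: mat_assoc)
    also have "\<dots> = (?mu + rat_const U * r) @\<^sub>r (?mv + rat_const V * r)"
    proof (rule Theta_apply[OF W U V P(2) T(1,2) _ _ _ _ P(1,3,4) T(3,4) dW _ _ _ r_def])
      show "q = rat_const (minv (1\<^sub>m \<delta> - W)) * (rat_const Ti * (g - b))"
        unfolding q_def N_def[symmetric] by (simp add: rat_const_mult mat_assoc)
      have "rat_const (U\<^sup>\<dagger>) * (rat_const Mu * G) = rat_const (U\<^sup>\<dagger> * Mu) * G" by (simp add: rat_const_mult mat_assoc)
      then show "rat_const (U\<^sup>\<dagger>) * (rat_const Mu * G) = - (rat_const (W\<^sup>\<dagger>) * (rat_const T * g))"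
        unfolding o g_def by (simp add: rat_const_simps mat_ring)
      have "rat_const (V\<^sup>\<dagger>) * rat_const Mv = rat_const (V\<^sup>\<dagger> * Mv)" by (simp add: rat_const_mult)
      then show "rat_const (V\<^sup>\<dagger>) * rat_const Mv = - (rat_const T * b)"
        unfolding o b_def by (simp add: rat_const_simps)
    qed (auto intro: carrier_matI)
    finally show ?thesis .
  qed
  \<comment> \<open>The bypass signal in the coordinates of \<open>\<U>\<close> and \<open>\<V>\<close>, chosen such that the upper right blocks send it to \<open>U r\<close> and \<open>V r\<close>.\<close>
  define f where "f = rat_const Sq * (rat_const T * r)"
  have fc: "f \<in> carrier_mat \<delta> p" by (simp add: f_def carrier_matI)
  have rRS: "rat_const Rd * (rat_const Sq * X) = X" if "dim_row X = \<delta>" for X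
    using that arg_cong[OF Sq(3), of rat_const] by (intro mat_inv_cancel[of _ _ \<delta>]) (simp_all add: rat_const_simps)
  have rTiT: "rat_const Ti * (rat_const T * X) = X" if "dim_row X = \<delta>" for X
    using that arg_cong[OF T(4), of rat_const] by (intro mat_inv_cancel[of _ _ \<delta>]) (simp_all add: rat_const_simps)
  have rTTi: "rat_const T * (rat_const Ti * X) = X" if "dim_row X = \<delta>" for X
    using that arg_cong[OF T(3), of rat_const] by (intro mat_inv_cancel[of _ _ \<delta>]) (simp_all add: rat_const_simps)
  have fa: "rat_const ?au * f = rat_const U * r" "rat_const ?av * f = rat_const V * r" "rat_const Rd * f = rat_const T * r"
    "rat_const ?Ku * f = rat_const T * (rat_const W * r)"
    unfolding f_def by (simp_all add: rat_const_simps mat_assoc rRS rTiT)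
  have stt: "rat_var \<cdot>\<^sub>m (rat_const bv + rat_const Rd * f) = rat_const bu * G + rat_const ?Ku * f"
  proof -
    have "(rat_var \<cdot>\<^sub>m 1\<^sub>m \<delta> - rat_const W) * r = rat_const Ti * (g - rat_var \<cdot>\<^sub>m b)"
      unfolding r_def by (rule mat_inv_cancel[OF resolvent_inverse(2)[OF W]]) simp_all
    then have "rat_const T * ((rat_var \<cdot>\<^sub>m 1\<^sub>m \<delta> - rat_const W) * r) = g - rat_var \<cdot>\<^sub>m b" by (simp add: rTTi)
    then have "rat_var \<cdot>\<^sub>m (rat_const T * r) - rat_const T * (rat_const W * r) = g - rat_var \<cdot>\<^sub>m b" by (simp add: mat_ring)
    from mat_eq_of_diff[OF this]
    have "rat_var \<cdot>\<^sub>m (rat_const T * r) + rat_var \<cdot>\<^sub>m b = g + rat_const T * (rat_const W * r)" by simp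
    then show ?thesis unfolding fa g_def b_def by (simp add: mat_ring mat_ac)
  qed
  note loop = closed_loop_realization[OF M(1) c(1) M(3) c(3) M(2) c(2) M(4) Sq(2) dcba un(2)[unfolded uv] Gr assms(12)[unfolded uv] fc stt refl refl,
    unfolded fa]
  have cols: "?mu + rat_const U * r \<in> carrier_mat p p" "?mv + rat_const V * r \<in> carrier_mat p p" by (auto intro: carrier_matI)
  have Thc: "Theta_hat W U V \<in> carrier_mat (p + p) (p + p)" unfolding That by (simp add: carrier_matI)
  note lft = lft_of_columns[OF Thc Gc Tap cols]
  have Uc: "\<U> \<in> carrier_mat (p + \<delta>) (p + \<delta>)" "\<V> \<in> carrier_mat (p + \<delta>) (p + \<delta>)" unfolding uv by (auto intro: carrier_matI)
  have Ra: "unitary_mat R'"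
    unfolding assms(12)
  proof (intro unitary_mult[of _ _ "p + \<delta> + k"])
    show "unitary_mat (four_block_mat \<U> (0\<^sub>m (p + \<delta>) k) (0\<^sub>m k (p + \<delta>)) (1\<^sub>m k))"
      by (rule unitary_diag_one[OF unitary_matI(1)[OF Uc(1) un(1)] Uc(1)])
    show "unitary_mat (four_block_mat (\<V>\<^sup>\<dagger>) (0\<^sub>m (p + \<delta>) k) (0\<^sub>m k (p + \<delta>)) (1\<^sub>m k))"
      by (rule unitary_diag_one[OF unitary_adj[OF unitary_matI(1)[OF Uc(2) un(2)]] adj_carrier[OF Uc(2)]])
    show "unitary_mat (four_block_mat (four_block_mat D (0\<^sub>m p \<delta>) (0\<^sub>m \<delta> p) (1\<^sub>m \<delta>)) (C @\<^sub>r 0\<^sub>m \<delta> k) (B @\<^sub>c 0\<^sub>m k \<delta>) A)"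
      by (rule unitary_insert_identity[OF dcba assms(10)[unfolded assms(9)]])
  qed (use Uc dcba in \<open>auto intro: carrier_matI\<close>)
  from coup Ra lft loop show ?thesis by simp
qed

end
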